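(* Let $1/n\ll\gamma,\epsilon,\mu\ll\zeta,1/k$ and $k\mid n$. Let $J$ be a $k$-complex on $n$ vertices satisfying $\delta(J)\ge(n,\zeta n,\dots,\zeta n)$ and (i) every induced subcomplex $J'$ of $J$ on at least $n-\epsilon n$ vertices has at least $\ell=\gamma|V(J')|$ perfect fractional matchings $g_1,\dots,g_\ell$ of $J'_k$ satisfying $\sum_{e\in J'_k:\,u,v\in e}\sum_{i=1}^{\ell}g_i(e)\le 2$ for every pair of distinct vertices $u,v$ of $J'$; (ii) $L^\mu_{\mathcal{P}}(J_k)$ is complete for every partition $\mathcal{P}$ of $V(J)$ whose parts each have size at least $(\zeta-\mu)n$. Then $J_k$ contains a perfect matching.
   Context: Hierarchy convention: "$a\ll b$" means that for every $b>0$ there is $a_0>0$ such that the statement holds for all $0<a\le a_0$; longer hierarchies are read analogously. A $k$-complex is a hypergraph $J$ in which every edge has at most $k$ vertices and every subset of an edge is an edge; $J_i$ is the set of edges of size exactly $i$. For an $i$-edge $e$, $\deg_J(e)$ is the number of $(i+1)$-edges of $J$ containing $e$; $\delta_i(J)$ is the minimum of $\deg_J(e)$ over $e\in J_i$, and $\delta(J)=(\delta_0(J),\dots,\delta_{k-1}(J))$, compared coordinatewise. A perfect fractional matching of a $k$-graph $H$ is $g:E(H)\to[0,1]$ with $\sum_{e\ni v}g(e)=1$ for every vertex $v$. For a partition $\mathcal{P}=\{V_1,\dots,V_d\}$ of $V$, the index vector of $S$ is $\mathbf{i}_{\mathcal{P}}(S)=(|S\cap V_1|,\dots,|S\cap V_d|)$.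 A $k$-vector is a nonnegative integer vector with coordinate sum $k$. A $k$-vector $\mathbf{v}$ is a $\mu$-robust edge-vector of $J_k$ if at least $\mu|V|^k$ edges $e\in J_k$ have $\mathbf{i}_{\mathcal{P}}(e)=\mathbf{v}$; $L^\mu_{\mathcal{P}}(J_k)$ is the lattice in $\mathbb{Z}^d$ generated by these vectors; it is complete if it contains all $k$-vectors of $\mathbb{Z}^d$. *)

theory Defs
  imports Complex_Main "HOL-Library.Disjoint_Sets"
begin

definition k_complex :: "nat \<Rightarrow> 'a set \<Rightarrow> 'a set set \<Rightarrow> bool" where
  "k_complex k V J \<longleftrightarrow> finite V \<and> (\<forall>e\<in>J. e \<subseteq> V \<and> card e \<le> k)
     \<and> (\<forall>e\<in>J. \<forall>f. f \<subseteq> e \<longrightarrow> f \<in> J)"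

definition layer :: "'a set set \<Rightarrow> nat \<Rightarrow> 'a set set" where
  "layer J i = {e \<in> J. card e = i}"

definition cdeg :: "'a set set \<Rightarrow> 'a set \<Rightarrow> nat" where
  "cdeg J e = card {f \<in> layer J (Suc (card e)). e \<subseteq> f}"

text \<open>delta(J) >= (n, zeta n, ..., zeta n) coordinatewise, i.e. delta_0(J) >= n and
  delta_i(J) >= zeta n for 1 <= i <= k-1 (the minimum over an empty layer imposes nothing).\<close>
definition min_deg_cond :: "nat \<Rightarrow> 'a set set \<Rightarrow> nat \<Rightarrow> real \<Rightarrow> bool" where
  "min_deg_cond k J n \<zeta> \<longleftrightarrow>
     (\<forall>e\<in>layer J 0. cdeg J e \<ge> n) \<and>
     (\<forall>i. 1 \<le> i \<and> i \<le> k - 1 \<longrightarrow> (\<forall>e\<in>layer J i. real (cdeg J e) \<ge> \<zeta> * real n))"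

definition induced :: "'a set set \<Rightarrow> 'a set \<Rightarrow> 'a set set" where
  "induced J U = {e \<in> J. e \<subseteq> U}"

definition perfect_fractional_matching :: "'a set \<Rightarrow> 'a set set \<Rightarrow> ('a set \<Rightarrow> real) \<Rightarrow> bool" where
  "perfect_fractional_matching U E g \<longleftrightarrow>
     (\<forall>e\<in>E. 0 \<le> g e \<and> g e \<le> 1) \<and> (\<forall>v\<in>U. (\<Sum>e\<in>{e\<in>E. v \<in> e}. g e) = 1)"

definition perfect_matching :: "'a set \<Rightarrow> 'a set set \<Rightarrow> 'a set set \<Rightarrow> bool" where
  "perfect_matching V E M \<longleftrightarrow> M \<subseteq> E \<and> \<Union>M = V \<and>
     (\<forall>e\<in>M. \<forall>f\<in>M. e \<noteq> f \<longrightarrow> e \<inter> f = {})"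

text \<open>Index vectors are indexed by the parts of the partition P (a vector in Z^P,
  zero outside P).\<close>
definition index_vec :: "'a set set \<Rightarrow> 'a set \<Rightarrow> ('a set \<Rightarrow> int)" where
  "index_vec P S = (\<lambda>X. if X \<in> P then int (card (S \<inter> X)) else 0)"

definition k_vector :: "'a set set \<Rightarrow> nat \<Rightarrow> ('a set \<Rightarrow> int) \<Rightarrow> bool" where
  "k_vector P k v \<longleftrightarrow> (\<forall>X. X \<notin> P \<longrightarrow> v X = 0) \<and> (\<forall>X\<in>P. v X \<ge> 0)
     \<and> (\<Sum>X\<in>P. v X) = int k"

definition robust_edge_vector ::
  "'a set \<Rightarrow> 'a set set \<Rightarrow> nat \<Rightarrow> real \<Rightarrow> 'a set set \<Rightarrow> ('a set \<Rightarrow> int) \<Rightarrow> bool" where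
  "robust_edge_vector V P k \<mu> Jk v \<longleftrightarrow> k_vector P k v \<and>
     real (card {e \<in> Jk. index_vec P e = v}) \<ge> \<mu> * real (card V) ^ k"

definition lattice_gen :: "('a set \<Rightarrow> int) set \<Rightarrow> ('a set \<Rightarrow> int) set" where
  "lattice_gen B = {v. \<exists>F c. finite F \<and> F \<subseteq> B \<and> v = (\<lambda>X. \<Sum>w\<in>F. c w * w X)}"

definition robust_lattice :: "'a set \<Rightarrow> 'a set set \<Rightarrow> nat \<Rightarrow> real \<Rightarrow> 'a set set \<Rightarrow> ('a set \<Rightarrow> int) set" where
  "robust_lattice V P k \<mu> Jk = lattice_gen {v. robust_edge_vector V P k \<mu> Jk v}"

definition complete_lattice_of :: "'a set set \<Rightarrow> nat \<Rightarrow> ('a set \<Rightarrow> int) set \<Rightarrow> bool" where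
  "complete_lattice_of P k L \<longleftrightarrow> (\<forall>v. k_vector P k v \<longrightarrow> v \<in> L)"

end

theory Submission
  imports Defs "HOL-Library.Multiset"
begin

text \<open>The proof combines a nibble with lattice-based absorption.

  Averaging the fractional matchings gives edge weights with all degrees 1 and all codegrees
  \<open>O(1/n)\<close>. Choosing the edges of a matching greedily, each time at least as well as a random edge
  drawn proportionally to the weights, keeps the quadratic deviation of the weighted degrees
  from their ideal value \<open>p ^ (k - 1)\<close> bounded while the proportion \<open>p\<close> of uncovered vertices
  stays above a constant; hence the matching leaves only \<open>\<alpha> n\<close> vertices uncovered.

  Two vertices are reachable if positively many tuples can be completed to a matchable set by
  either of them. The minimum degree condition splits \<open>V\<close> into boundedly many parts of size at least
  \<open>(\<zeta> - \<mu>) n\<close> within which all pairs are reachable. Completeness of the lattice writes the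
  difference of two unit vectors as a bounded integer combination of robust edge-vectors, and
  exchanging the corresponding edges makes any two vertices reachable across parts as well. So every
  \<open>k\<close>-set has positively many absorbers, and a greedily chosen small family of disjoint absorbers
  swallows whatever the nibble leaves.\<close>

section \<open>Weighted degrees and the greedy nibble\<close>

text \<open>The target p^(k - 1) is the chance that the other k - 1 vertices of an edge are all
  uncovered, if uncovered vertices behaved like a random set of density p. A quadratic potential
  replaces concentration inequalities: in its average change under one step the first-order terms
  cancel, leaving a factor 1 + O(1/n) and an additive O(1/n), and there are at most n steps.

  The obstacle in the absorption is uniformity. The linear number of absorbers of a k-set has to be
  fixed before V and J are known, so the number of parts, the length of the connecting tuples and
  the size of the lattice coefficients must all be bounded in terms of k, \<zeta> and \<mu>.
  Existence statements therefore put their constants in front of the quantifiers over V and J.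

  The same constant dictates the order of the construction. The absorbing family is set aside first,
  on so few vertices that (i) still applies to the rest; the nibble then runs on the rest with the
  \<alpha> that the family can swallow, so that the k-sets into which the leftover is cut find
  distinct absorbers.\<close>

definition wdeg :: "('a set \<Rightarrow> real) \<Rightarrow> 'a set set \<Rightarrow> 'a \<Rightarrow> real" where
  "wdeg w E v = (\<Sum>e\<in>E. w e * of_bool (v \<in> e))"

definition wcod :: "('a set \<Rightarrow> real) \<Rightarrow> 'a set set \<Rightarrow> 'a \<Rightarrow> 'a \<Rightarrow> real" where
  "wcod w E u v = (\<Sum>e\<in>E. w e * of_bool (u \<in> e) * of_bool (v \<in> e))"

lemma sum_of_bool_mem: "finite A \<Longrightarrow> e \<subseteq> A \<Longrightarrow> (\<Sum>v\<in>A. of_bool (v \<in> e)) = (real (card e))"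
  by (simp add: inf.absorb2 Int_commute flip: Int_def)

text \<open>Degrees and codegrees are bounded from above only, because such bounds pass to the edges
  that avoid a partial matching, whereas the degrees are equal to 1 just at the start.\<close>

locale weighted_hypergraph =
  fixes k :: nat and A :: "'a set" and E :: "'a set set" and w :: "'a set \<Rightarrow> real" and \<kappa> :: real
  assumes k2: "2 \<le> k" and finA: "finite A"
    and edge: "\<And>e. e \<in> E \<Longrightarrow> e \<subseteq> A" "\<And>e. e \<in> E \<Longrightarrow> card e = k"
    and w_nonneg: "\<And>e. 0 \<le> w e"
    and deg_le: "\<And>v. v \<in> A \<Longrightarrow> wdeg w E v \<le> 1"
    and cod_le: "\<And>u v. u \<in> A \<Longrightarrow> v \<in> A \<Longrightarrow> u \<noteq> v \<Longrightarrow> wcod w E u v \<le> \<kappa>"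
    and kappa_nonneg: "0 \<le> \<kappa>"
begin

lemma finE: "finite E"
  by (rule finite_subset[of _ "Pow A"]) (use edge(1) finA in auto)

lemma fin_edge: "e \<in> E \<Longrightarrow> finite e"
  using edge(1) finA finite_subset by blast

definition loss :: "'a set \<Rightarrow> 'a \<Rightarrow> real" where
  "loss e v = wdeg w E v - wdeg w {f\<in>E. f \<inter> e = {}} v"

text \<open>Linearised \<open>loss\<close>: for v outside e, an edge at v that meets e in c vertices
  counts c times instead of once. Being a sum of codegrees, it can be averaged over e by exchanging
  sums.\<close>

definition cods :: "'a set \<Rightarrow> 'a \<Rightarrow> real" where
  "cods e v = (\<Sum>u\<in>e - {v}. wcod w E u v)"

lemma wdeg_nonneg: "0 \<le> wdeg w E v"
  unfolding wdeg_def by (intro sum_nonneg) (simp add: w_nonneg)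

lemma wcod_nonneg: "0 \<le> wcod w E u v"
  unfolding wcod_def by (intro sum_nonneg) (simp add: w_nonneg)

lemma wcod_commute: "wcod w E u v = wcod w E v u"
  unfolding wcod_def by (simp add: mult_ac)

lemma sum_wdeg: "(\<Sum>v\<in>A. wdeg w E v) = real k * sum w E"
proof -
  have "(\<Sum>v\<in>A. wdeg w E v) = (\<Sum>e\<in>E. \<Sum>v\<in>A. w e * of_bool (v \<in> e))"
    unfolding wdeg_def by (rule sum.swap)
  also have "\<dots> = (\<Sum>e\<in>E. w e * real k)"
    using edge finA by (intro sum.cong refl) (simp add: sum_distrib_left[symmetric] sum_of_bool_mem del: sum_of_bool_eq)
  finally show ?thesis by (simp add: sum_distrib_left mult.commute)
qed

lemma sum_wcod:
  assumes "v \<in> A"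
  shows "(\<Sum>u\<in>A - {v}. wcod w E u v) = (real k - 1) * wdeg w E v"
proof -
  have "(\<Sum>u\<in>A-{v}. wcod w E u v) = (\<Sum>e\<in>E. \<Sum>u\<in>A-{v}. w e * of_bool (v \<in> e) * of_bool (u \<in> e))"
    unfolding wcod_def by (subst sum.swap) (simp add: mult_ac)
  also have "\<dots> = (\<Sum>e\<in>E. w e * of_bool (v \<in> e) * (real k - 1))"
  proof (intro sum.cong refl)
    fix e assume e: "e \<in> E"
    have "(\<Sum>u\<in>A-{v}. of_bool (u \<in> e)) = (\<Sum>u\<in>A. of_bool (u \<in> e)) - (of_bool (v \<in> e) :: real)"
      using finA assms by (simp add: sum_diff1 del: sum_of_bool_eq)
    also have "\<dots> = real k - of_bool (v \<in> e)"
      using e edge finA by (simp add: sum_of_bool_mem del: sum_of_bool_eq)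
    finally show "(\<Sum>u\<in>A-{v}. w e * of_bool (v \<in> e) * of_bool (u \<in> e)) = w e * of_bool (v \<in> e) * (real k - 1)"
      by (simp add: sum_distrib_left[symmetric] del: sum_of_bool_eq)
  qed
  finally show ?thesis
    by (simp add: wdeg_def sum_distrib_left mult.commute)
qed

lemma loss_eq: "loss e v = (\<Sum>f\<in>E. w f * of_bool (v \<in> f) * of_bool (f \<inter> e \<noteq> {}))"
proof -
  have "wdeg w {f\<in>E. f \<inter> e = {}} v = (\<Sum>f\<in>E. w f * of_bool (v \<in> f) * of_bool (f \<inter> e = {}))"
    unfolding wdeg_def by (subst sum.inter_filter[OF finE]) (auto intro!: sum.cong)
  then show ?thesis unfolding loss_def wdeg_def
    by (auto simp: sum_subtractf[symmetric] intro!: sum.cong)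
qed

lemma cods_eq:
  assumes "e \<in> E" "v \<notin> e"
  shows "cods e v = (\<Sum>f\<in>E. w f * of_bool (v \<in> f) * real (card (f \<inter> e)))"
proof -
  have "cods e v = (\<Sum>f\<in>E. \<Sum>u\<in>e. w f * of_bool (v \<in> f) * of_bool (u \<in> f))"
    unfolding cods_def wcod_def using assms by (subst sum.swap) (simp add: mult_ac)
  also have "\<dots> = (\<Sum>f\<in>E. w f * of_bool (v \<in> f) * real (card (f \<inter> e)))"
  proof (intro sum.cong refl)
    fix f assume "f \<in> E"
    have "(\<Sum>u\<in>e. of_bool (u \<in> f)) = real (card (f \<inter> e))"
      using fin_edge[OF assms(1)] by (simp add: Int_def conj_commute)
    then show "(\<Sum>u\<in>e. w f * of_bool (v \<in> f) * of_bool (u \<in> f)) = w f * of_bool (v \<in> f) * real (card (f \<inter> e))"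
      by (simp add: sum_distrib_left[symmetric] del: sum_of_bool_eq)
  qed
  finally show ?thesis .
qed

lemma loss_nonneg: "0 \<le> loss e v"
  unfolding loss_eq by (intro sum_nonneg) (simp add: w_nonneg)

lemma cods_nonneg: "0 \<le> cods e v"
  unfolding cods_def by (intro sum_nonneg) (simp add: wcod_nonneg)

lemma loss_le_cods:
  assumes "e \<in> E" "v \<notin> e"
  shows "loss e v \<le> cods e v"
  unfolding loss_eq cods_eq[OF assms]
proof (intro sum_mono mult_left_mono)
  fix f assume f: "f \<in> E"
  show "of_bool (f \<inter> e \<noteq> {}) \<le> real (card (f \<inter> e))"
    using fin_edge[OF f] by (auto simp: of_bool_def Suc_le_eq card_gt_0_iff)
qed (simp add: w_nonneg)

lemma cods_le:
  assumes "e \<in> E" "v \<in> A"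
  shows "cods e v \<le> real k * \<kappa>"
proof -
  have "cods e v \<le> (\<Sum>u\<in>e - {v}. \<kappa>)"
    unfolding cods_def using assms edge(1)[OF assms(1)] by (intro sum_mono cod_le) auto
  also have "\<dots> = real (card (e - {v})) * \<kappa>" by simp
  also have "\<dots> \<le> real k * \<kappa>"
    using card_Diff1_le[of e v] edge(2)[OF assms(1)] kappa_nonneg by (intro mult_right_mono) auto
  finally show ?thesis .
qed

lemma sum_cods_le:
  assumes "e \<in> E"
  shows "(\<Sum>v\<in>A. cods e v) \<le> real k ^ 2"
proof -
  have eA: "e \<subseteq> A" and fe: "finite e" using edge fin_edge assms by auto
  have "(\<Sum>v\<in>A. cods e v) = (\<Sum>v\<in>A. \<Sum>u\<in>e. if u \<noteq> v then wcod w E u v else 0)"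
    unfolding cods_def using fe
    by (intro sum.cong refl sum.mono_neutral_cong_left) auto
  also have "\<dots> = (\<Sum>u\<in>e. \<Sum>v\<in>A. if u \<noteq> v then wcod w E u v else 0)"
    by (rule sum.swap)
  also have "\<dots> = (\<Sum>u\<in>e. \<Sum>v\<in>A-{u}. wcod w E v u)"
    using finA by (intro sum.cong refl sum.mono_neutral_cong_right) (auto simp: wcod_commute)
  also have "\<dots> = (\<Sum>u\<in>e. (real k - 1) * wdeg w E u)"
    using eA by (intro sum.cong refl sum_wcod) auto
  also have "\<dots> \<le> (\<Sum>u\<in>e. real k * 1)"
    using eA k2 deg_le wdeg_nonneg by (intro sum_mono mult_mono) auto
  also have "\<dots> = real k ^ 2" using edge(2)[OF assms] by (simp add: power2_eq_square)
  finally show ?thesis .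
qed

text \<open>If f meets e in c > 0 vertices, it is overcounted c - 1 times at each of its vertices
  outside e. This is at most c (c - 1), the number of ordered pairs of distinct vertices of e inside
  f. Summing over f turns these pairs into codegrees of pairs in e, and the vertices of f outside e
  give one more factor k.\<close>

lemma sum_cods_diff_loss_le:
  assumes "e \<in> E"
  shows "(\<Sum>v\<in>A - e. cods e v - loss e v) \<le> real k ^ 3 * \<kappa>"
proof -
  have eA: "e \<subseteq> A" and fe: "finite e" using edge fin_edge assms by auto
  have "(\<Sum>v\<in>A - e. cods e v - loss e v)
      = (\<Sum>v\<in>A-e. \<Sum>f\<in>E. w f * of_bool (v \<in> f) * (real (card (f \<inter> e)) - of_bool (f \<inter> e \<noteq> {})))"
    using assms by (intro sum.cong refl) (simp add: cods_eq loss_eq sum_subtractf[symmetric] algebra_simps)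
  also have "\<dots> = (\<Sum>f\<in>E. \<Sum>v\<in>A-e. of_bool (v \<in> f) * (w f * (real (card (f \<inter> e)) - of_bool (f \<inter> e \<noteq> {}))))"
    by (subst sum.swap) (simp add: mult_ac)
  also have "\<dots> \<le> (\<Sum>f\<in>E. real k * (w f * (\<Sum>u\<in>e. \<Sum>u'\<in>e - {u}. of_bool (u \<in> f) * of_bool (u' \<in> f))))"
  proof (intro sum_mono)
    fix f assume f: "f \<in> E"
    let ?c = "card (f \<inter> e)"
    have ff: "finite f" using fin_edge f by auto
    have "(\<Sum>v\<in>A-e. of_bool (v \<in> f)) = (\<Sum>v\<in>(A-e) \<inter> f. 1::real)"
      using finA by (simp add: Int_def)
    also have "\<dots> \<le> real k"
      using edge(2)[OF f] ff by (simp) (metis Int_lower2 card_mono)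
    finally have 1: "(\<Sum>v\<in>A-e. of_bool (v \<in> f)) \<le> real k" .
    have "(\<Sum>u\<in>e. \<Sum>u'\<in>e - {u}. of_bool (u \<in> f) * of_bool (u' \<in> f)) = (\<Sum>u\<in>e. of_bool (u \<in> f) * (real ?c - 1))"
    proof (intro sum.cong refl)
      fix u assume u: "u \<in> e"
      have "(\<Sum>u'\<in>e - {u}. of_bool (u' \<in> f)) = (\<Sum>u'\<in>e. of_bool (u' \<in> f)) - (of_bool (u \<in> f)::real)"
        using fe u by (simp add: sum_diff1 del: sum_of_bool_eq)
      also have "\<dots> = real ?c - of_bool (u \<in> f)" using fe by (simp add: Int_def conj_commute)
      finally show "(\<Sum>u'\<in>e - {u}. of_bool (u \<in> f) * of_bool (u' \<in> f)) = of_bool (u \<in> f) * (real ?c - 1)"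
        by (simp add: sum_distrib_left[symmetric] del: sum_of_bool_eq)
    qed
    also have "\<dots> = real ?c * (real ?c - 1)"
      using fe by (simp add: sum_distrib_right[symmetric] Int_def conj_commute)
    finally have 2: "(\<Sum>u\<in>e. \<Sum>u'\<in>e - {u}. of_bool (u \<in> f) * of_bool (u' \<in> f)) = real ?c * (real ?c - 1)" .
    have 3: "real ?c - of_bool (f \<inter> e \<noteq> {}) \<le> real ?c * (real ?c - 1)"
    proof (cases "f \<inter> e = {}")
      case False
      then have "?c \<ge> 1" using ff by (simp add: Suc_le_eq card_gt_0_iff)
      then have "real ?c \<ge> 1" by simp
      then have "1 * (real ?c - 1) \<le> real ?c * (real ?c - 1)" by (intro mult_right_mono) auto
      with False show ?thesis by simp
    qed simp
    have 4: "0 \<le> real ?c - of_bool (f \<inter> e \<noteq> {})"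
      using ff by (auto simp: of_bool_def Suc_le_eq card_gt_0_iff)
    have "(\<Sum>v\<in>A-e. of_bool (v \<in> f) * (w f * (real ?c - of_bool (f \<inter> e \<noteq> {}))))
        = (\<Sum>v\<in>A-e. of_bool (v \<in> f)) * (w f * (real ?c - of_bool (f \<inter> e \<noteq> {})))"
      by (simp only: sum_distrib_right)
    also have "\<dots> \<le> real k * (w f * (real ?c * (real ?c - 1)))"
      using 1 3 4 w_nonneg by (intro mult_mono) (auto simp: mult_left_mono)
    finally show "(\<Sum>v\<in>A-e. of_bool (v \<in> f) * (w f * (real ?c - of_bool (f \<inter> e \<noteq> {}))))
      \<le> real k * (w f * (\<Sum>u\<in>e. \<Sum>u'\<in>e - {u}. of_bool (u \<in> f) * of_bool (u' \<in> f)))"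
      unfolding 2 .
  qed
  also have "\<dots> = real k * (\<Sum>u\<in>e. \<Sum>u'\<in>e - {u}. wcod w E u u')"
    unfolding wcod_def sum_distrib_left
    apply (subst sum.swap) apply (intro sum.cong refl) apply (subst sum.swap)
    by (simp add: mult_ac)
  also have "\<dots> \<le> real k * (\<Sum>u\<in>e. real k * \<kappa>)"
  proof (intro mult_left_mono sum_mono)
    fix u assume "u \<in> e"
    then show "(\<Sum>u'\<in>e - {u}. wcod w E u u') \<le> real k * \<kappa>"
      using cods_le[OF assms, of u] eA by (auto simp: cods_def wcod_commute[of u])
  qed simp
  also have "\<dots> = real k ^ 3 * \<kappa>" using edge(2)[OF assms] by (simp add: power3_eq_cube)
  finally show ?thesis .
qed

text \<open>Up to normalisation, this is the average linearised effect of deleting an edge drawn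
  with probability proportional to \<open>w\<close>: the vertex u lies in the drawn edge with weight
  \<open>wdeg w E u\<close>.\<close>

lemma sum_weight_cods:
  "(\<Sum>e\<in>E. w e * (\<Sum>v\<in>A. x v * cods e v)) = (\<Sum>v\<in>A. x v * (\<Sum>u\<in>A-{v}. wcod w E u v * wdeg w E u))"
proof -
  have "(\<Sum>e\<in>E. w e * (\<Sum>v\<in>A. x v * cods e v)) = (\<Sum>e\<in>E. \<Sum>v\<in>A. \<Sum>u\<in>A-{v}. x v * wcod w E u v * (w e * of_bool (u \<in> e)))"
    unfolding sum_distrib_left
  proof (intro sum.cong refl)
    fix e v assume e: "e \<in> E" and v: "v \<in> A"
    have "cods e v = (\<Sum>u\<in>A-{v}. wcod w E u v * of_bool (u \<in> e))"
      unfolding cods_def using finA edge(1)[OF e] by (intro sum.mono_neutral_cong_left) auto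
    then show "w e * (x v * cods e v) = (\<Sum>u\<in>A-{v}. x v * wcod w E u v * (w e * of_bool (u \<in> e)))"
      by (simp add: sum_distrib_left mult_ac)
  qed
  also have "\<dots> = (\<Sum>v\<in>A. \<Sum>u\<in>A-{v}. \<Sum>e\<in>E. x v * wcod w E u v * (w e * of_bool (u \<in> e)))"
    apply (subst sum.swap) apply (intro sum.cong refl) by (rule sum.swap)
  also have "\<dots> = (\<Sum>v\<in>A. x v * (\<Sum>u\<in>A-{v}. wcod w E u v * wdeg w E u))"
    by (simp add: wdeg_def sum_distrib_left mult_ac)
  finally show ?thesis .
qed

end

text \<open>Error of the tangent to the m-th power at p. The error for \<open>Suc m\<close> is p
  times the error for m plus h times the drop of the m-th power, and since p \<le> 1 that drop is at
  most m h.\<close>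

lemma power_diff_linear_approx:
  fixes p h :: real
  assumes "0 \<le> h" "h \<le> p" "p \<le> 1"
  shows "0 \<le> real m * p ^ (m - 1) * h - (p ^ m - (p - h) ^ m)
    \<and> real m * p ^ (m - 1) * h - (p ^ m - (p - h) ^ m) \<le> (real m)\<^sup>2 * h\<^sup>2"
proof (induction m)
  case (Suc m)
  let ?D = "\<lambda>m. real m * p ^ (m - 1) * h - (p ^ m - (p - h) ^ m)"
  define a where "a = real m * p ^ (m - 1) * h"
  have pm: "p * a = real m * p ^ m * h"
    unfolding a_def by (cases m) (auto simp: algebra_simps)
  have "?D (Suc m) = p * (a - (p ^ m - (p - h) ^ m)) + h * (p ^ m - (p - h) ^ m)"
    using pm by (simp add: algebra_simps)
  then have eq: "?D (Suc m) = p * ?D m + h * (p ^ m - (p - h) ^ m)"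
    unfolding a_def .
  have mono: "0 \<le> p ^ m - (p - h) ^ m"
    using assms power_mono[of "p - h" p m] by simp
  have "p ^ m - (p - h) ^ m \<le> real m * p ^ (m - 1) * h" using Suc by simp
  also have "\<dots> \<le> real m * 1 * h"
    using assms by (intro mult_right_mono mult_left_mono power_le_one) auto
  finally have lip: "p ^ m - (p - h) ^ m \<le> real m * h" by simp
  have lo: "0 \<le> p * ?D m" using Suc assms by (intro mult_nonneg_nonneg) auto
  have "p * ?D m \<le> 1 * ((real m)\<^sup>2 * h\<^sup>2)"
    using Suc assms by (intro mult_mono) auto
  moreover have "h * (p ^ m - (p - h) ^ m) \<le> h * (real m * h)"
    using lip assms by (intro mult_left_mono) auto
  moreover have "(real m)\<^sup>2 * h\<^sup>2 + h * (real m * h) \<le> (real (Suc m))\<^sup>2 * h\<^sup>2"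
    using assms by (simp add: power2_eq_square algebra_simps)
  moreover have "0 \<le> h * (p ^ m - (p - h) ^ m)" using mono assms by simp
  ultimately show ?case using lo eq by linarith
qed simp

lemma sum_squared_le: "finite A \<Longrightarrow> (\<Sum>v\<in>A. x v)\<^sup>2 \<le> real (card A) * (\<Sum>v\<in>A. (x v)\<^sup>2 :: real)"
proof (cases "A = {}")
  case False
  assume fin: "finite A"
  let ?n = "real (card A)" and ?S = "\<Sum>v\<in>A. x v"
  have n: "0 < ?n" using fin False by (simp add: card_gt_0_iff)
  have "0 \<le> (\<Sum>v\<in>A. (?n * x v - ?S)\<^sup>2)" by (intro sum_nonneg) simp
  also have "\<dots> = (\<Sum>v\<in>A. ?n\<^sup>2 * (x v)\<^sup>2 - 2 * ?n * ?S * x v + ?S\<^sup>2)"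
    by (intro sum.cong refl) (simp add: power2_diff power_mult_distrib algebra_simps)
  also have "\<dots> = ?n\<^sup>2 * (\<Sum>v\<in>A. (x v)\<^sup>2) - 2 * ?n * ?S * ?S + ?n * ?S\<^sup>2"
    by (simp only: sum.distrib sum_subtractf sum_distrib_left sum_constant)
  also have "\<dots> = ?n * (?n * (\<Sum>v\<in>A. (x v)\<^sup>2) - ?S\<^sup>2)"
    by (simp add: power2_eq_square algebra_simps)
  finally show ?thesis using n by (simp add: zero_le_mult_iff)
qed simp

section \<open>Change of the squared deviation when one edge is removed\<close>

context weighted_hypergraph
begin

text \<open>The deviation x at v becomes x - (loss - \<delta>), and the square is expanded. In the
  linear term \<open>loss\<close> is replaced by \<open>cods\<close>, which costs at most
  \<open>cods - loss\<close> since |x| \<le> 1; the quadratic term is small because a single loss is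
  at most k \<kappa>. The vertices of e leave the sum, which accounts for the last error term. With
  \<kappa> and \<delta> of order 1/N the whole bracket is O(1/N).\<close>

lemma squared_deviation_after_removal:
  assumes e: "e \<in> E" and P: "0 \<le> P" "P \<le> 1" and \<delta>: "0 \<le> \<delta>" and N: "real (card A) \<le> N"
  shows "(\<Sum>v\<in>A - e. (wdeg w {f\<in>E. f \<inter> e = {}} v - (P - \<delta>))\<^sup>2)
     \<le> (\<Sum>v\<in>A. (wdeg w E v - P)\<^sup>2) - 2 * (\<Sum>v\<in>A. (wdeg w E v - P) * (cods e v - \<delta>))
       + (4 * real k ^ 3 * \<kappa> + 2 * N * \<delta>\<^sup>2 + 2 * real k * (real k * \<kappa> + \<delta>))"
proof -
  define x where "x v = wdeg w E v - P" for v
  have eA: "e \<subseteq> A" and fe: "finite e" using edge fin_edge e by auto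
  have absx: "\<bar>x v\<bar> \<le> 1" if "v \<in> A" for v
    using deg_le[OF that] wdeg_nonneg[of v] P unfolding x_def by auto
  have pt: "(wdeg w {f\<in>E. f \<inter> e = {}} v - (P - \<delta>))\<^sup>2
     \<le> ((x v)\<^sup>2 - 2 * (x v * (cods e v - \<delta>))) + 2 * (cods e v - loss e v) + 2 * (real k * \<kappa> * cods e v) + 2 * \<delta>\<^sup>2"
    if v: "v \<in> A - e" for v
  proof -
    let ?l = "loss e v" and ?c = "cods e v"
    have lc: "?l \<le> ?c" using loss_le_cods e v by auto
    have "?l * ?l \<le> (real k * \<kappa>) * ?c"
      using lc loss_nonneg cods_le[OF e] v order_trans[OF lc cods_le[OF e]] kappa_nonneg by (intro mult_mono) auto
    moreover have "x v * (?c - ?l) \<le> 1 * (?c - ?l)"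
      using absx[of v] v lc by (intro mult_right_mono) auto
    moreover have "(?l - \<delta>)\<^sup>2 \<le> 2 * ?l\<^sup>2 + 2 * \<delta>\<^sup>2"
      using zero_le_power2[of "?l + \<delta>"] by (simp add: power2_eq_square algebra_simps)
    moreover have "(wdeg w {f\<in>E. f \<inter> e = {}} v - (P - \<delta>))\<^sup>2 = (x v - (?l - \<delta>))\<^sup>2"
      unfolding x_def loss_def by (rule arg_cong[where f = "\<lambda>t. t\<^sup>2"]) simp
    moreover have "(x v - (?l - \<delta>))\<^sup>2 = (x v)\<^sup>2 - 2 * (x v * (?c - \<delta>)) + 2 * (x v * (?c - ?l)) + (?l - \<delta>)\<^sup>2"
      by (simp add: power2_eq_square algebra_simps)
    ultimately show ?thesis unfolding power2_eq_square[of "loss e v"] by linarith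
  qed
  let ?h = "\<lambda>v. (x v)\<^sup>2 - 2 * (x v * (cods e v - \<delta>))"
  have "(\<Sum>v\<in>A - e. (wdeg w {f\<in>E. f \<inter> e = {}} v - (P - \<delta>))\<^sup>2)
    \<le> (\<Sum>v\<in>A - e. ?h v + 2 * (cods e v - loss e v) + 2 * (real k * \<kappa> * cods e v) + 2 * \<delta>\<^sup>2)"
    by (intro sum_mono pt)
  also have "\<dots> = (\<Sum>v\<in>A-e. ?h v) + 2 * (\<Sum>v\<in>A-e. cods e v - loss e v) + 2 * (real k * \<kappa> * (\<Sum>v\<in>A-e. cods e v)) + 2 * \<delta>\<^sup>2 * real (card (A - e))"
    by (simp add: sum.distrib sum_distrib_left)
  also have "(\<Sum>v\<in>A-e. ?h v) = (\<Sum>v\<in>A. ?h v) - (\<Sum>v\<in>e. ?h v)"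
    using finA eA by (simp add: sum_diff)
  finally have 1: "(\<Sum>v\<in>A - e. (wdeg w {f\<in>E. f \<inter> e = {}} v - (P - \<delta>))\<^sup>2) \<le>
     (\<Sum>v\<in>A. ?h v) - (\<Sum>v\<in>e. ?h v) + 2 * (\<Sum>v\<in>A-e. cods e v - loss e v) + 2 * (real k * \<kappa> * (\<Sum>v\<in>A-e. cods e v)) + 2 * \<delta>\<^sup>2 * real (card (A - e))" .
  have "(\<Sum>v\<in>A-e. cods e v) \<le> (\<Sum>v\<in>A. cods e v)"
    using finA cods_nonneg by (intro sum_mono2) auto
  also have "\<dots> \<le> real k ^ 2" by (rule sum_cods_le[OF e])
  finally have 2: "real k * \<kappa> * (\<Sum>v\<in>A-e. cods e v) \<le> real k * \<kappa> * real k ^ 2"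
    using kappa_nonneg by (intro mult_left_mono) auto
  have "card (A - e) \<le> card A" using finA by (simp add: card_mono)
  then have 3: "2 * \<delta>\<^sup>2 * real (card (A - e)) \<le> 2 * \<delta>\<^sup>2 * N"
    using N by (intro mult_left_mono) auto
  have "- ?h v \<le> 2 * (real k * \<kappa> + \<delta>)" if v: "v \<in> e" for v
  proof -
    have vA: "v \<in> A" using v eA by auto
    have "x v * (cods e v - \<delta>) \<le> \<bar>x v\<bar> * \<bar>cods e v - \<delta>\<bar>"
      by (simp add: abs_mult[symmetric])
    also have "\<dots> \<le> 1 * (real k * \<kappa> + \<delta>)"
      using absx[OF vA] cods_nonneg[of e v] cods_le[OF e vA] \<delta> by (intro mult_mono) auto
    finally show ?thesis using zero_le_power2[of "x v"] by linarith
  qed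
  then have "(\<Sum>v\<in>e. - ?h v) \<le> (\<Sum>v\<in>e. 2 * (real k * \<kappa> + \<delta>))" by (rule sum_mono)
  then have 4: "- (\<Sum>v\<in>e. ?h v) \<le> real k * (2 * (real k * \<kappa> + \<delta>))"
    unfolding sum_negf sum_constant edge(2)[OF e] .
  have 5: "(\<Sum>v\<in>A. ?h v) = (\<Sum>v\<in>A. (x v)\<^sup>2) - 2 * (\<Sum>v\<in>A. x v * (cods e v - \<delta>))"
    by (simp add: sum_subtractf sum_distrib_left)
  show ?thesis
    using 1 2 3 4 5 sum_cods_diff_loss_le[OF e] unfolding x_def[symmetric]
    by (simp add: power3_eq_cube power2_eq_square algebra_simps)
qed

text \<open>Each product \<open>x u * x v\<close> is at least minus half the sum of the two squares,
  and the codegrees at a vertex sum to at most k - 1.\<close>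

lemma wcod_quadratic_form_ge:
  "- ((real k - 1) * (\<Sum>v\<in>A. (x v)\<^sup>2)) \<le> (\<Sum>v\<in>A. x v * (\<Sum>u\<in>A-{v}. wcod w E u v * x u))"
proof -
  let ?a = "\<Sum>v\<in>A. \<Sum>u\<in>A-{v}. wcod w E u v * (x v)\<^sup>2"
  let ?b = "\<Sum>v\<in>A. \<Sum>u\<in>A-{v}. wcod w E u v * (x u)\<^sup>2"
  have a: "?a \<le> (real k - 1) * (\<Sum>v\<in>A. (x v)\<^sup>2)"
  proof -
    have "?a = (\<Sum>v\<in>A. ((real k - 1) * wdeg w E v) * (x v)\<^sup>2)"
      by (intro sum.cong refl) (simp add: sum_distrib_right[symmetric] sum_wcod)
    also have "\<dots> \<le> (\<Sum>v\<in>A. ((real k - 1) * 1) * (x v)\<^sup>2)"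
      using k2 deg_le by (intro sum_mono mult_right_mono mult_left_mono) auto
    finally show ?thesis by (simp add: sum_distrib_left)
  qed
  have "?b = (\<Sum>v\<in>A. \<Sum>u\<in>A. if u \<noteq> v then wcod w E u v * (x u)\<^sup>2 else 0)"
    using finA by (intro sum.cong refl sum.mono_neutral_cong_left) auto
  also have "\<dots> = (\<Sum>u\<in>A. \<Sum>v\<in>A. if u \<noteq> v then wcod w E u v * (x u)\<^sup>2 else 0)"
    by (rule sum.swap)
  also have "\<dots> = ?a"
    using finA by (intro sum.cong refl sum.mono_neutral_cong_right) (auto simp: wcod_commute)
  finally have b: "?b = ?a" .
  have "- ((real k - 1) * (\<Sum>v\<in>A. (x v)\<^sup>2)) \<le> - ?a"
    using a by (rule le_imp_neg_le)
  also have "- ?a = - (?a + ?b) / 2" unfolding b by (simp only: mult_2[symmetric])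
  also have "\<dots> = (\<Sum>v\<in>A. \<Sum>u\<in>A-{v}. - (wcod w E u v * ((x v)\<^sup>2 + (x u)\<^sup>2)) / 2)"
    by (simp only: sum.distrib distrib_left sum_negf sum_divide_distrib[symmetric])
  also have "\<dots> \<le> (\<Sum>v\<in>A. \<Sum>u\<in>A-{v}. x v * (wcod w E u v * x u))"
  proof (intro sum_mono)
    fix u v
    have "0 \<le> wcod w E u v * (x v + x u)\<^sup>2" using wcod_nonneg by simp
    then show "- (wcod w E u v * ((x v)\<^sup>2 + (x u)\<^sup>2)) / 2 \<le> x v * (wcod w E u v * x u)"
      by (simp add: power2_eq_square algebra_simps)
  qed
  also have "\<dots> = (\<Sum>v\<in>A. x v * (\<Sum>u\<in>A-{v}. wcod w E u v * x u))"
    by (simp only: sum_distrib_left)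
  finally show ?thesis .
qed

text \<open>With \<open>wdeg\<close> written as P + x and X the sum of x, the averaged linear term
  has the main part (k - 1) P^2 X. The drop \<delta> of the target, multiplied by the total weight
  W, has the main part (k - 1) P^2 as well, so the two cancel; this is what singles out the target
  p^(k - 1). There remain X^2 / N, which Cauchy-Schwarz controls, and the codegree form, both
  bounded by a multiple of the potential.\<close>

lemma weighted_drift_le:
  assumes p: "0 \<le> p" "p \<le> 1" "real k / N \<le> p" and N: "0 < N" and cA: "real (card A) = p * N"
    and \<delta>_def: "\<delta> = p ^ (k - 1) - (p - real k / N) ^ (k - 1)"
  defines "x \<equiv> \<lambda>v. wdeg w E v - p ^ (k - 1)"
  shows "- 2 * (\<Sum>e\<in>E. w e * (\<Sum>v\<in>A. x v * (cods e v - \<delta>)))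
     \<le> 4 * real k * (\<Sum>v\<in>A. (x v)\<^sup>2) + sum w E * (2 * real k ^ 4 / N)"
proof -
  define P where "P = p ^ (k - 1)"
  define X where "X = (\<Sum>v\<in>A. x v)"
  define W where "W = sum w E"
  define \<Phi> where "\<Phi> = (\<Sum>v\<in>A. (x v)\<^sup>2)"
  define q where "q = p ^ (k - 2)"
  define \<rho> where "\<rho> = \<delta> - (real k - 1) * q * (real k / N)"
  have kk: "real k - 1 \<ge> 0" using k2 by simp
  have W0: "0 \<le> W" unfolding W_def by (intro sum_nonneg w_nonneg)
  have \<Phi>0: "0 \<le> \<Phi>" unfolding \<Phi>_def by (intro sum_nonneg) auto
  have P01: "0 \<le> P" "P \<le> 1" and q01: "0 \<le> q" "q \<le> 1"
    unfolding P_def q_def using p by (auto simp: power_le_one)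
  have Pq: "P = p * q" unfolding P_def q_def using k2
    by (metis Suc_1 Suc_diff_Suc Suc_le_lessD diff_Suc_1 power_Suc le_simps(3) One_nat_def)
  have card_le: "real (card A) \<le> N" using cA p N by (simp add: mult_left_le_one_le)
  have kW: "real k * W = X + P * (p * N)"
    using sum_wdeg unfolding X_def W_def x_def P_def cA[symmetric] by (simp add: sum_subtractf)
  have rho: "\<bar>\<rho>\<bar> \<le> real k ^ 4 / N\<^sup>2"
  proof -
    have *: "real (k - 1) = real k - 1" "k - 1 - 1 = k - 2" using k2 by auto
    have "\<bar>\<rho>\<bar> \<le> (real k - 1)\<^sup>2 * (real k / N)\<^sup>2"
      using power_diff_linear_approx[of "real k / N" p "k - 1"] p N
      unfolding \<rho>_def \<delta>_def q_def * by auto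
    also have "\<dots> \<le> (real k)\<^sup>2 * (real k / N)\<^sup>2"
      using kk by (intro mult_right_mono power_mono) auto
    finally show ?thesis by (simp add: power_divide power4_eq_xxxx power2_eq_square)
  qed
  have "X\<^sup>2 \<le> real (card A) * \<Phi>"
    unfolding X_def \<Phi>_def by (rule sum_squared_le[OF finA])
  also have "\<dots> \<le> N * \<Phi>" using card_le \<Phi>0 by (intro mult_right_mono)
  finally have X2: "X\<^sup>2 \<le> N * \<Phi>" .
  have absX: "\<bar>X\<bar> \<le> N"
  proof -
    have "\<bar>X\<bar> \<le> (\<Sum>v\<in>A. \<bar>x v\<bar>)" unfolding X_def by (rule sum_abs)
    also have "\<dots> \<le> (\<Sum>v\<in>A. 1)"
      using deg_le wdeg_nonneg P01 unfolding x_def P_def[symmetric]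
      by (intro sum_mono) (smt (verit))
    finally show ?thesis using card_le by simp
  qed
  have eq1: "(\<Sum>e\<in>E. w e * (\<Sum>v\<in>A. x v * cods e v)) = (real k - 1) * P\<^sup>2 * X + (real k - 1) * P * \<Phi>
      + (\<Sum>v\<in>A. x v * (\<Sum>u\<in>A-{v}. wcod w E u v * x u))"
  proof -
    have "(\<Sum>v\<in>A. x v * (\<Sum>u\<in>A-{v}. wcod w E u v * wdeg w E u))
      = (\<Sum>v\<in>A. x v * (P * ((real k - 1) * (x v + P)) + (\<Sum>u\<in>A-{v}. wcod w E u v * x u)))"
    proof (intro sum.cong refl arg_cong2[where f = "(*)"])
      fix v assume v: "v \<in> A"
      have "(\<Sum>u\<in>A-{v}. wcod w E u v * wdeg w E u) = (\<Sum>u\<in>A-{v}. P * wcod w E u v + wcod w E u v * x u)"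
        by (intro sum.cong refl) (simp add: x_def P_def algebra_simps)
      also have "\<dots> = P * (\<Sum>u\<in>A-{v}. wcod w E u v) + (\<Sum>u\<in>A-{v}. wcod w E u v * x u)"
        by (simp add: sum.distrib sum_distrib_left)
      finally show "(\<Sum>u\<in>A-{v}. wcod w E u v * wdeg w E u) = P * ((real k - 1) * (x v + P)) + (\<Sum>u\<in>A-{v}. wcod w E u v * x u)"
        using sum_wcod[OF v] by (simp add: x_def P_def)
    qed
    also have "\<dots> = (\<Sum>v\<in>A. ((real k - 1) * P\<^sup>2) * x v + ((real k - 1) * P) * (x v)\<^sup>2 + x v * (\<Sum>u\<in>A-{v}. wcod w E u v * x u))"
      by (intro sum.cong refl) (simp add: power2_eq_square algebra_simps)
    also have "\<dots> = (real k - 1) * P\<^sup>2 * X + (real k - 1) * P * \<Phi> + (\<Sum>v\<in>A. x v * (\<Sum>u\<in>A-{v}. wcod w E u v * x u))"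
      unfolding X_def \<Phi>_def by (simp only: sum.distrib sum_distrib_left)
    finally show ?thesis unfolding sum_weight_cods .
  qed
  have eq2: "(\<Sum>e\<in>E. w e * (\<Sum>v\<in>A. x v * (cods e v - \<delta>)))
      = (\<Sum>e\<in>E. w e * (\<Sum>v\<in>A. x v * cods e v)) - W * \<delta> * X"
  proof -
    have "(\<Sum>e\<in>E. w e * (\<Sum>v\<in>A. x v * (cods e v - \<delta>))) = (\<Sum>e\<in>E. w e * (\<Sum>v\<in>A. x v * cods e v) - w e * (\<delta> * X))"
      unfolding X_def by (intro sum.cong refl) (simp add: sum_subtractf sum_distrib_left algebra_simps)
    also have "\<dots> = (\<Sum>e\<in>E. w e * (\<Sum>v\<in>A. x v * cods e v)) - W * (\<delta> * X)"
      unfolding W_def by (simp only: sum_subtractf sum_distrib_right)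
    finally show ?thesis by simp
  qed
  \<comment> \<open>Insert k W = X + P p N into the tangent value of \<delta>, with \<rho> as the
    error of the tangent; the term (k - 1) P^2 splits off because P = p q.\<close>
  have "W * \<delta> = (real k * W) * (real k - 1) * q / N + W * \<rho>"
    unfolding \<rho>_def by (simp add: algebra_simps diff_divide_distrib)
  also have "\<dots> = (real k - 1) * P\<^sup>2 + X * (real k - 1) * q / N + W * \<rho>"
    unfolding kW Pq using N by (simp add: power2_eq_square field_simps)
  finally have Wd: "W * \<delta> = (real k - 1) * P\<^sup>2 + X * (real k - 1) * q / N + W * \<rho>" .
  have main: "2 * X * (W * \<delta> - (real k - 1) * P\<^sup>2) \<le> 2 * (real k - 1) * \<Phi> + W * (2 * real k ^ 4 / N)"
  proof -
    have "2 * X * (W * \<delta> - (real k - 1) * P\<^sup>2) = 2 * (real k - 1) * (q * X\<^sup>2 / N) + 2 * (X * \<rho>) * W"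
      unfolding Wd by (simp add: power2_eq_square algebra_simps diff_divide_distrib)
    moreover have "q * X\<^sup>2 / N \<le> \<Phi>"
    proof -
      have "q * X\<^sup>2 \<le> 1 * (N * \<Phi>)" using q01 X2 by (intro mult_mono) auto
      then show ?thesis using N by (simp add: field_simps)
    qed
    then have "2 * (real k - 1) * (q * X\<^sup>2 / N) \<le> 2 * (real k - 1) * \<Phi>"
      using kk by (intro mult_left_mono) auto
    moreover have "X * \<rho> \<le> real k ^ 4 / N"
    proof -
      have "X * \<rho> \<le> \<bar>X\<bar> * \<bar>\<rho>\<bar>" by (simp add: abs_mult[symmetric])
      also have "\<dots> \<le> N * (real k ^ 4 / N\<^sup>2)" using absX rho by (intro mult_mono) auto
      also have "\<dots> = real k ^ 4 / N" using N by (simp add: power2_eq_square)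
      finally show ?thesis .
    qed
    then have "2 * (X * \<rho>) * W \<le> 2 * (real k ^ 4 / N) * W" using W0 by (intro mult_right_mono) auto
    ultimately show ?thesis by (simp add: mult_ac)
  qed
  have "- 2 * (\<Sum>e\<in>E. w e * (\<Sum>v\<in>A. x v * (cods e v - \<delta>)))
     = 2 * X * (W * \<delta> - (real k - 1) * P\<^sup>2) - 2 * ((real k - 1) * P * \<Phi>)
       - 2 * (\<Sum>v\<in>A. x v * (\<Sum>u\<in>A-{v}. wcod w E u v * x u))"
    unfolding eq2 eq1 by (simp add: algebra_simps)
  also have "\<dots> \<le> (2 * (real k - 1) * \<Phi> + W * (2 * real k ^ 4 / N)) - 0 + 2 * ((real k - 1) * \<Phi>)"
  proof -
    have "0 \<le> (real k - 1) * P * \<Phi>" using kk P01 \<Phi>0 by simp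
    then show ?thesis using main wcod_quadratic_form_ge[of x] unfolding \<Phi>_def[symmetric] by linarith
  qed
  also have "\<dots> \<le> 4 * real k * \<Phi> + W * (2 * real k ^ 4 / N)"
    using \<Phi>0 by (simp add: algebra_simps)
  finally show ?thesis unfolding \<Phi>_def W_def .
qed

end

context weighted_hypergraph
begin

text \<open>Some edge does at least as well as the weighted average. The drift 4 k \<Phi> is divided
  by the total weight W, so W must be linear in N: by Cauchy-Schwarz \<open>small\<close> bounds the
  sum of the deviations, which gives W \<ge> \<alpha>^k N / (2 k). The quotient is the constant 8
  k^2 / \<alpha>^k.\<close>

lemma removable_edge:
  assumes p: "p \<le> 1" "\<alpha> \<le> p" and \<alpha>: "0 < \<alpha>" and N: "1 \<le> N" "real k \<le> \<alpha> * N" and cA: "real (card A) = p * N"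
    and K: "\<kappa> = K / N" "0 \<le> K"
    and small: "4 * (\<Sum>v\<in>A. (wdeg w E v - p ^ (k - 1))\<^sup>2) \<le> \<alpha> ^ (2 * k) * N"
  shows "\<exists>e\<in>E. (\<Sum>v\<in>A - e. (wdeg w {f\<in>E. f \<inter> e = {}} v - (p - real k / N) ^ (k - 1))\<^sup>2)
     \<le> (1 + (8 * (real k)\<^sup>2 / \<alpha> ^ k) / N) * (\<Sum>v\<in>A. (wdeg w E v - p ^ (k - 1))\<^sup>2)
       + (4 * real k ^ 3 * K + 2 * (real k)\<^sup>2 * K + 6 * real k ^ 4 + 2 * real k ^ 3) / N"
proof -
  define P where "P = p ^ (k - 1)"
  define \<delta> where "\<delta> = P - (p - real k / N) ^ (k - 1)"
  define \<Phi> where "\<Phi> = (\<Sum>v\<in>A. (wdeg w E v - P)\<^sup>2)"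
  define X where "X = (\<Sum>v\<in>A. wdeg w E v - P)"
  define W where "W = sum w E"
  define B where "B = 4 * real k ^ 3 * \<kappa> + 2 * N * \<delta>\<^sup>2 + 2 * real k * (real k * \<kappa> + \<delta>)"
  have \<Phi>0: "0 \<le> \<Phi>" unfolding \<Phi>_def by (intro sum_nonneg) auto
  have p0: "0 \<le> p" using \<alpha> p by simp
  have "real k \<le> p * N" using N p mult_right_mono[of \<alpha> p N] by linarith
  then have h: "real k / N \<le> p" "0 \<le> real k / N" using N by (auto simp: field_simps)
  have h1: "real k / N \<le> 1" using h p by simp
  have P01: "0 \<le> P" "P \<le> 1" unfolding P_def using p p0 by (auto simp: power_le_one)
  have \<delta>0: "0 \<le> \<delta>" unfolding \<delta>_def P_def using h p0 power_mono[of "p - real k / N" p "k - 1"] by simp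
  have \<delta>1: "\<delta> \<le> (real k)\<^sup>2 / N"
  proof -
    have "\<delta> \<le> real (k - 1) * p ^ (k - 1 - 1) * (real k / N)"
      using power_diff_linear_approx[of "real k / N" p "k - 1"] h p unfolding \<delta>_def P_def by simp
    also have "\<dots> \<le> real k * 1 * (real k / N)"
      using h p p0 by (intro mult_right_mono mult_mono power_le_one) auto
    finally show ?thesis by (simp add: power2_eq_square)
  qed
  have card_le: "real (card A) \<le> N" using cA p N by (simp add: mult_left_le_one_le)
  have kW: "real k * W = X + p ^ k * N"
  proof -
    have "real k * W = X + P * (p * N)"
      using sum_wdeg unfolding X_def W_def cA[symmetric] by (simp add: sum_subtractf)
    moreover have "P * p = p ^ k" unfolding P_def using k2 by (metis One_nat_def Suc_pred less_le_trans numeral_2_eq_2 power_Suc2 zero_less_Suc)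
    ultimately show ?thesis by (metis mult.assoc)
  qed
  have "X\<^sup>2 \<le> real (card A) * \<Phi>"
    unfolding X_def \<Phi>_def by (rule sum_squared_le[OF finA])
  also have "\<dots> \<le> N * (\<alpha> ^ (2 * k) * N / 4)"
    using card_le \<Phi>0 small N unfolding \<Phi>_def P_def by (intro mult_mono) auto
  also have "\<dots> = (\<alpha> ^ k * N / 2)\<^sup>2"
    by (simp add: power2_eq_square mult_2 power_add)
  finally have "\<bar>X\<bar> \<le> \<alpha> ^ k * N / 2"
    by (rule power2_le_imp_le[of "\<bar>X\<bar>", simplified]) (use \<alpha> N in auto)
  moreover have "\<alpha> ^ k * N \<le> p ^ k * N" using \<alpha> p N by (intro mult_right_mono power_mono) auto
  ultimately have "\<alpha> ^ k * N / 2 \<le> real k * W" using kW by linarith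
  then have W: "\<alpha> ^ k * N / (2 * real k) \<le> W" using k2 by (simp add: field_simps)
  have W_pos: "0 < W"
    by (rule less_le_trans[OF _ W]) (use \<alpha> N k2 in auto)
  have B: "B \<le> (4 * real k ^ 3 * K + 2 * (real k)\<^sup>2 * K + 2 * real k ^ 4 + 2 * real k ^ 3) / N"
  proof -
    have "N * \<delta>\<^sup>2 \<le> N * ((real k)\<^sup>2 / N)\<^sup>2"
      using \<delta>0 \<delta>1 N by (intro mult_left_mono power_mono) auto
    also have "\<dots> = real k ^ 4 / N" using N by (simp add: power2_eq_square power4_eq_xxxx)
    finally have "N * \<delta>\<^sup>2 \<le> real k ^ 4 / N" .
    moreover have "real k * \<delta> \<le> real k ^ 3 / N"
      using mult_left_mono[OF \<delta>1, of "real k"] by (simp add: power2_eq_square power3_eq_cube)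
    moreover have "B = 4 * real k ^ 3 * K / N + 2 * (N * \<delta>\<^sup>2) + 2 * (real k)\<^sup>2 * K / N + 2 * (real k * \<delta>)"
      unfolding B_def K by (simp add: algebra_simps power2_eq_square)
    ultimately show ?thesis by (simp add: add_divide_distrib)
  qed
  define R where "R = (1 + (8 * (real k)\<^sup>2 / \<alpha> ^ k) / N) * \<Phi>
       + (4 * real k ^ 3 * K + 2 * (real k)\<^sup>2 * K + 6 * real k ^ 4 + 2 * real k ^ 3) / N"
  define new where "new e = (\<Sum>v\<in>A - e. (wdeg w {f\<in>E. f \<inter> e = {}} v - (p - real k / N) ^ (k - 1))\<^sup>2)" for e
  define Y where "Y e = (\<Sum>v\<in>A. (wdeg w E v - P) * (cods e v - \<delta>))" for e
  have new_le: "new e \<le> \<Phi> - 2 * Y e + B" if "e \<in> E" for e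
    using squared_deviation_after_removal[OF that P01 \<delta>0 card_le]
    unfolding new_def \<Phi>_def B_def Y_def by (simp add: \<delta>_def)
  have "(\<Sum>e\<in>E. w e * new e) \<le> (\<Sum>e\<in>E. w e * (\<Phi> - 2 * Y e + B))"
    using new_le w_nonneg by (intro sum_mono mult_left_mono) auto
  also have "\<dots> = W * \<Phi> + - 2 * (\<Sum>e\<in>E. w e * Y e) + W * B"
    unfolding W_def by (simp add: sum_distrib_left sum_distrib_right sum.distrib sum_subtractf sum_negf algebra_simps)
  also have "\<dots> \<le> W * \<Phi> + (4 * real k * \<Phi> + W * (2 * real k ^ 4 / N)) + W * B"
    using weighted_drift_le[OF p0 p(1) h(1) _ cA, of \<delta>] N
    unfolding Y_def \<Phi>_def W_def P_def \<delta>_def by simp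
  also have "\<dots> \<le> W * R"
  proof -
    have "4 * real k = \<alpha> ^ k * N / (2 * real k) * (8 * (real k)\<^sup>2 / \<alpha> ^ k / N)"
      using \<alpha> N k2 by (simp add: field_simps power2_eq_square)
    also have "\<dots> \<le> W * (8 * (real k)\<^sup>2 / \<alpha> ^ k / N)"
      using W \<alpha> N by (intro mult_right_mono) auto
    finally have "4 * real k * \<Phi> \<le> W * (8 * (real k)\<^sup>2 / \<alpha> ^ k / N) * \<Phi>"
      using \<Phi>0 by (intro mult_right_mono)
    moreover have "W * B \<le> W * ((4 * real k ^ 3 * K + 2 * (real k)\<^sup>2 * K + 2 * real k ^ 4 + 2 * real k ^ 3) / N)"
      using B W_pos by (intro mult_left_mono) auto
    moreover have "W * R = W * \<Phi> + W * (8 * (real k)\<^sup>2 / \<alpha> ^ k / N) * \<Phi> + W * (2 * real k ^ 4 / N) +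
       W * ((4 * real k ^ 3 * K + 2 * (real k)\<^sup>2 * K + 2 * real k ^ 4 + 2 * real k ^ 3) / N) + W * (2 * real k ^ 4 / N)"
      unfolding R_def by (simp add: algebra_simps add_divide_distrib)
    moreover have "0 \<le> W * (2 * real k ^ 4 / N)" using W_pos N by simp
    ultimately show ?thesis by linarith
  qed
  finally have avg: "(\<Sum>e\<in>E. w e * new e) \<le> W * R" .
  have "\<exists>e\<in>E. new e \<le> R"
  proof (rule ccontr)
    assume "\<not> (\<exists>e\<in>E. new e \<le> R)"
    then have lt: "R < new e" if "e \<in> E" for e using that by auto
    \<comment> \<open>Edges of weight 0 contribute nothing, so strictness of the averaged inequality
      has to come from an edge of positive weight.\<close>
    have "\<exists>e\<in>E. 0 < w e"
      using W_pos w_nonneg unfolding W_def by (metis less_eq_real_def not_less sum_nonpos)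
    then obtain e0 where e0: "e0 \<in> E" "0 < w e0" by auto
    have "(\<Sum>e\<in>E. w e * R) < (\<Sum>e\<in>E. w e * new e)"
    proof (rule sum_strict_mono_ex1[OF finE])
      show "\<forall>e\<in>E. w e * R \<le> w e * new e"
        using lt w_nonneg by (metis less_imp_le mult_left_mono)
      show "\<exists>e\<in>E. w e * R < w e * new e"
        using e0 lt by (auto intro!: bexI[of _ e0])
    qed
    then show False using avg unfolding W_def by (simp add: sum_distrib_right)
  qed
  then show ?thesis unfolding new_def R_def \<Phi>_def P_def .
qed

end

text \<open>Each step multiplies the potential by at most 1 + C1 / N and adds at most C2 / N. Since
  there are at most N steps, it stays below the constant C2 exp C1, while the bound that
  \<open>removable_edge\<close> asks for is linear in N.\<close>

lemma almost_perfect_matching: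
  fixes \<alpha> K :: real
  assumes k: "2 \<le> k" and \<alpha>: "0 < \<alpha>" and K: "0 \<le> K"
  shows "\<exists>N0. \<forall>(U::'a set) E w. finite U \<longrightarrow> N0 \<le> card U \<longrightarrow> (\<forall>e\<in>E. e \<subseteq> U \<and> card e = k) \<longrightarrow>
      (\<forall>e. 0 \<le> w e) \<longrightarrow> (\<forall>v\<in>U. wdeg w E v = 1) \<longrightarrow>
      (\<forall>u\<in>U. \<forall>v\<in>U. u \<noteq> v \<longrightarrow> wcod w E u v \<le> K / real (card U)) \<longrightarrow>
      (\<exists>M\<subseteq>E. (\<forall>e\<in>M. \<forall>f\<in>M. e \<noteq> f \<longrightarrow> e \<inter> f = {}) \<and> real (card (U - \<Union>M)) \<le> \<alpha> * real (card U))"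
proof -
  define C1 where "C1 = 8 * (real k)\<^sup>2 / \<alpha> ^ k"
  define C2 where "C2 = 4 * real k ^ 3 * K + 2 * (real k)\<^sup>2 * K + 6 * real k ^ 4 + 2 * real k ^ 3"
  define N0 where "N0 = nat \<lceil>max (max 1 (real k / \<alpha>)) (4 * C2 * exp C1 / \<alpha> ^ (2 * k))\<rceil>"
  have C1: "0 \<le> C1" and C2: "0 \<le> C2" unfolding C1_def C2_def using \<alpha> K by auto
  show ?thesis
  proof (intro exI[of _ N0] allI impI)
    fix U :: "'a set" and E w
    assume U: "finite U" "N0 \<le> card U" and E: "\<forall>e\<in>E. e \<subseteq> U \<and> card e = k" and w: "\<forall>e. 0 \<le> w e"
      and deg: "\<forall>v\<in>U. wdeg w E v = 1"
      and cod: "\<forall>u\<in>U. \<forall>v\<in>U. u \<noteq> v \<longrightarrow> wcod w E u v \<le> K / real (card U)"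
    let ?disj = "\<lambda>M. \<forall>e\<in>M. \<forall>f\<in>M. e \<noteq> f \<longrightarrow> e \<inter> f = {}"
    define N where "N = real (card U)"
    have "max (max 1 (real k / \<alpha>)) (4 * C2 * exp C1 / \<alpha> ^ (2 * k)) \<le> N"
      using U(2) unfolding N_def N0_def by linarith
    then have N1: "1 \<le> N" and N2: "real k \<le> \<alpha> * N" and N3: "4 * (C2 * exp C1) \<le> \<alpha> ^ (2 * k) * N"
      using \<alpha> by (auto simp: field_simps)
    have finE: "finite E" by (rule finite_subset[of _ "Pow U"]) (use E U in auto)
    define EA where "EA M = {f\<in>E. f \<inter> \<Union>M = {}}" for M :: "'a set set"
    define \<Phi> where "\<Phi> M = (\<Sum>v\<in>U - \<Union>M. (wdeg w (EA M) v - (real (card (U - \<Union>M)) / N) ^ (k - 1))\<^sup>2)" for M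
    \<comment> \<open>The second alternative persists once it holds, so the induction never has to
      stop. At t = \<open>card U\<close> the first alternative is impossible because k \<ge>
      2.\<close>
    have ex: "\<exists>M. M \<subseteq> E \<and> ?disj M \<and> card (U - \<Union>M) + k * t = card U
            \<and> \<Phi> M \<le> C2 * real t / N * (1 + C1 / N) ^ t \<or> (M \<subseteq> E \<and> ?disj M \<and> real (card (U - \<Union>M)) \<le> \<alpha> * N)" for t
    proof (induction t)
      case 0
      have "EA {} = E" unfolding EA_def by auto
      then have "\<Phi> {} = 0" using deg N1 unfolding \<Phi>_def N_def by (simp)
      then show ?case by (intro exI[of _ "{}"]) auto
    next
      case (Suc t)
      then obtain M where M: "M \<subseteq> E" "?disj M"
        and alt: "(card (U - \<Union>M) + k * t = card U \<and> \<Phi> M \<le> C2 * real t / N * (1 + C1 / N) ^ t)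
          \<or> real (card (U - \<Union>M)) \<le> \<alpha> * N" by blast
      show ?case
      proof (cases "real (card (U - \<Union>M)) \<le> \<alpha> * N")
        case True
        with M show ?thesis by blast
      next
        case False
        with alt have cM: "card (U - \<Union>M) + k * t = card U" and \<Phi>M: "\<Phi> M \<le> C2 * real t / N * (1 + C1 / N) ^ t" by auto
        define A where "A = U - \<Union>M"
        define p where "p = real (card A) / N"
        have sub: "EA M \<subseteq> E" unfolding EA_def by auto
        interpret weighted_hypergraph k A "EA M" w "K / N"
        proof
          show "2 \<le> k" "finite A" "\<And>e. 0 \<le> w e" "0 \<le> K / N" using k U w K N1 by (auto simp: A_def)
          show "e \<subseteq> A" if "e \<in> EA M" for e using that E unfolding EA_def A_def by blast
          show "card e = k" if "e \<in> EA M" for e using that E unfolding EA_def by blast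
          show "wdeg w (EA M) v \<le> 1" if "v \<in> A" for v
          proof -
            have "wdeg w (EA M) v \<le> wdeg w E v"
              unfolding wdeg_def using sub finE w by (intro sum_mono2) auto
            then show ?thesis using deg that by (auto simp: A_def)
          qed
          show "wcod w (EA M) u v \<le> K / N" if "u \<in> A" "v \<in> A" "u \<noteq> v" for u v
          proof -
            have "wcod w (EA M) u v \<le> wcod w E u v"
              unfolding wcod_def using sub finE w by (intro sum_mono2) auto
            then show ?thesis using cod that by (force simp: A_def N_def)
          qed
        qed
        have tN: "real t \<le> N"
        proof -
          have "1 * t \<le> k * t" using k by (intro mult_le_mono1) simp
          then show ?thesis using cM unfolding N_def by linarith
        qed
        have "(1 + C1 / N) ^ t \<le> exp (C1 / N) ^ t"
          using C1 N1 by (intro power_mono exp_ge_add_one_self) (auto simp: add.commute)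
        also have "\<dots> = exp (C1 / N * real t)" using exp_of_nat_mult[of t "C1 / N"] by (simp only: mult.commute)
        also have "\<dots> \<le> exp C1"
          using tN C1 N1 by (simp add: field_simps mult_left_mono)
        finally have pow: "(1 + C1 / N) ^ t \<le> exp C1" .
        have "C2 * real t / N \<le> C2"
          using tN C2 N1 by (simp add: field_simps mult_left_mono)
        then have "C2 * real t / N * (1 + C1 / N) ^ t \<le> C2 * exp C1"
          using pow C2 C1 N1 by (intro mult_mono) auto
        then have small: "4 * \<Phi> M \<le> \<alpha> ^ (2 * k) * N" using \<Phi>M N3 by linarith
        have cA: "real (card A) = p * N" unfolding p_def using N1 by simp
        have "card A \<le> card U" unfolding A_def using U by (intro card_mono) auto
        then have p1: "p \<le> 1" unfolding p_def N_def using N1 N_def by simp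
        have p\<alpha>: "\<alpha> \<le> p" using False N1 unfolding p_def A_def by (simp add: field_simps)
        obtain e where e: "e \<in> EA M" and le: "(\<Sum>v\<in>A - e. (wdeg w {f\<in>EA M. f \<inter> e = {}} v - (p - real k / N) ^ (k - 1))\<^sup>2)
            \<le> (1 + C1 / N) * \<Phi> M + C2 / N"
          using removable_edge[OF p1 p\<alpha> \<alpha> N1 N2 cA refl K] small
          unfolding \<Phi>_def A_def[symmetric] p_def[symmetric] C1_def C2_def by auto
        have eE: "e \<in> E" and eM: "e \<inter> \<Union>M = {}" and eA: "e \<subseteq> A" and ce: "card e = k" and fe: "finite e"
          using e edge fin_edge unfolding EA_def by auto
        let ?M = "insert e M"
        have UA: "U - \<Union>?M = A - e" unfolding A_def by auto
        have EAe: "EA ?M = {f\<in>EA M. f \<inter> e = {}}" unfolding EA_def by auto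
        have cAe: "card (A - e) + k = card A"
          using eA ce finA fe card_mono[OF finA eA] by (simp add: card_Diff_subset)
        then have "real (card (A - e)) = real (card A) - real k" by linarith
        then have pe: "real (card (A - e)) / N = p - real k / N" unfolding p_def by (simp add: diff_divide_distrib)
        have "\<Phi> ?M \<le> (1 + C1 / N) * \<Phi> M + C2 / N" using le unfolding \<Phi>_def UA EAe pe .
        also have "\<dots> \<le> (1 + C1 / N) * (C2 * real t / N * (1 + C1 / N) ^ t) + C2 / N * (1 + C1 / N) ^ Suc t"
        proof (intro add_mono mult_left_mono \<Phi>M)
          have "1 \<le> (1 + C1 / N) ^ Suc t" using C1 N1 by (intro one_le_power) auto
          then show "C2 / N \<le> C2 / N * (1 + C1 / N) ^ Suc t"
            using C2 N1 mult_left_mono[of 1 "(1 + C1 / N) ^ Suc t" "C2 / N"] by simp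
        qed (use C1 N1 in auto)
        also have "\<dots> = C2 * real (Suc t) / N * (1 + C1 / N) ^ Suc t"
          by (simp add: algebra_simps add_divide_distrib)
        finally have "\<Phi> ?M \<le> C2 * real (Suc t) / N * (1 + C1 / N) ^ Suc t" .
        moreover have "card (U - \<Union>?M) + k * Suc t = card U"
          using cM cAe unfolding UA A_def[symmetric] by simp
        moreover have "?disj ?M" using M(2) eM by blast
        ultimately show ?thesis using M(1) eE by (intro exI[of _ ?M]) blast
      qed
    qed
    obtain M where M: "M \<subseteq> E" "?disj M" and alt: "card (U - \<Union>M) + k * card U = card U \<or> real (card (U - \<Union>M)) \<le> \<alpha> * N"
      using ex[of "card U"] by blast
    have "k * card U = card U + (k - 1) * card U" using k by (cases k) auto
    moreover have "(k - 1) * card U \<ge> 1 * 1" using k N1 unfolding N_def by (intro mult_le_mono) auto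
    ultimately have "real (card (U - \<Union>M)) \<le> \<alpha> * N" using alt by linarith
    then show "\<exists>M\<subseteq>E. ?disj M \<and> real (card (U - \<Union>M)) \<le> \<alpha> * real (card U)"
      using M unfolding N_def by blast
  qed
qed

section \<open>Partition into closed parts\<close>

text \<open>\<open>R i\<close> stands for reachability at the i-th pair of constants, and every use
  of robust transitivity raises the level by one. Representatives are chosen whose neighbourhoods
  cover V and hardly overlap; a vertex in an overlap joins a part that contains many of its
  neighbours. Only a bounded number of levels is spent.\<close>

lemma closed_partition:
  fixes R :: "nat \<Rightarrow> 'a \<Rightarrow> 'a \<Rightarrow> bool" and \<eta> d n :: real and c :: nat
  assumes fin: "finite V" and ne: "V \<noteq> {}" and n: "0 < n"
    and refl: "\<And>v. v \<in> V \<Longrightarrow> R 0 v v"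
    and sym: "\<And>i u v. R i u v \<Longrightarrow> R i v u"
    and suc: "\<And>i u v. i \<le> c \<Longrightarrow> u \<in> V \<Longrightarrow> v \<in> V \<Longrightarrow> R i u v \<Longrightarrow> R (Suc i) u v"
    and comp: "\<And>i u v. i \<le> c \<Longrightarrow> u \<in> V \<Longrightarrow> v \<in> V \<Longrightarrow>
        \<eta> * n \<le> real (card {w\<in>V. R i u w \<and> R i w v}) \<Longrightarrow> R (Suc i) u v"
    and deg: "\<And>v. v \<in> V \<Longrightarrow> (d + (real c)\<^sup>2 * \<eta>) * n \<le> real (card {u\<in>V. R 0 u v})"
    and indep: "\<And>S. S \<subseteq> V \<Longrightarrow> card S = Suc c \<Longrightarrow> \<exists>u\<in>S. \<exists>v\<in>S. u \<noteq> v \<and> R 0 u v"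
    and d: "0 < d" "real c * \<eta> \<le> d" and \<eta>: "0 < \<eta>"
  shows "\<exists>P. partition_on V P \<and> card P \<le> c \<and>
    (\<forall>X\<in>P. d * n \<le> real (card X) \<and> (\<forall>u\<in>X. \<forall>v\<in>X. R (Suc c) u v))"
proof -
  have mono: "R j u v" if "R i u v" "i \<le> j" "j \<le> Suc c" "u \<in> V" "v \<in> V" for i j u v
    using that(2,3)
  proof (induction j rule: dec_induct)
    case (step m)
    then show ?case using suc[of m u v] that by auto
  qed (use that in auto)
  \<comment> \<open>The level falls as the set grows. At the last r with \<open>free r\<close> there
    are r vertices unrelated even at level i + 1, while any r + 1 vertices contain a pair related
    already at level i. This gap of one level makes the overlaps small.\<close>
  define free where "free r \<longleftrightarrow> (\<exists>S\<subseteq>V. card S = r \<and> (\<forall>u\<in>S. \<forall>v\<in>S. u \<noteq> v \<longrightarrow> \<not> R (Suc c - r) u v))" for r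
  obtain v0 where v0: "v0 \<in> V" using ne by auto
  have "free 1" unfolding free_def using v0 by (intro exI[of _ "{v0}"]) auto
  moreover have "\<not> free (Suc c)" unfolding free_def using indep by fastforce
  ultimately have c1: "1 \<le> c" by (cases c) auto
  obtain r where r: "1 \<le> r" "r \<le> c" "free r" "\<not> free (Suc r)"
  proof -
    have "\<exists>r\<ge>1. r < Suc c \<and> free r \<and> \<not> free (Suc r)"
    proof (rule ccontr)
      assume H: "\<not> ?thesis"
      have "free j" if "1 \<le> j" "j \<le> Suc c" for j
        using that by (induction j rule: dec_induct) (use \<open>free 1\<close> H in auto)
      then show False using \<open>\<not> free (Suc c)\<close> by simp
    qed
    then show ?thesis using that by auto
  qed
  define i where "i = c - r"
  have i: "Suc c - r = Suc i" "Suc c - Suc r = i" "i < c" unfolding i_def using r by auto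
  obtain S where S: "S \<subseteq> V" "card S = r" and S_free: "\<And>u v. u \<in> S \<Longrightarrow> v \<in> S \<Longrightarrow> u \<noteq> v \<Longrightarrow> \<not> R (Suc i) u v"
    using r(3) unfolding free_def i by blast
  have S_free': "\<not> R i u v" if "u \<in> S" "v \<in> S" "u \<noteq> v" for u v
    using S_free[OF that] suc[of i u v] S that i by auto
  have pair: "\<exists>u\<in>T. \<exists>v\<in>T. u \<noteq> v \<and> R i u v" if "T \<subseteq> V" "card T = Suc r" for T
    using r(4) that unfolding free_def i by blast
  have finS: "finite S" using S fin finite_subset by blast
  have neS: "S \<noteq> {}" using S r by auto
  define Nb where "Nb s = {v\<in>V. R i v s}" for s
  have cover: "\<exists>s\<in>S. v \<in> Nb s" if v: "v \<in> V" for v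
  proof (cases "v \<in> S")
    case True
    have "R i v v" using mono[OF refl[OF v], of i] i v by simp
    then show ?thesis using True v unfolding Nb_def by auto
  next
    case False
    then obtain u w where uw: "u \<in> insert v S" "w \<in> insert v S" "u \<noteq> w" "R i u w"
      using pair[of "insert v S"] S v finS by auto
    then show ?thesis using S_free' sym v unfolding Nb_def by blast
  qed
  \<comment> \<open>Two members of S with many common neighbours at level i would be related at
    level i + 1.\<close>
  have ov: "real (card (Nb s \<inter> Nb t)) \<le> \<eta> * n" if "s \<in> S" "t \<in> S" "s \<noteq> t" for s t
  proof (rule ccontr)
    assume "\<not> ?thesis"
    moreover have "Nb s \<inter> Nb t = {w\<in>V. R i s w \<and> R i w t}" unfolding Nb_def using sym by blast
    ultimately have "R (Suc i) s t" using comp[of i s t] S that i by (auto simp: subset_iff)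
    then show False using S_free that by blast
  qed
  define Ov where "Ov = (\<Union>(s,t)\<in>{(s,t). s \<in> S \<and> t \<in> S \<and> s \<noteq> t}. Nb s \<inter> Nb t)"
  have Ov_sub: "Ov \<subseteq> V" unfolding Ov_def Nb_def by auto
  have Ov: "real (card Ov) \<le> (real c)\<^sup>2 * \<eta> * n"
  proof -
    let ?I = "{(s,t). s \<in> S \<and> t \<in> S \<and> s \<noteq> t}"
    have sub: "?I \<subseteq> S \<times> S" by auto
    have finI: "finite ?I" using finite_subset[OF sub] finS by auto
    have "card Ov \<le> (\<Sum>(s,t)\<in>?I. card (Nb s \<inter> Nb t))"
      unfolding Ov_def using card_UN_le[OF finI, of "\<lambda>(s,t). Nb s \<inter> Nb t"] by (simp add: case_prod_unfold)
    then have "real (card Ov) \<le> (\<Sum>(s,t)\<in>?I. real (card (Nb s \<inter> Nb t)))"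
      by (simp add: case_prod_unfold flip: of_nat_sum)
    also have "\<dots> \<le> (\<Sum>(s,t)\<in>?I. \<eta> * n)" using ov by (intro sum_mono) auto
    also have "\<dots> = real (card ?I) * (\<eta> * n)" by (simp add: case_prod_unfold)
    also have "\<dots> \<le> (real c)\<^sup>2 * (\<eta> * n)"
    proof (intro mult_right_mono)
      have "card ?I \<le> card (S \<times> S)" using sub finS by (intro card_mono) auto
      also have "\<dots> \<le> c * c" using S r by (simp add: card_cartesian_product mult_le_mono)
      finally show "real (card ?I) \<le> (real c)\<^sup>2" by (simp add: power2_eq_square flip: of_nat_mult)
    qed (use \<eta> n in auto)
    finally show ?thesis by simp
  qed
  have deg': "d * n \<le> real (card ({u\<in>V. R 0 u v} - Ov))" if "v \<in> V" for v
  proof -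
    have "card {u\<in>V. R 0 u v} - card Ov \<le> card ({u\<in>V. R 0 u v} - Ov)"
      using Ov_sub fin finite_subset by (intro diff_card_le_card_Diff) auto
    then show ?thesis using deg[OF that] Ov by (simp add: algebra_simps)
  qed
  define core where "core s = Nb s - Ov" for s
  \<comment> \<open>Replacing s by u and v in S gives r + 1 vertices, hence a pair related at level
    i. Members of S are unrelated, and a vertex outside the overlaps is related to no member of S
    but its own, so the pair is u, v.\<close>
  have core_related: "R i u v" if s: "s \<in> S" and uv: "u \<in> core s" "v \<in> core s" for s u v
  proof (cases "u = v")
    case True
    then show ?thesis using mono[OF refl[of u], of i] uv i by (auto simp: core_def Nb_def)
  next
    case False
    have uV: "u \<in> V" "v \<in> V" using uv by (auto simp: core_def Nb_def)
    have only: "t = s" if "t \<in> S" "x \<in> core s" "R i x t" for x t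
      using that s unfolding core_def Ov_def Nb_def by blast
    have notin: "x \<notin> S - {s}" if "x \<in> core s" for x
    proof
      assume x: "x \<in> S - {s}"
      then have "R i x x" using mono[OF refl[of x], of i] S i by auto
      then show False using only[of x x] that x by auto
    qed
    have "card (insert u (insert v (S - {s}))) = Suc r"
      using notin[OF uv(1)] notin[OF uv(2)] False finS s S r by simp
    then obtain x y where xy: "x \<in> insert u (insert v (S - {s}))" "y \<in> insert u (insert v (S - {s}))" "x \<noteq> y" "R i x y"
      using pair[of "insert u (insert v (S - {s}))"] uV S by blast
    have no: "\<not> R i x y" if "x \<in> core s" "y \<in> S - {s}" for x y
      using only[of y x] that by auto
    from xy no[OF uv(1)] no[OF uv(2)] S_free' sym show ?thesis by blast
  qed
  \<comment> \<open>At least d n neighbours at level 0 avoid the overlaps. They are spread over at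
    most c cores, and c \<eta> \<le> d, so one core receives \<eta> n of them.\<close>
  have core_ov: "\<exists>s\<in>S. \<eta> * n \<le> real (card ({u\<in>V. R 0 u v} \<inter> core s))" if v: "v \<in> V" for v
  proof (rule ccontr)
    assume "\<not> ?thesis"
    then have lt: "real (card ({u\<in>V. R 0 u v} \<inter> core s)) < \<eta> * n" if "s \<in> S" for s using that by force
    have "{u\<in>V. R 0 u v} - Ov \<subseteq> (\<Union>s\<in>S. {u\<in>V. R 0 u v} \<inter> core s)"
      using cover unfolding core_def by blast
    then have "card ({u\<in>V. R 0 u v} - Ov) \<le> card (\<Union>s\<in>S. {u\<in>V. R 0 u v} \<inter> core s)"
      using fin finS by (intro card_mono) auto
    also have "\<dots> \<le> (\<Sum>s\<in>S. card ({u\<in>V. R 0 u v} \<inter> core s))" by (rule card_UN_le[OF finS])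
    finally have "real (card ({u\<in>V. R 0 u v} - Ov)) \<le> (\<Sum>s\<in>S. real (card ({u\<in>V. R 0 u v} \<inter> core s)))"
      by (simp flip: of_nat_sum)
    also have "\<dots> < (\<Sum>s\<in>S. \<eta> * n)" using lt finS neS by (intro sum_strict_mono) auto
    also have "\<dots> \<le> real c * (\<eta> * n)" using S r \<eta> n by (simp add: mult_right_mono)
    also have "\<dots> \<le> d * n" using d n by (simp add: mult_right_mono flip: mult.assoc)
    finally show False using deg'[OF v] by simp
  qed
  define own where "own v = (if v \<in> Ov then SOME s. s \<in> S \<and> \<eta> * n \<le> real (card ({u\<in>V. R 0 u v} \<inter> core s))
      else SOME s. s \<in> S \<and> v \<in> core s)" for v
  have own_ov: "own v \<in> S" "\<eta> * n \<le> real (card ({u\<in>V. R 0 u v} \<inter> core (own v)))" if "v \<in> Ov" for v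
    using someI_ex[of "\<lambda>s. s \<in> S \<and> \<eta> * n \<le> real (card ({u\<in>V. R 0 u v} \<inter> core s))"] core_ov[of v] that Ov_sub
    unfolding own_def by auto
  have own_core: "own v \<in> S \<and> v \<in> core (own v)" if "v \<in> V" "v \<notin> Ov" for v
  proof -
    have "\<exists>s. s \<in> S \<and> v \<in> core s" using cover[OF that(1)] that(2) unfolding core_def by blast
    then show ?thesis using someI_ex[of "\<lambda>s. s \<in> S \<and> v \<in> core s"] that(2) unfolding own_def by auto
  qed
  have own_S: "own v \<in> S" if "v \<in> V" for v using own_ov own_core that by (cases "v \<in> Ov") auto
  have core_own: "own v = s" if "s \<in> S" "v \<in> core s" for v s
  proof -
    have v: "v \<in> V" "v \<notin> Ov" using that by (auto simp: core_def Nb_def)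
    then show ?thesis using own_core[OF v] that unfolding core_def Ov_def by blast
  qed
  define part where "part s = {v\<in>V. own v = s}" for s
  have core_part: "core s \<subseteq> part s" if "s \<in> S" for s
    using core_own[OF that] unfolding part_def core_def Nb_def by auto
  have big: "d * n \<le> real (card (part s))" if s: "s \<in> S" for s
  proof -
    have sV: "s \<in> V" using s S by auto
    have "{u\<in>V. R 0 u s} - Ov \<subseteq> part s"
      using core_part[OF s] mono[of 0 _ s i] sV i unfolding core_def Nb_def by auto
    then have "card ({u\<in>V. R 0 u s} - Ov) \<le> card (part s)"
      using fin unfolding part_def by (intro card_mono) auto
    then show ?thesis using deg'[OF sV] by linarith
  qed
  have related1: "R (Suc i) u w" if u: "u \<in> V" and w: "w \<in> core (own u)" for u w
  proof (cases "u \<in> Ov")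
    case True
    have wV: "w \<in> V" using w by (auto simp: core_def Nb_def)
    have "{x\<in>V. R 0 x u} \<inter> core (own u) \<subseteq> {x\<in>V. R i u x \<and> R i x w}"
      using core_related[OF own_S[OF u] _ w] mono[of 0 _ u i] u i sym by fastforce
    then have "card ({x\<in>V. R 0 x u} \<inter> core (own u)) \<le> card {x\<in>V. R i u x \<and> R i x w}"
      using fin by (intro card_mono) auto
    then show ?thesis using own_ov(2)[OF True] comp[of i u w] u wV i by linarith
  next
    case False
    then have "R i u w" using core_related[OF own_S[OF u] _ w] own_core[OF u] by blast
    moreover have "w \<in> V" using w by (auto simp: core_def Nb_def)
    ultimately show ?thesis using mono[of i u w "Suc i"] u i by simp
  qed
  have related: "R (Suc c) u v" if u: "u \<in> V" and v: "v \<in> V" and uv: "own u = own v" for u v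
  proof -
    \<comment> \<open>Both vertices may lie in overlaps. Going through the core then costs two
      levels above i, and i + 2 \<le> c + 1 because r \<ge> 1.\<close>
    have "R (Suc (Suc i)) u v"
    proof (cases "v \<in> Ov")
      case True
      have "{x\<in>V. R 0 x v} \<inter> core (own v) \<subseteq> {x\<in>V. R (Suc i) u x \<and> R (Suc i) x v}"
        using related1[OF u] uv mono[of 0 _ v "Suc i"] v i by auto
      then have "card ({x\<in>V. R 0 x v} \<inter> core (own v)) \<le> card {x\<in>V. R (Suc i) u x \<and> R (Suc i) x v}"
        using fin by (intro card_mono) auto
      then show ?thesis using own_ov(2)[OF True] comp[of "Suc i" u v] u v i by linarith
    next
      case False
      then have "R (Suc i) u v" using related1[OF u, of v] own_core[OF v] uv by simp
      then show ?thesis using suc[of "Suc i"] u v i by simp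
    qed
    then show ?thesis using mono[of "Suc (Suc i)" u v "Suc c"] u v i by simp
  qed
  have "partition_on V (part ` S)"
  proof (rule partition_onI)
    show "\<Union>(part ` S) = V" using own_S unfolding part_def by auto
    show "{} \<notin> part ` S"
      using big mult_pos_pos[OF d(1) n] by (metis card.empty imageE not_le of_nat_0)
    show "disjnt p q" if "p \<in> part ` S" "q \<in> part ` S" "p \<noteq> q" for p q
      using that unfolding disjnt_def part_def by auto
  qed
  moreover have "card (part ` S) \<le> c" using card_image_le[OF finS, of part] S r by simp
  ultimately show ?thesis using big related unfolding part_def by (intro exI[of _ "part ` S"]) (auto simp: part_def)
qed

section \<open>Reachability\<close>

text \<open>Lists with repetitions are counted so that densities multiply under concatenation.
  Degenerate lists have density O(1/n) and are discarded once, at the end of a construction.\<close>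

definition dense_tuples :: "'a set \<Rightarrow> nat \<Rightarrow> real \<Rightarrow> ('a list \<Rightarrow> bool) \<Rightarrow> bool" where
  "dense_tuples V m b Q \<longleftrightarrow>
     b * real (card V) ^ m \<le> real (card {xs. set xs \<subseteq> V \<and> length xs = m \<and> Q xs})"

lemma finite_tuples: "finite V \<Longrightarrow> finite {xs. set xs \<subseteq> V \<and> length xs = m \<and> Q xs}"
  by (rule finite_subset[OF _ finite_lists_length_eq[of V m]]) auto

lemma dense_tuples_mono:
  assumes "dense_tuples V m b Q" "finite V" "b' \<le> b"
    and "\<And>xs. set xs \<subseteq> V \<Longrightarrow> length xs = m \<Longrightarrow> Q xs \<Longrightarrow> Q' xs"
  shows "dense_tuples V m b' Q'"
proof -
  have "card {xs. set xs \<subseteq> V \<and> length xs = m \<and> Q xs} \<le> card {xs. set xs \<subseteq> V \<and> length xs = m \<and> Q' xs}"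
    using assms by (intro card_mono finite_tuples) auto
  moreover have "b' * real (card V) ^ m \<le> b * real (card V) ^ m" using assms by (intro mult_right_mono) auto
  ultimately show ?thesis using assms(1) unfolding dense_tuples_def by linarith
qed

lemma dense_tuples_append:
  assumes "dense_tuples V l a (\<lambda>xs. dense_tuples V m b (\<lambda>ys. Q (xs @ ys)))" "finite V" "0 \<le> b"
  shows "dense_tuples V (l + m) (a * b) Q"
proof -
  let ?X = "{xs. set xs \<subseteq> V \<and> length xs = l \<and> dense_tuples V m b (\<lambda>ys. Q (xs @ ys))}"
  let ?Y = "\<lambda>xs. {ys. set ys \<subseteq> V \<and> length ys = m \<and> Q (xs @ ys)}"
  have finX: "finite ?X" and finY: "finite (?Y xs)" for xs using assms(2) by (auto intro: finite_tuples)
  have "a * real (card V) ^ l * (b * real (card V) ^ m) \<le> real (card ?X) * (b * real (card V) ^ m)"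
    using assms unfolding dense_tuples_def[of V l] by (intro mult_right_mono) auto
  also have "\<dots> = (\<Sum>xs\<in>?X. b * real (card V) ^ m)" by simp
  also have "\<dots> \<le> (\<Sum>xs\<in>?X. real (card (?Y xs)))"
    by (intro sum_mono) (auto simp: dense_tuples_def)
  also have "\<dots> = real (card (Sigma ?X ?Y))"
    using finX finY by (simp add: card_SigmaI)
  also have "card (Sigma ?X ?Y) = card ((\<lambda>(xs, ys). xs @ ys) ` Sigma ?X ?Y)"
    by (rule card_image[symmetric]) (auto simp: inj_on_def)
  also have "\<dots> \<le> card {xs. set xs \<subseteq> V \<and> length xs = l + m \<and> Q xs}"
    using assms(2) by (intro card_mono finite_tuples) auto
  finally show ?thesis unfolding dense_tuples_def by (simp add: power_add mult_ac)
qed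

lemma dense_tuples_Cons:
  assumes "a * real (card V) \<le> real (card {x\<in>V. dense_tuples V m b (\<lambda>xs. Q (x # xs))})" "finite V" "0 \<le> b"
  shows "dense_tuples V (Suc m) (a * b) Q"
proof -
  have "{xs. set xs \<subseteq> V \<and> length xs = 1 \<and> dense_tuples V m b (\<lambda>ys. Q (xs @ ys))}
      = (\<lambda>x. [x]) ` {x\<in>V. dense_tuples V m b (\<lambda>xs. Q (x # xs))}"
    by (auto simp: length_Suc_conv)
  then have "dense_tuples V 1 a (\<lambda>xs. dense_tuples V m b (\<lambda>ys. Q (xs @ ys)))"
    unfolding dense_tuples_def[of V 1] using assms(1) by (simp add: card_image inj_on_def)
  from dense_tuples_append[OF this assms(2,3)] show ?thesis by simp
qed

text \<open>The factor \<open>card V\<close> on the left stands for an exponent m - 1 on the right.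
  A degenerate list has a degenerate tail, or its head lies in F or in the tail.\<close>

lemma card_degenerate_tuples_le:
  assumes "finite V" "finite F"
  shows "card V * card {xs. set xs \<subseteq> V \<and> length xs = m \<and> \<not> (distinct xs \<and> set xs \<inter> F = {})}
     \<le> m * (card F + m) * card V ^ m"
proof (induction m)
  case (Suc m)
  let ?B = "\<lambda>m. {xs. set xs \<subseteq> V \<and> length xs = m \<and> \<not> (distinct xs \<and> set xs \<inter> F = {})}"
  let ?T = "{xs. set xs \<subseteq> V \<and> length xs = m}"
  have fB: "finite (?B m)" using assms by (intro finite_tuples)
  have fT: "finite ?T" by (rule finite_lists_length_eq[OF assms(1)])
  have sub: "?B (Suc m) \<subseteq> (\<lambda>(x, xs). x # xs) ` (V \<times> ?B m) \<union> (\<Union>xs\<in>?T. (\<lambda>x. x # xs) ` (F \<union> set xs))"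
    by (auto simp: length_Suc_conv image_iff)
  have "card (?B (Suc m)) \<le> card ((\<lambda>(x, xs). x # xs) ` (V \<times> ?B m) \<union> (\<Union>xs\<in>?T. (\<lambda>x. x # xs) ` (F \<union> set xs)))"
    using sub fB fT assms by (intro card_mono) auto
  also have "\<dots> \<le> card ((\<lambda>(x, xs). x # xs) ` (V \<times> ?B m)) + card (\<Union>xs\<in>?T. (\<lambda>x. x # xs) ` (F \<union> set xs))"
    by (rule card_Un_le)
  also have "card ((\<lambda>(x, xs). x # xs) ` (V \<times> ?B m)) \<le> card V * card (?B m)"
    using card_image_le[of "V \<times> ?B m" "\<lambda>(x, xs). x # xs"] fB assms by (simp add: card_cartesian_product)
  also have "card (\<Union>xs\<in>?T. (\<lambda>x. x # xs) ` (F \<union> set xs)) \<le> (\<Sum>xs\<in>?T. card ((\<lambda>x. x # xs) ` (F \<union> set xs)))"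
    by (rule card_UN_le[OF fT])
  also have "\<dots> \<le> (\<Sum>xs\<in>?T. card F + m)"
  proof (intro sum_mono)
    fix xs assume xs: "xs \<in> ?T"
    have "card ((\<lambda>x. x # xs) ` (F \<union> set xs)) \<le> card (F \<union> set xs)"
      using assms by (intro card_image_le) auto
    also have "\<dots> \<le> card F + card (set xs)" by (rule card_Un_le)
    also have "\<dots> \<le> card F + m" using card_length[of xs] xs by simp
    finally show "card ((\<lambda>x. x # xs) ` (F \<union> set xs)) \<le> card F + m" .
  qed
  also have "\<dots> = card V ^ m * (card F + m)" by (simp add: card_lists_length_eq[OF assms(1)])
  finally have "card V * card (?B (Suc m)) \<le> card V * (card V * card (?B m) + card V ^ m * (card F + m))"
    by simp
  also have "\<dots> \<le> card V * (m * (card F + m) * card V ^ m + card V ^ m * (card F + m))"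
    using Suc.IH by simp
  also have "\<dots> = Suc m * (card F + m) * card V ^ Suc m" by (simp add: algebra_simps)
  also have "\<dots> \<le> Suc m * (card F + Suc m) * card V ^ Suc m" by (intro mult_le_mono) auto
  finally show ?case .
qed simp

lemma dense_tuples_distinct_avoiding:
  assumes Q: "dense_tuples V m b Q" and fin: "finite V" "finite F" and b: "0 < b"
    and n: "2 * real (m * (c + m)) \<le> b * real (card V)" "0 < card V" and c: "card F \<le> c"
  shows "dense_tuples V m (b / 2) (\<lambda>xs. Q xs \<and> distinct xs \<and> set xs \<inter> F = {})"
proof -
  let ?n = "real (card V)"
  let ?B = "{xs. set xs \<subseteq> V \<and> length xs = m \<and> \<not> (distinct xs \<and> set xs \<inter> F = {})}"
  let ?G = "{xs. set xs \<subseteq> V \<and> length xs = m \<and> Q xs \<and> distinct xs \<and> set xs \<inter> F = {}}"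
  let ?A = "{xs. set xs \<subseteq> V \<and> length xs = m \<and> Q xs}"
  have "card V * card ?B \<le> m * (card F + m) * card V ^ m" by (rule card_degenerate_tuples_le[OF fin])
  also have "\<dots> \<le> m * (c + m) * card V ^ m" using c by (intro mult_le_mono) auto
  finally have "real (card V * card ?B) \<le> real (m * (c + m) * card V ^ m)" by (simp only: of_nat_le_iff)
  then have "?n * real (card ?B) \<le> real (m * (c + m)) * ?n ^ m" by simp
  also have "\<dots> \<le> (b * ?n / 2) * ?n ^ m" using n by (intro mult_right_mono) auto
  finally have B: "real (card ?B) \<le> b / 2 * ?n ^ m" using n(2) by (simp add: mult_ac)
  have "card ?A \<le> card (?G \<union> ?B)" using fin by (intro card_mono finite_UnI finite_tuples) auto
  also have "\<dots> \<le> card ?G + card ?B" by (rule card_Un_le)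
  finally have "real (card ?A) \<le> real (card ?G) + real (card ?B)" by simp
  then show ?thesis using Q B unfolding dense_tuples_def by simp
qed

section \<open>Matchable sets and reachable pairs\<close>

definition matchable :: "'a set set \<Rightarrow> 'a set \<Rightarrow> bool" where
  "matchable H S \<longleftrightarrow> (\<exists>M. perfect_matching S H M)"

lemma matchable_empty: "matchable H {}"
  unfolding matchable_def perfect_matching_def by (intro exI[of _ "{}"]) auto

lemma matchable_edge: "e \<in> H \<Longrightarrow> matchable H e"
  unfolding matchable_def perfect_matching_def by (intro exI[of _ "{e}"]) auto

lemma matchable_Un:
  assumes "matchable H S" "matchable H T" "S \<inter> T = {}"
  shows "matchable H (S \<union> T)"
proof -
  obtain M N where M: "M \<subseteq> H" "\<Union>M = S" "\<forall>e\<in>M. \<forall>f\<in>M. e \<noteq> f \<longrightarrow> e \<inter> f = {}"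
    and N: "N \<subseteq> H" "\<Union>N = T" "\<forall>e\<in>N. \<forall>f\<in>N. e \<noteq> f \<longrightarrow> e \<inter> f = {}"
    using assms(1,2) unfolding matchable_def perfect_matching_def by auto
  have "e \<inter> f = {}" if "e \<in> M" "f \<in> N" for e f
  proof -
    have "e \<subseteq> S" "f \<subseteq> T" using M(2) N(2) that by auto
    then show ?thesis using assms(3) by auto
  qed
  then have "\<forall>e\<in>M \<union> N. \<forall>f\<in>M \<union> N. e \<noteq> f \<longrightarrow> e \<inter> f = {}"
    using M(3) N(3) by (metis Int_commute UnE)
  then show ?thesis unfolding matchable_def perfect_matching_def
    using M N by (intro exI[of _ "M \<union> N"]) auto
qed

lemma dvd_card_matchable:
  assumes "matchable H S" "finite S" "\<And>e. e \<in> H \<Longrightarrow> card e = k"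
  shows "k dvd card S"
proof -
  obtain M where M: "M \<subseteq> H" "\<Union>M = S" "\<forall>e\<in>M. \<forall>f\<in>M. e \<noteq> f \<longrightarrow> e \<inter> f = {}"
    using assms(1) unfolding matchable_def perfect_matching_def by auto
  have "card S = sum card M"
  proof -
    have "pairwise disjnt M" using M(3) unfolding pairwise_def disjnt_def by blast
    moreover have "finite e" if "e \<in> M" for e
      using that M(2) assms(2) by (meson Union_upper finite_subset)
    ultimately show ?thesis using card_Union_disjoint[of M] M(2) by simp
  qed
  also have "\<dots> = (\<Sum>e\<in>M. k)" using M assms(3) by (intro sum.cong) auto
  finally show ?thesis by simp
qed

text \<open>One and the same list completes u and v, so u and v can be exchanged by rematching that
  list. The case u = v is allowed and says that v lies in many matchable sets of size m + 1.\<close>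

definition reachable :: "'a set \<Rightarrow> 'a set set \<Rightarrow> nat \<Rightarrow> real \<Rightarrow> 'a \<Rightarrow> 'a \<Rightarrow> bool" where
  "reachable V H m b u v \<longleftrightarrow> dense_tuples V m b (\<lambda>xs. distinct xs \<and> u \<notin> set xs \<and> v \<notin> set xs \<and>
     matchable H (insert u (set xs)) \<and> matchable H (insert v (set xs)))"

lemma reachable_sym: "reachable V H m b u v \<Longrightarrow> reachable V H m b v u"
  unfolding reachable_def by (simp add: conj_ac)

text \<open>For an intermediate vertex w the list \<open>w # xs @ ys\<close> serves both ends: with
  u it splits into u, xs and w, ys; with v it splits into w, xs and v, ys. This gives length 2 m + 1
  and density \<eta> b^2, halved when degenerate lists are removed.\<close>

lemma reachable_trans_robust:
  assumes fin: "finite V" and pos: "0 < b" "0 < \<eta>" and ne: "0 < card V"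
    and n: "2 * real ((2 * m + 1) * (2 + (2 * m + 1))) \<le> \<eta> * b\<^sup>2 * real (card V)"
    and w: "\<eta> * real (card V) \<le> real (card {w\<in>V. reachable V H m b u w \<and> reachable V H m b w v})"
  shows "reachable V H (2 * m + 1) (\<eta> * b\<^sup>2 / 2) u v"
proof -
  define P where "P u v xs \<longleftrightarrow> distinct xs \<and> u \<notin> set xs \<and> v \<notin> set xs \<and>
     matchable H (insert u (set xs)) \<and> matchable H (insert v (set xs))" for u v xs
  have reach: "reachable V H m b u v = dense_tuples V m b (P u v)" for u v
    unfolding reachable_def P_def ..
  define Q where "Q zs \<longleftrightarrow> (\<exists>w xs ys. zs = w # xs @ ys \<and> P u w xs \<and> P w v ys)" for zs
  have "dense_tuples V (m + m) (b * b) (\<lambda>zs. Q (w # zs))"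
    if w: "reachable V H m b u w \<and> reachable V H m b w v" for w
  proof (rule dense_tuples_append[OF _ fin])
    show "dense_tuples V m b (\<lambda>xs. dense_tuples V m b (\<lambda>ys. Q (w # xs @ ys)))"
    proof (rule dense_tuples_mono[where Q = "P u w" and b = b])
      show "dense_tuples V m b (P u w)" using w reach by simp
      fix xs assume xs: "P u w xs"
      show "dense_tuples V m b (\<lambda>ys. Q (w # xs @ ys))"
        by (rule dense_tuples_mono[where Q = "P w v" and b = b]) (use w reach xs fin in \<open>auto simp: Q_def\<close>)
    qed (use fin in auto)
  qed (use pos in auto)
  then have "{w\<in>V. reachable V H m b u w \<and> reachable V H m b w v} \<subseteq> {w\<in>V. dense_tuples V (m + m) (b * b) (\<lambda>zs. Q (w # zs))}"
    by auto
  then have "card {w\<in>V. reachable V H m b u w \<and> reachable V H m b w v} \<le> card {w\<in>V. dense_tuples V (m + m) (b * b) (\<lambda>zs. Q (w # zs))}"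
    using fin by (intro card_mono) auto
  then have "\<eta> * real (card V) \<le> real (card {w\<in>V. dense_tuples V (m + m) (b * b) (\<lambda>zs. Q (w # zs))})"
    using w by linarith
  then have "dense_tuples V (Suc (m + m)) (\<eta> * (b * b)) Q"
    by (rule dense_tuples_Cons) (use fin pos in auto)
  then have dQ: "dense_tuples V (2 * m + 1) (\<eta> * b\<^sup>2) Q"
    by (simp add: power2_eq_square mult_2)
  have card2: "card {u, v} \<le> 2" by (cases "u = v") auto
  have "dense_tuples V (2 * m + 1) (\<eta> * b\<^sup>2 / 2) (\<lambda>zs. Q zs \<and> distinct zs \<and> set zs \<inter> {u, v} = {})"
    by (rule dense_tuples_distinct_avoiding[OF dQ fin _ _ n ne card2]) (use pos in auto)
  then show ?thesis unfolding reachable_def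
  proof (rule dense_tuples_mono[OF _ fin order_refl])
    fix zs assume zs: "Q zs \<and> distinct zs \<and> set zs \<inter> {u, v} = {}"
    then obtain w xs ys where eq: "zs = w # xs @ ys" and P: "P u w xs" "P w v ys" unfolding Q_def by auto
    have d: "distinct (w # xs @ ys)" "u \<notin> set zs" "v \<notin> set zs" using zs eq by auto
    have "matchable H (insert u (set xs) \<union> insert w (set ys))"
      using P d eq by (intro matchable_Un) (auto simp: P_def)
    moreover have "matchable H (insert v (set ys) \<union> insert w (set xs))"
      using P d eq by (intro matchable_Un) (auto simp: P_def)
    moreover have "insert u (set xs) \<union> insert w (set ys) = insert u (set zs)"
      "insert v (set ys) \<union> insert w (set xs) = insert v (set zs)" using eq by auto
    ultimately show "distinct zs \<and> u \<notin> set zs \<and> v \<notin> set zs \<and>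
     matchable H (insert u (set zs)) \<and> matchable H (insert v (set zs))" using zs d by auto
  qed
qed

text \<open>Carries related pairs to the next level: the list for u and v is padded by a matchable
  set w, xs, so that length and density agree with those of
  \<open>reachable_trans_robust\<close>.\<close>

lemma reachable_extend:
  assumes fin: "finite V" and pos: "0 < b" "0 < \<eta>" "\<eta> \<le> 1" and ne: "0 < card V"
    and n: "2 * real ((2 * m + 1) * (2 + (2 * m + 1))) \<le> \<eta> * b\<^sup>2 * real (card V)"
    and uv: "reachable V H m b u v" and refl: "\<And>w. w \<in> V \<Longrightarrow> reachable V H m b w w"
  shows "reachable V H (2 * m + 1) (\<eta> * b\<^sup>2 / 2) u v"
proof -
  define P where "P u v xs \<longleftrightarrow> distinct xs \<and> u \<notin> set xs \<and> v \<notin> set xs \<and>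
     matchable H (insert u (set xs)) \<and> matchable H (insert v (set xs))" for u v xs
  have reach: "reachable V H m b u v = dense_tuples V m b (P u v)" for u v
    unfolding reachable_def P_def ..
  define Q where "Q zs \<longleftrightarrow> (\<exists>w xs ys. zs = w # xs @ ys \<and> P w w xs \<and> P u v ys)" for zs
  have "dense_tuples V (m + m) (b * b) (\<lambda>zs. Q (w # zs))" if w: "w \<in> V" for w
  proof (rule dense_tuples_append[OF _ fin])
    show "dense_tuples V m b (\<lambda>xs. dense_tuples V m b (\<lambda>ys. Q (w # xs @ ys)))"
    proof (rule dense_tuples_mono[where Q = "P w w" and b = b])
      show "dense_tuples V m b (P w w)" using refl[OF w] reach by simp
      fix xs assume xs: "P w w xs"
      show "dense_tuples V m b (\<lambda>ys. Q (w # xs @ ys))"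
        by (rule dense_tuples_mono[where Q = "P u v" and b = b]) (use uv reach xs fin in \<open>auto simp: Q_def\<close>)
    qed (use fin in auto)
  qed (use pos in auto)
  then have "{w\<in>V. dense_tuples V (m + m) (b * b) (\<lambda>zs. Q (w # zs))} = V" by auto
  then have "\<eta> * real (card V) \<le> real (card {w\<in>V. dense_tuples V (m + m) (b * b) (\<lambda>zs. Q (w # zs))})"
    using pos by (simp add: mult_left_le_one_le)
  then have "dense_tuples V (Suc (m + m)) (\<eta> * (b * b)) Q"
    by (rule dense_tuples_Cons) (use fin pos in auto)
  then have dQ: "dense_tuples V (2 * m + 1) (\<eta> * b\<^sup>2) Q"
    by (simp add: power2_eq_square mult_2)
  have card2: "card {u, v} \<le> 2" by (cases "u = v") auto
  have "dense_tuples V (2 * m + 1) (\<eta> * b\<^sup>2 / 2) (\<lambda>zs. Q zs \<and> distinct zs \<and> set zs \<inter> {u, v} = {})"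
    by (rule dense_tuples_distinct_avoiding[OF dQ fin _ _ n ne card2]) (use pos in auto)
  then show ?thesis unfolding reachable_def
  proof (rule dense_tuples_mono[OF _ fin order_refl])
    fix zs assume zs: "Q zs \<and> distinct zs \<and> set zs \<inter> {u, v} = {}"
    then obtain w xs ys where eq: "zs = w # xs @ ys" and P: "P w w xs" "P u v ys" unfolding Q_def by auto
    have d: "distinct (w # xs @ ys)" "u \<notin> set zs" "v \<notin> set zs" using zs eq by auto
    have "matchable H (insert w (set xs) \<union> insert u (set ys))"
      using P d eq by (intro matchable_Un) (auto simp: P_def)
    moreover have "matchable H (insert w (set xs) \<union> insert v (set ys))"
      using P d eq by (intro matchable_Un) (auto simp: P_def)
    moreover have "insert w (set xs) \<union> insert u (set ys) = insert u (set zs)"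
      "insert w (set xs) \<union> insert v (set ys) = insert v (set zs)" using eq by auto
    ultimately show "distinct zs \<and> u \<notin> set zs \<and> v \<notin> set zs \<and>
     matchable H (insert u (set zs)) \<and> matchable H (insert v (set zs))" using zs d by auto
  qed
qed

section \<open>Absorption\<close>

text \<open>Concatenate one connecting list for each pair of corresponding entries. Matchability is
  conditional on distinctness because the pieces of a counted list may overlap; this is repaired
  later for the whole list at once.\<close>

lemma dense_tuples_connecting:
  assumes "list_all2 (reachable V H m b) xs ys" "finite V" "0 \<le> b"
  shows "dense_tuples V (length xs * m) (b ^ length xs) (\<lambda>zs.
    (distinct (xs @ zs) \<longrightarrow> matchable H (set xs \<union> set zs)) \<and>
    (distinct (ys @ zs) \<longrightarrow> matchable H (set ys \<union> set zs)))"
  using assms(1)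
proof (induction rule: list_all2_induct)
  case Nil
  have "{xs. set xs \<subseteq> V \<and> length xs = 0 \<and> matchable H (set xs)} = {[]}"
    by (auto simp: matchable_empty)
  then show ?case unfolding dense_tuples_def by (simp cong: conj_cong)
next
  case (Cons x xs y ys)
  let ?R = "\<lambda>xs ys zs. (distinct (xs @ zs) \<longrightarrow> matchable H (set xs \<union> set zs)) \<and>
    (distinct (ys @ zs) \<longrightarrow> matchable H (set ys \<union> set zs))"
  let ?P = "\<lambda>ss. distinct ss \<and> x \<notin> set ss \<and> y \<notin> set ss \<and>
     matchable H (insert x (set ss)) \<and> matchable H (insert y (set ss))"
  have "dense_tuples V (m + length xs * m) (b * b ^ length xs) (?R (x # xs) (y # ys))"
  proof (rule dense_tuples_append[OF _ assms(2)])
    show "dense_tuples V m b (\<lambda>ss. dense_tuples V (length xs * m) (b ^ length xs) (\<lambda>zs. ?R (x # xs) (y # ys) (ss @ zs)))"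
    proof (rule dense_tuples_mono[where Q = ?P and b = b])
      show "dense_tuples V m b ?P" using Cons unfolding reachable_def by simp
      fix ss assume P: "?P ss"
      show "dense_tuples V (length xs * m) (b ^ length xs) (\<lambda>zs. ?R (x # xs) (y # ys) (ss @ zs))"
      proof (rule dense_tuples_mono[OF Cons.IH assms(2) order_refl])
        fix zs assume zs: "?R xs ys zs"
        have *: "set (a # as) \<union> set (ss @ zs) = insert a (set ss) \<union> (set as \<union> set zs)" for a as by auto
        show "?R (x # xs) (y # ys) (ss @ zs)"
        proof (intro conjI impI)
          assume "distinct ((x # xs) @ ss @ zs)"
          then show "matchable H (set (x # xs) \<union> set (ss @ zs))"
            unfolding * using zs P by (intro matchable_Un[of H "insert x (set ss)" "set xs \<union> set zs"]) auto
        next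
          assume "distinct ((y # ys) @ ss @ zs)"
          then show "matchable H (set (y # ys) \<union> set (ss @ zs))"
            unfolding * using zs P by (intro matchable_Un[of H "insert y (set ss)" "set ys \<union> set zs"]) auto
        qed
      qed
    qed (use assms in auto)
  qed (use assms in auto)
  then show ?case by simp
qed

definition absorbs :: "'a set set \<Rightarrow> 'a set \<Rightarrow> 'a set \<Rightarrow> bool" where
  "absorbs H T Q \<longleftrightarrow> T \<inter> Q = {} \<and> matchable H T \<and> matchable H (T \<union> Q)"

text \<open>An absorber consists of an edge \<open>ys\<close> and lists \<open>zs\<close> that
  connect its vertices to those of Q. Alone, it matches zs together with ys; to take in Q, it uses
  ys as an edge and matches zs together with Q.\<close>

lemma dense_tuples_absorbing:
  assumes fin: "finite V" and b: "0 < b" and a: "0 < a"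
    and reach: "\<And>u v. u \<in> V \<Longrightarrow> v \<in> V \<Longrightarrow> reachable V H m b u v"
    and edges: "dense_tuples V k a (\<lambda>xs. distinct xs \<and> set xs \<in> H)"
    and Q: "Q \<subseteq> V" "card Q = k"
    and n: "2 * real ((k + k * m) * (k + (k + k * m))) \<le> (a * b ^ k) * real (card V)" "0 < card V"
  shows "dense_tuples V (k + k * m) (a * b ^ k / 2) (\<lambda>zs. distinct zs \<and> absorbs H (set zs) Q)"
proof -
  have finQ: "finite Q" using Q fin finite_subset by blast
  obtain q where q: "set q = Q" "distinct q" using finite_distinct_list[OF finQ] by auto
  have lq: "length q = k" using q Q distinct_card by metis
  let ?R = "\<lambda>ys zs. (distinct (q @ zs) \<longrightarrow> matchable H (set q \<union> set zs)) \<and>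
    (distinct (ys @ zs) \<longrightarrow> matchable H (set ys \<union> set zs))"
  let ?S = "\<lambda>ws. \<exists>ys zs. ws = ys @ zs \<and> distinct ys \<and> set ys \<in> H \<and> ?R ys zs"
  have "dense_tuples V (k + k * m) (a * b ^ k) ?S"
  proof (rule dense_tuples_append[OF _ fin])
    show "dense_tuples V k a (\<lambda>ys. dense_tuples V (k * m) (b ^ k) (\<lambda>zs. ?S (ys @ zs)))"
    proof (rule dense_tuples_mono[OF edges fin order_refl])
      fix ys assume ys: "set ys \<subseteq> V" "length ys = k" "distinct ys \<and> set ys \<in> H"
      have la: "list_all2 (reachable V H m b) q ys"
        unfolding list_all2_conv_all_nth using lq ys q Q
        by (auto intro!: reach)
      show "dense_tuples V (k * m) (b ^ k) (\<lambda>zs. ?S (ys @ zs))"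
        using dense_tuples_connecting[OF la fin less_imp_le[OF b]] unfolding lq
      proof (rule dense_tuples_mono)
        fix zs assume "?R ys zs"
        then show "?S (ys @ zs)" using ys(3) by (intro exI[of _ ys] exI[of _ zs]) blast
      qed (use fin in auto)
    qed
  qed (use b in auto)
  then have "dense_tuples V (k + k * m) (a * b ^ k / 2) (\<lambda>ws. ?S ws \<and> distinct ws \<and> set ws \<inter> Q = {})"
    by (rule dense_tuples_distinct_avoiding[OF _ fin finQ _ n]) (use Q a b in auto)
  then show ?thesis
  proof (rule dense_tuples_mono[OF _ fin order_refl])
    fix ws assume ws: "?S ws \<and> distinct ws \<and> set ws \<inter> Q = {}"
    then obtain ys zs where eq: "ws = ys @ zs" and yz: "distinct ys" "set ys \<in> H" "?R ys zs" by auto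
    have "matchable H (set ys \<union> (set q \<union> set zs))"
    proof (rule matchable_Un)
      show "matchable H (set ys)" using yz(2) by (rule matchable_edge)
    qed (use ws eq yz q in auto)
    moreover have "set ys \<union> (set q \<union> set zs) = set ws \<union> Q" using eq q by auto
    moreover have "matchable H (set ws)" using ws eq yz by auto
    ultimately show "distinct ws \<and> absorbs H (set ws) Q" unfolding absorbs_def using ws by auto
  qed
qed

text \<open>The family is chosen greedily so as to decrease the potential
  \<open>\<Sum>Q. (1/2) ^ (number of absorbers of Q)\<close> as much as the average candidate does.\<close>
lemma absorbing_family_potential:
  assumes fin: "finite V" "finite \<Q>" and ne: "0 < card V" and l: "0 < l" and b: "0 < b" "b \<le> 1"
    and dense: "\<And>Q. Q \<in> \<Q> \<Longrightarrow> dense_tuples V l b (\<lambda>zs. distinct zs \<and> absorbs H (set zs) Q)"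
  shows "2 * real (l * (l * t + l)) \<le> b * real (card V) \<Longrightarrow>
    \<exists>\<F>. finite \<F> \<and> card \<F> \<le> t \<and> (\<forall>S\<in>\<F>. \<forall>T\<in>\<F>. S \<noteq> T \<longrightarrow> S \<inter> T = {}) \<and>
      (\<forall>T\<in>\<F>. T \<subseteq> V \<and> card T = l \<and> matchable H T) \<and>
      (\<Sum>Q\<in>\<Q>. (1/2) ^ card {T\<in>\<F>. absorbs H T Q}) \<le> real (card \<Q>) * (1 - b / 4) ^ t"
proof (induction t)
  case 0
  then show ?case by (intro exI[of _ "{}"]) auto
next
  case (Suc t)
  have "l * (l * t + l) \<le> l * (l * Suc t + l)" by (intro mult_le_mono) auto
  then have "2 * real (l * (l * t + l)) \<le> 2 * real (l * (l * Suc t + l))" by (simp only: of_nat_le_iff mult_le_cancel_left_pos zero_less_numeral)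
  then have small: "2 * real (l * (l * t + l)) \<le> b * real (card V)" using Suc.prems by linarith
  from Suc.IH[OF small] obtain \<F> where F: "finite \<F>" "card \<F> \<le> t" "\<forall>S\<in>\<F>. \<forall>T\<in>\<F>. S \<noteq> T \<longrightarrow> S \<inter> T = {}"
      "\<forall>T\<in>\<F>. T \<subseteq> V \<and> card T = l \<and> matchable H T"
      "(\<Sum>Q\<in>\<Q>. (1/2) ^ card {T\<in>\<F>. absorbs H T Q}) \<le> real (card \<Q>) * (1 - b / 4) ^ t" by blast
  show ?case
  proof (cases "\<Q> = {}")
    case True
    then show ?thesis using F by (intro exI[of _ \<F>]) auto
  next
    case False
    define wt where "wt Q = (1/2::real) ^ card {T\<in>\<F>. absorbs H T Q}" for Q
    let ?L = "{xs. set xs \<subseteq> V \<and> length xs = l}"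
    define G where "G Q = {xs. set xs \<subseteq> V \<and> length xs = l \<and> (distinct xs \<and> absorbs H (set xs) Q) \<and>
      distinct xs \<and> set xs \<inter> \<Union>\<F> = {}}" for Q
    have finL: "finite ?L" by (rule finite_lists_length_eq[OF fin(1)])
    have cL: "card ?L = card V ^ l" by (rule card_lists_length_eq[OF fin(1)])
    have finU: "finite (\<Union>\<F>)" using F(1,4) fin(1) by (meson finite_Union finite_subset)
    have cU: "card (\<Union>\<F>) \<le> l * t"
    proof -
      have "card (\<Union>\<F>) \<le> sum card \<F>" by (rule card_Union_le_sum_card)
      also have "\<dots> = card \<F> * l" using F(4) by simp
      also have "\<dots> \<le> l * t" using F(2) by simp
      finally show ?thesis .
    qed
    have G: "b / 2 * real (card ?L) \<le> real (card (G Q))" if "Q \<in> \<Q>" for Q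
      using dense_tuples_distinct_avoiding[OF dense[OF that] fin(1) finU b(1) small ne cU]
      unfolding dense_tuples_def G_def cL by simp
    have GL: "G Q \<subseteq> ?L" for Q unfolding G_def by auto
    have wt_pos: "0 < wt Q" for Q unfolding wt_def by simp
    \<comment> \<open>Every Q accepts a proportion b / 2 of all lists, even among those disjoint
      from the present family. Averaging over the lists, some y is accepted by that share of the
      total weight.\<close>
    have "\<exists>y\<in>?L. b / 2 * sum wt \<Q> \<le> (\<Sum>Q\<in>\<Q>. wt Q * of_bool (y \<in> G Q))"
    proof (rule ccontr)
      assume "\<not> ?thesis"
      then have lt: "(\<Sum>Q\<in>\<Q>. wt Q * of_bool (y \<in> G Q)) < b / 2 * sum wt \<Q>" if "y \<in> ?L" for y
        using that by force
      have neL: "?L \<noteq> {}"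
      proof -
        have "0 < card ?L" unfolding cL using ne by simp
        then show ?thesis by force
      qed
      have "(\<Sum>y\<in>?L. \<Sum>Q\<in>\<Q>. wt Q * of_bool (y \<in> G Q)) < (\<Sum>y\<in>?L. b / 2 * sum wt \<Q>)"
        using lt finL neL by (intro sum_strict_mono) auto
      also have "\<dots> = (\<Sum>Q\<in>\<Q>. wt Q * (b / 2 * real (card ?L)))" by (simp add: sum_distrib_right mult_ac sum_distrib_left)
      also have "\<dots> \<le> (\<Sum>Q\<in>\<Q>. wt Q * real (card (G Q)))"
        using G wt_pos by (intro sum_mono mult_left_mono) (auto simp: less_imp_le)
      also have "\<dots> = (\<Sum>Q\<in>\<Q>. \<Sum>y\<in>?L. wt Q * of_bool (y \<in> G Q))"
      proof (intro sum.cong refl)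
        fix Q
        have "(\<Sum>y\<in>?L. of_bool (y \<in> G Q)) = real (card (?L \<inter> G Q))"
          using finL by (simp add: Int_def)
        also have "?L \<inter> G Q = G Q" using GL[of Q] by auto
        finally show "wt Q * real (card (G Q)) = (\<Sum>y\<in>?L. wt Q * of_bool (y \<in> G Q))"
          by (simp only: sum_distrib_left[symmetric])
      qed
      also have "\<dots> = (\<Sum>y\<in>?L. \<Sum>Q\<in>\<Q>. wt Q * of_bool (y \<in> G Q))" by (rule sum.swap)
      finally show False by simp
    qed
    then obtain y where y: "y \<in> ?L" and gain: "b / 2 * sum wt \<Q> \<le> (\<Sum>Q\<in>\<Q>. wt Q * of_bool (y \<in> G Q))" by blast
    have wt_sum: "0 < sum wt \<Q>" using wt_pos False fin(2) by (intro sum_pos) auto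
    \<comment> \<open>The average ran over all lists. Membership in some \<open>G Q\<close> is what
      makes the set of y admissible: l distinct entries, matchable, disjoint from the earlier
      members.\<close>
    have "\<exists>Q\<in>\<Q>. y \<in> G Q"
    proof (rule ccontr)
      assume "\<not> ?thesis"
      then have "(\<Sum>Q\<in>\<Q>. wt Q * of_bool (y \<in> G Q)) = 0" by (intro sum.neutral) auto
      then show False using gain mult_pos_pos[OF b(1) wt_sum] by simp
    qed
    then obtain Q0 where Q0: "y \<in> G Q0" by blast
    let ?T = "set y"
    have T: "?T \<subseteq> V" "card ?T = l" "matchable H ?T" "?T \<inter> \<Union>\<F> = {}"
      using Q0 distinct_card unfolding G_def absorbs_def by auto
    have T_new: "?T \<notin> \<F>"
    proof
      assume "?T \<in> \<F>"
      then have "?T \<subseteq> \<Union>\<F>" by (rule Union_upper)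
      then have "?T = {}" using T(4) by (simp add: Int_absorb2)
      then show False using T(2) l by simp
    qed
    have wt_new: "(1/2) ^ card {T\<in>insert ?T \<F>. absorbs H T Q} \<le> wt Q - 1/2 * (wt Q * of_bool (y \<in> G Q))" for Q
    proof (cases "absorbs H ?T Q")
      case True
      then have "{T\<in>insert ?T \<F>. absorbs H T Q} = insert ?T {T\<in>\<F>. absorbs H T Q}" by auto
      then have "card {T\<in>insert ?T \<F>. absorbs H T Q} = Suc (card {T\<in>\<F>. absorbs H T Q})" using T_new F(1) by simp
      then show ?thesis using wt_pos[of Q] unfolding wt_def by (simp add: of_bool_def)
    next
      case False
      then have "{T\<in>insert ?T \<F>. absorbs H T Q} = {T\<in>\<F>. absorbs H T Q}" "y \<notin> G Q" by (auto simp: G_def)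
      then show ?thesis unfolding wt_def by simp
    qed
    have "(\<Sum>Q\<in>\<Q>. (1/2) ^ card {T\<in>insert ?T \<F>. absorbs H T Q}) \<le> (\<Sum>Q\<in>\<Q>. wt Q - 1/2 * (wt Q * of_bool (y \<in> G Q)))"
      by (intro sum_mono wt_new)
    also have "\<dots> = sum wt \<Q> - 1/2 * (\<Sum>Q\<in>\<Q>. wt Q * of_bool (y \<in> G Q))"
      by (simp only: sum_subtractf sum_distrib_left)
    also have "\<dots> \<le> (1 - b / 4) * sum wt \<Q>" using gain by (simp add: algebra_simps)
    also have "\<dots> \<le> (1 - b / 4) * (real (card \<Q>) * (1 - b / 4) ^ t)"
      using F(5) b unfolding wt_def by (intro mult_left_mono) auto
    finally have "(\<Sum>Q\<in>\<Q>. (1/2) ^ card {T\<in>insert ?T \<F>. absorbs H T Q}) \<le> real (card \<Q>) * (1 - b / 4) ^ Suc t"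
      by (simp add: mult_ac)
    moreover have "card (insert ?T \<F>) \<le> Suc t" using F T_new by simp
    moreover have "\<forall>S\<in>insert ?T \<F>. \<forall>T\<in>insert ?T \<F>. S \<noteq> T \<longrightarrow> S \<inter> T = {}" using F(3) T(4) by blast
    ultimately show ?thesis using F(1,4) T(1-3) by (intro exI[of _ "insert ?T \<F>"]) auto
  qed
qed

lemma matchable_Union:
  assumes "finite \<F>" "\<And>T. T \<in> \<F> \<Longrightarrow> matchable H T" "\<And>S T. S \<in> \<F> \<Longrightarrow> T \<in> \<F> \<Longrightarrow> S \<noteq> T \<Longrightarrow> S \<inter> T = {}"
  shows "matchable H (\<Union>\<F>)"
  using assms
proof (induction \<F>)
  case (insert T \<F>)
  have "matchable H (T \<union> \<Union>\<F>)"
  proof (rule matchable_Un)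
    show "matchable H (\<Union>\<F>)" by (rule insert.IH) (use insert.prems in auto)
    have "T \<inter> S = {}" if "S \<in> \<F>" for S
      using insert.prems(2)[of T S] insert.hyps(2) that by (metis insert_iff)
    then show "T \<inter> \<Union>\<F> = {}" by (simp add: Int_Union)
  qed (use insert in auto)
  then show ?case by simp
qed (simp add: matchable_empty)

text \<open>Cut R into k-sets one at a time. Each of the q rounds uses up one member of the family,
  so a k-set of a later round loses at most one absorber per earlier round and never runs
  out.\<close>

lemma matchable_absorbing_family:
  assumes "0 < k" "finite \<F>" "\<And>T. T \<in> \<F> \<Longrightarrow> matchable H T"
    "\<And>S T. S \<in> \<F> \<Longrightarrow> T \<in> \<F> \<Longrightarrow> S \<noteq> T \<Longrightarrow> S \<inter> T = {}"
    "finite R" "card R = k * q" "R \<inter> \<Union>\<F> = {}"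
    "\<And>Q. Q \<subseteq> R \<Longrightarrow> card Q = k \<Longrightarrow> q \<le> card {T\<in>\<F>. absorbs H T Q}"
  shows "matchable H (\<Union>\<F> \<union> R)"
  using assms(2-)
proof (induction q arbitrary: \<F> R)
  case 0
  then show ?case using matchable_Union[of \<F> H] by simp
next
  case (Suc q)
  have "k \<le> card R" using Suc.prems(5) by simp
  then obtain Q where Q: "Q \<subseteq> R" "card Q = k" by (meson obtain_subset_with_card_n)
  have "0 < card {T\<in>\<F>. absorbs H T Q}" using Suc.prems(7)[OF Q] by simp
  then obtain T where T: "T \<in> \<F>" "absorbs H T Q" by (auto simp: card_gt_0_iff)
  have finQ: "finite Q" using Q Suc.prems(4) finite_subset by blast
  have "matchable H (\<Union>(\<F> - {T}) \<union> (R - Q))"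
  proof (rule Suc.IH)
    show "card (R - Q) = k * q" using Suc.prems(5) Q finQ by (simp add: card_Diff_subset)
    fix Q' assume Q': "Q' \<subseteq> R - Q" "card Q' = k"
    have "Suc q \<le> card {T\<in>\<F>. absorbs H T Q'}" using Suc.prems(7)[of Q'] Q' by blast
    also have "\<dots> \<le> card (insert T {S\<in>\<F> - {T}. absorbs H S Q'})"
      using Suc.prems(1) by (intro card_mono) auto
    also have "\<dots> \<le> Suc (card {S\<in>\<F> - {T}. absorbs H S Q'})" by (rule card_insert_le_m1) auto
    finally show "q \<le> card {S\<in>\<F> - {T}. absorbs H S Q'}" by simp
  qed (use Suc.prems in auto)
  moreover have "(\<Union>(\<F> - {T}) \<union> (R - Q)) \<inter> (T \<union> Q) = {}"
  proof -
    have "T \<inter> S = {}" if "S \<in> \<F> - {T}" for S using Suc.prems(3)[of T S] T(1) that by (metis DiffE insertI1)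
    then have "\<Union>(\<F> - {T}) \<inter> T = {}" by blast
    moreover have "R \<inter> T = {}" "\<Union>(\<F> - {T}) \<inter> R = {}" using Suc.prems(6) T(1) by blast+
    ultimately show ?thesis using Q by blast
  qed
  ultimately have "matchable H ((\<Union>(\<F> - {T}) \<union> (R - Q)) \<union> (T \<union> Q))"
    using T(2) unfolding absorbs_def by (metis matchable_Un)
  moreover have "(\<Union>(\<F> - {T}) \<union> (R - Q)) \<union> (T \<union> Q) = \<Union>\<F> \<union> R" using T(1) Q by auto
  ultimately show ?case by simp
qed

section \<open>Complexes of large minimum degree\<close>

lemma card_one_vertex_extensions:
  assumes J: "k_complex k V J" and e: "e \<in> J"
  shows "card {x\<in>V. x \<notin> e \<and> insert x e \<in> J} = cdeg J e"
proof -
  have fe: "finite e" and finV: "finite V" using J e unfolding k_complex_def by (auto intro: finite_subset)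
  have "{f \<in> layer J (Suc (card e)). e \<subseteq> f} = (\<lambda>x. insert x e) ` {x\<in>V. x \<notin> e \<and> insert x e \<in> J}"
  proof (intro equalityI subsetI)
    fix f assume "f \<in> {f \<in> layer J (Suc (card e)). e \<subseteq> f}"
    then have f: "f \<in> J" "card f = Suc (card e)" "e \<subseteq> f" by (auto simp: layer_def)
    have fV: "f \<subseteq> V" using f J unfolding k_complex_def by auto
    then have "card (f - e) = 1" using f fe by (simp add: card_Diff_subset)
    then obtain x where x: "f - e = {x}" by (auto simp: card_1_singleton_iff)
    then have "f = insert x e" using f by auto
    then show "f \<in> (\<lambda>x. insert x e) ` {x\<in>V. x \<notin> e \<and> insert x e \<in> J}"
      using x f fV by (intro image_eqI[of _ _ x]) auto
  qed (use fe in \<open>auto simp: layer_def\<close>)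
  moreover have "inj_on (\<lambda>x. insert x e) {x\<in>V. x \<notin> e \<and> insert x e \<in> J}"
    unfolding inj_on_def by auto
  ultimately show ?thesis unfolding cdeg_def by (simp add: card_image)
qed

text \<open>Bonferroni's bound, with the number of pairs rounded up to a square.\<close>

lemma sum_card_le_card_Union:
  assumes "finite S" "\<And>s. s \<in> S \<Longrightarrow> finite (A s)"
    "\<And>s t. s \<in> S \<Longrightarrow> t \<in> S \<Longrightarrow> s \<noteq> t \<Longrightarrow> real (card (A s \<inter> A t)) \<le> \<beta>" "0 \<le> \<beta>"
  shows "(\<Sum>s\<in>S. real (card (A s))) \<le> real (card (\<Union>s\<in>S. A s)) + (real (card S))\<^sup>2 * \<beta>"
  using assms
proof (induction S)
  case (insert t S)
  let ?U = "\<Union>s\<in>S. A s"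
  have IH: "(\<Sum>s\<in>S. real (card (A s))) \<le> real (card ?U) + (real (card S))\<^sup>2 * \<beta>"
    using insert.prems by (intro insert.IH) auto
  have "card (A t \<inter> ?U) \<le> (\<Sum>s\<in>S. card (A t \<inter> A s))"
    using card_UN_le[OF insert.hyps(1), of "\<lambda>s. A t \<inter> A s"] by (simp only: Int_UN_distrib)
  then have "real (card (A t \<inter> ?U)) \<le> (\<Sum>s\<in>S. real (card (A t \<inter> A s)))" by (simp flip: of_nat_sum)
  also have "\<dots> \<le> (\<Sum>s\<in>S. \<beta>)" using insert by (intro sum_mono) auto
  finally have 1: "real (card (A t \<inter> ?U)) \<le> real (card S) * \<beta>" by simp
  have "card (A t) + card ?U = card (A t \<union> ?U) + card (A t \<inter> ?U)"
    using insert by (intro card_Un_Int) auto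
  then have 2: "real (card (A t)) + real (card ?U) = real (card (A t \<union> ?U)) + real (card (A t \<inter> ?U))" by linarith
  have "(real (card (insert t S)))\<^sup>2 * \<beta> = (real (card S))\<^sup>2 * \<beta> + 2 * (real (card S) * \<beta>) + \<beta>"
    using insert by (simp add: power2_eq_square algebra_simps)
  moreover have "0 \<le> real (card S) * \<beta>" using insert.prems by simp
  ultimately show ?case using IH 1 2 insert.hyps insert.prems(3) by simp
qed simp

text \<open>\<open>empty_in\<close> rules out the void complex, about which
  \<open>min_deg_cond\<close> says nothing; it holds as soon as J has a k-edge.\<close>

locale dense_complex =
  fixes k :: nat and \<zeta> :: real and V :: "'a set" and J :: "'a set set"
  assumes k2: "2 \<le> k" and \<zeta>: "0 < \<zeta>" and J: "k_complex k V J"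
    and min_deg: "min_deg_cond k J (card V) \<zeta>" and empty_in: "{} \<in> J" and neV: "0 < card V"
begin

abbreviation "H \<equiv> layer J k"

lemma finV: "finite V" using J by (simp add: k_complex_def)

lemma edge_H: "e \<in> H \<Longrightarrow> e \<subseteq> V" "e \<in> H \<Longrightarrow> card e = k" "e \<in> H \<Longrightarrow> finite e"
  using J finV by (auto simp: k_complex_def layer_def intro: finite_subset)

lemma extensions_ge:
  assumes "e \<in> J" "1 \<le> card e" "card e \<le> k - 1"
  shows "\<zeta> * real (card V) \<le> real (card {x\<in>V. x \<notin> e \<and> insert x e \<in> J})"
  using card_one_vertex_extensions[OF J assms(1)] min_deg assms by (auto simp: min_deg_cond_def layer_def)

lemma singleton_in: "v \<in> V \<Longrightarrow> {v} \<in> J"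
proof -
  assume v: "v \<in> V"
  have "card V \<le> card {x\<in>V. {x} \<in> J}"
    using card_one_vertex_extensions[OF J empty_in] min_deg empty_in by (auto simp: min_deg_cond_def layer_def)
  then have "{x\<in>V. {x} \<in> J} = V" using finV by (intro card_seteq) auto
  then show ?thesis using v by blast
qed

text \<open>Vertices are added one at a time. Every edge that gets extended has between 1 and k - 1
  vertices, where the degree condition offers \<zeta> n choices.\<close>

lemma dense_extensions:
  assumes "e \<in> J" "1 \<le> card e" "card e + j = k"
  shows "dense_tuples V j (\<zeta> ^ j) (\<lambda>xs. distinct xs \<and> set xs \<inter> e = {} \<and> e \<union> set xs \<in> H)"
  using assms
proof (induction j arbitrary: e)
  case 0
  then have "{xs. set xs \<subseteq> V \<and> length xs = 0 \<and> distinct xs \<and> set xs \<inter> e = {} \<and> e \<union> set xs \<in> H} = {[]}"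
    by (auto simp: layer_def)
  then show ?case unfolding dense_tuples_def by simp
next
  case (Suc j)
  have fe: "finite e" using Suc.prems J finV by (auto simp: k_complex_def intro: finite_subset)
  have "{x\<in>V. x \<notin> e \<and> insert x e \<in> J} \<subseteq> {x\<in>V. dense_tuples V j (\<zeta> ^ j)
      (\<lambda>xs. distinct (x # xs) \<and> set (x # xs) \<inter> e = {} \<and> e \<union> set (x # xs) \<in> H)}"
  proof safe
    fix x assume x: "x \<in> V" "x \<notin> e" "insert x e \<in> J"
    have "dense_tuples V j (\<zeta> ^ j) (\<lambda>xs. distinct xs \<and> set xs \<inter> insert x e = {} \<and> insert x e \<union> set xs \<in> H)"
      using Suc.IH[of "insert x e"] x fe Suc.prems by simp
    then show "dense_tuples V j (\<zeta> ^ j)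
      (\<lambda>xs. distinct (x # xs) \<and> set (x # xs) \<inter> e = {} \<and> e \<union> set (x # xs) \<in> H)"
      by (rule dense_tuples_mono) (use x finV in auto)
  qed
  then have "card {x\<in>V. x \<notin> e \<and> insert x e \<in> J} \<le> card {x\<in>V. dense_tuples V j (\<zeta> ^ j)
      (\<lambda>xs. distinct (x # xs) \<and> set (x # xs) \<inter> e = {} \<and> e \<union> set (x # xs) \<in> H)}"
    using finV by (intro card_mono) auto
  moreover have "\<zeta> * real (card V) \<le> real (card {x\<in>V. x \<notin> e \<and> insert x e \<in> J})"
    using Suc.prems by (intro extensions_ge) auto
  ultimately have "\<zeta> * real (card V) \<le> real (card {x\<in>V. dense_tuples V j (\<zeta> ^ j)
      (\<lambda>xs. distinct (x # xs) \<and> set (x # xs) \<inter> e = {} \<and> e \<union> set (x # xs) \<in> H)})"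
    by linarith
  from dense_tuples_Cons[OF this finV] show ?case using \<zeta> by simp
qed

definition link :: "'a \<Rightarrow> 'a list set" where
  "link v = {xs. set xs \<subseteq> V \<and> length xs = k - 1 \<and> distinct xs \<and> v \<notin> set xs \<and> insert v (set xs) \<in> H}"

lemma finite_link: "finite (link v)"
  unfolding link_def by (rule finite_tuples[OF finV])

lemma card_link_ge:
  assumes "v \<in> V"
  shows "\<zeta> ^ (k - 1) * real (card V) ^ (k - 1) \<le> real (card (link v))"
  using dense_extensions[OF singleton_in[OF assms], of "k - 1"] k2
  unfolding dense_tuples_def link_def by (simp add: conj_ac cong: conj_cong)

lemma dense_edges: "dense_tuples V k (\<zeta> ^ (k - 1)) (\<lambda>xs. distinct xs \<and> set xs \<in> H)"
proof -
  have "dense_tuples V (k - 1) (\<zeta> ^ (k - 1)) (\<lambda>xs. distinct (v # xs) \<and> set (v # xs) \<in> H)" if "v \<in> V" for v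
    using dense_extensions[OF singleton_in[OF that], of "k - 1"] k2
    by (auto intro: dense_tuples_mono simp: finV)
  then have "{v\<in>V. dense_tuples V (k - 1) (\<zeta> ^ (k - 1)) (\<lambda>xs. distinct (v # xs) \<and> set (v # xs) \<in> H)} = V" by auto
  then have "dense_tuples V (Suc (k - 1)) (1 * \<zeta> ^ (k - 1)) (\<lambda>xs. distinct xs \<and> set xs \<in> H)"
    using finV \<zeta> by (intro dense_tuples_Cons) auto
  then show ?thesis using k2 by simp
qed

lemma reachable_if_common_link:
  assumes "b * real (card V) ^ (k - 1) \<le> real (card (link u \<inter> link v))"
  shows "reachable V H (k - 1) b u v"
proof -
  have "card (link u \<inter> link v) \<le> card {xs. set xs \<subseteq> V \<and> length xs = k - 1 \<and> (distinct xs \<and> u \<notin> set xs \<and> v \<notin> set xs \<and>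
     matchable H (insert u (set xs)) \<and> matchable H (insert v (set xs)))}"
    by (intro card_mono finite_tuples finV) (auto simp: link_def intro: matchable_edge)
  then show ?thesis using assms unfolding reachable_def dense_tuples_def by linarith
qed

lemma reachable_refl: "v \<in> V \<Longrightarrow> b \<le> \<zeta> ^ (k - 1) \<Longrightarrow> reachable V H (k - 1) b v v"
  using card_link_ge[of v] mult_right_mono[of b "\<zeta> ^ (k - 1)" "real (card V) ^ (k - 1)"]
  by (intro reachable_if_common_link) simp

text \<open>Double counting of pairs of a list xs in the link of v and a vertex u that also
  completes xs to an edge. Every xs has \<zeta> n such u, by the degree of (k - 1)-edges. A vertex u
  that is not reachable from v shares fewer than b n^(k - 1) lists with v, at most a fraction b /
  \<zeta>^(k - 1) of the link.\<close>

lemma reachable_degree_ge: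
  assumes v: "v \<in> V" and b: "0 \<le> b"
  shows "(\<zeta> - b / \<zeta> ^ (k - 1)) * real (card V) \<le> real (card {u\<in>V. reachable V H (k - 1) b u v})"
proof -
  let ?n = "real (card V)" and ?z = "\<zeta> ^ (k - 1)"
  let ?N = "{u\<in>V. reachable V H (k - 1) b u v}"
  define l where "l = real (card (link v))"
  have z: "0 < ?z" using \<zeta> by simp
  have l: "?z * ?n ^ (k - 1) \<le> l" unfolding l_def by (rule card_link_ge[OF v])
  have l_pos: "0 < l" by (rule less_le_trans[OF _ l]) (use z neV in simp)
  have "\<zeta> * ?n * l = (\<Sum>xs\<in>link v. \<zeta> * ?n)" unfolding l_def by simp
  also have "\<dots> \<le> (\<Sum>xs\<in>link v. real (card {u\<in>V. xs \<in> link u}))"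
  proof (intro sum_mono)
    fix xs assume xs: "xs \<in> link v"
    have c: "card (set xs) = k - 1" using xs distinct_card unfolding link_def by force
    have "set xs \<in> J" using xs J unfolding link_def layer_def k_complex_def by blast
    then have "\<zeta> * ?n \<le> real (card {x\<in>V. x \<notin> set xs \<and> insert x (set xs) \<in> J})"
      using extensions_ge c k2 by simp
    also have "{x\<in>V. x \<notin> set xs \<and> insert x (set xs) \<in> J} = {u\<in>V. xs \<in> link u}"
      using xs c k2 unfolding link_def layer_def by auto
    finally show "\<zeta> * ?n \<le> real (card {u\<in>V. xs \<in> link u})" .
  qed
  also have "\<dots> = (\<Sum>xs\<in>link v. \<Sum>u\<in>V. of_bool (xs \<in> link u))"
    using finV by (simp add: Int_def)
  also have "\<dots> = (\<Sum>u\<in>V. \<Sum>xs\<in>link v. of_bool (xs \<in> link u))" by (rule sum.swap)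
  also have "\<dots> = (\<Sum>u\<in>V. real (card (link v \<inter> link u)))"
    using finite_link by (simp add: Int_def)
  also have "\<dots> \<le> (\<Sum>u\<in>V. of_bool (u \<in> ?N) * l + b / ?z * l)"
  proof (intro sum_mono)
    fix u assume u: "u \<in> V"
    have bl: "b * ?n ^ (k - 1) \<le> b / ?z * l"
    proof -
      have "b * ?n ^ (k - 1) = b / ?z * (?z * ?n ^ (k - 1))"
        using \<zeta> by simp
      also have "\<dots> \<le> b / ?z * l" using l b z by (intro mult_left_mono) auto
      finally show ?thesis .
    qed
    show "real (card (link v \<inter> link u)) \<le> of_bool (u \<in> ?N) * l + b / ?z * l"
    proof (cases "u \<in> ?N")
      case True
      have "card (link v \<inter> link u) \<le> card (link v)" using finite_link by (intro card_mono) auto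
      moreover have "0 \<le> b / ?z * l" using b z l_pos by simp
      ultimately show ?thesis using True unfolding l_def by simp
    next
      case False
      then have "\<not> b * ?n ^ (k - 1) \<le> real (card (link u \<inter> link v))"
        using reachable_if_common_link[of b u v] u by blast
      then have "real (card (link v \<inter> link u)) \<le> b / ?z * l" using bl by (simp only: Int_commute)
      moreover have "0 \<le> of_bool (u \<in> ?N) * l" using l_pos by (intro mult_nonneg_nonneg) auto
      ultimately show ?thesis by linarith
    qed
  qed
  also have "\<dots> = real (card ?N) * l + ?n * (b / ?z * l)"
    using finV by (simp add: sum.distrib sum_distrib_right[symmetric] Int_def del: sum_of_bool_eq)
      (simp add: Int_def finV)
  finally have "\<zeta> * ?n * l \<le> real (card ?N) * l + ?n * (b / ?z * l)" .
  then have "((\<zeta> - b / ?z) * ?n) * l \<le> real (card ?N) * l" by (simp add: algebra_simps)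
  then show ?thesis using l_pos by (rule mult_right_le_imp_le)
qed

text \<open>Every link fills a proportion \<zeta>^(k - 1) of all (k - 1)-lists, so c + 1 links with
  pairwise intersections below b n^(k - 1) do not fit.\<close>

lemma reachable_pair:
  assumes S: "S \<subseteq> V" "card S = Suc c" and b: "0 \<le> b"
    and c: "1 + (real (Suc c))\<^sup>2 * b < real (Suc c) * \<zeta> ^ (k - 1)"
  shows "\<exists>u\<in>S. \<exists>v\<in>S. u \<noteq> v \<and> reachable V H (k - 1) b u v"
proof (rule ccontr)
  assume no: "\<not> ?thesis"
  let ?p = "real (card V) ^ (k - 1)"
  have p: "0 < ?p" using neV by simp
  have finS: "finite S" using S finV finite_subset by blast
  have "real (Suc c) * \<zeta> ^ (k - 1) * ?p = (\<Sum>s\<in>S. \<zeta> ^ (k - 1) * ?p)" using S by simp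
  also have "\<dots> \<le> (\<Sum>s\<in>S. real (card (link s)))" using card_link_ge S by (intro sum_mono) auto
  also have "\<dots> \<le> real (card (\<Union>s\<in>S. link s)) + (real (card S))\<^sup>2 * (b * ?p)"
  proof (rule sum_card_le_card_Union[OF finS finite_link])
    fix s t assume "s \<in> S" "t \<in> S" "s \<noteq> t"
    then show "real (card (link s \<inter> link t)) \<le> b * ?p"
      using reachable_if_common_link[of b s t] no by force
  qed (use b in auto)
  also have "card (\<Union>s\<in>S. link s) \<le> card {xs. set xs \<subseteq> V \<and> length xs = k - 1}"
    by (intro card_mono finite_lists_length_eq finV) (auto simp: link_def)
  also have "\<dots> = card V ^ (k - 1)" by (rule card_lists_length_eq[OF finV])
  finally have "real (Suc c) * \<zeta> ^ (k - 1) * ?p \<le> (1 + (real (Suc c))\<^sup>2 * b) * ?p"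
    using S by (simp add: algebra_simps)
  then show False using c p by (simp add: mult_le_cancel_right)
qed

end

text \<open>The degree \<zeta> n loses \<mu> n in total, so the parts have exactly the size from
  which on the lattice hypothesis applies. The bound c on their number is fixed before V and J,
  which later bounds the lattice coefficients.\<close>

lemma reachable_partition:
  fixes \<zeta> \<mu> :: real
  assumes k: "2 \<le> k" and \<mu>: "0 < \<mu>" "\<mu> < \<zeta>" "\<zeta> \<le> 1"
  shows "\<exists>c m b n0. 0 < b \<and> (\<forall>(V::'a set) J. dense_complex k \<zeta> V J \<longrightarrow> n0 \<le> card V \<longrightarrow>
    (\<exists>P. partition_on V P \<and> card P \<le> c \<and> (\<forall>X\<in>P. (\<zeta> - \<mu>) * real (card V) \<le> real (card X) \<and>
      (\<forall>u\<in>X. \<forall>v\<in>X. reachable V (layer J k) m b u v))))"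
proof -
  define z where "z = \<zeta> ^ (k - 1)"
  \<comment> \<open>c z \<ge> 2 is enough for \<open>reachable_pair\<close>: c + 1 links of density
    z have total density above 2, which leaves room for the pairwise intersections.\<close>
  define c where "c = nat \<lceil>2 / z\<rceil>"
  \<comment> \<open>\<mu> / (2 c^2) limits the cost of the overlaps to \<mu> / 2 of the degree;
    (\<zeta> - \<mu>) / c is for the pigeonhole over the cores.\<close>
  define \<eta> where "\<eta> = min 1 (min (\<mu> / (2 * (real c)\<^sup>2)) ((\<zeta> - \<mu>) / real c))"
  \<comment> \<open>The recursions for m and b are those of \<open>reachable_trans_robust\<close>.
    The start b 0 costs the other \<mu> / 2 of the degree and keeps (c + 1)^2 b 0 at most 1.\<close>
  define m where "m i = rec_nat (k - 1) (\<lambda>_ x. 2 * x + 1) i" for i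
  define b where "b i = rec_nat (min (\<mu> * z / 2) (1 / (real (Suc c))\<^sup>2)) (\<lambda>_ x. \<eta> * x\<^sup>2 / 2) i" for i
  have m: "m 0 = k - 1" "m (Suc i) = 2 * m i + 1" for i unfolding m_def by simp_all
  have b: "b 0 = min (\<mu> * z / 2) (1 / (real (Suc c))\<^sup>2)" "b (Suc i) = \<eta> * (b i)\<^sup>2 / 2" for i unfolding b_def by simp_all
  have \<zeta>0: "0 < \<zeta>" using \<mu> by simp
  have z: "0 < z" "z \<le> 1" unfolding z_def using \<mu> \<zeta>0 by (auto simp: power_le_one)
  have cz: "2 \<le> real c * z" 
  proof -
    have "2 / z \<le> real c" unfolding c_def by linarith
    then show ?thesis using z by (simp add: field_simps)
  qed
  have c0: "0 < real c" using cz z by (cases "c = 0") auto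
  have \<eta>: "0 < \<eta>" "\<eta> \<le> 1" unfolding \<eta>_def using c0 \<mu> by auto
  have \<eta>1: "(real c)\<^sup>2 * \<eta> \<le> \<mu> / 2"
  proof -
    have "\<eta> \<le> \<mu> / (2 * (real c)\<^sup>2)" unfolding \<eta>_def by auto
    then show ?thesis using c0 by (simp add: field_simps)
  qed
  have \<eta>2: "real c * \<eta> \<le> \<zeta> - \<mu>"
  proof -
    have "\<eta> \<le> (\<zeta> - \<mu>) / real c" unfolding \<eta>_def by auto
    then show ?thesis using c0 by (simp add: field_simps)
  qed
  have b0: "0 < b i" for i
  proof (induction i)
    case 0
    show ?case unfolding b using \<mu> z by simp
  next
    case (Suc i)
    then show ?case unfolding b using \<eta> by simp
  qed
  define n0 where "n0 = nat \<lceil>\<Sum>i\<le>c. 2 * real ((2 * m i + 1) * (2 + (2 * m i + 1))) / (\<eta> * (b i)\<^sup>2)\<rceil>"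
  show ?thesis
  proof (rule exI[of _ c], rule exI[of _ "m (Suc c)"], rule exI[of _ "b (Suc c)"], rule exI[of _ n0],
      intro conjI allI impI b0)
    fix V :: "'a set" and J
    assume D: "dense_complex k \<zeta> V J" and n0: "n0 \<le> card V"
    interpret dense_complex k \<zeta> V J by fact
    define n where "n = real (card V)"
    have n_ge: "2 * real ((2 * m i + 1) * (2 + (2 * m i + 1))) \<le> \<eta> * (b i)\<^sup>2 * real (card V)" if "i \<le> c" for i
    proof -
      have "2 * real ((2 * m i + 1) * (2 + (2 * m i + 1))) / (\<eta> * (b i)\<^sup>2)
        \<le> (\<Sum>i\<le>c. 2 * real ((2 * m i + 1) * (2 + (2 * m i + 1))) / (\<eta> * (b i)\<^sup>2))"
        using that \<eta> by (intro member_le_sum) auto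
      also have "\<dots> \<le> real (card V)" using n0 unfolding n0_def by linarith
      finally show ?thesis using \<eta> b0[of i] by (simp add: field_simps)
    qed
    let ?R = "\<lambda>i. reachable V (layer J k) (m i) (b i)"
    have refl: "?R i v v" if "i \<le> Suc c" "v \<in> V" for i v
      using that
    proof (induction i arbitrary: v)
      case 0
      have "b 0 \<le> \<mu> * z / 2" using b by simp
      also have "\<dots> \<le> 1 * z / 2" using \<mu> z by (intro divide_right_mono mult_right_mono) auto
      also have "\<dots> \<le> z" using z by simp
      finally show ?case using reachable_refl[of v "b 0"] 0 m unfolding z_def by simp
    next
      case (Suc i)
      then show ?case unfolding m b
        by (intro reachable_extend finV b0 \<eta> neV n_ge) auto
    qed
    have "\<exists>P. partition_on V P \<and> card P \<le> c \<and>
      (\<forall>X\<in>P. (\<zeta> - \<mu>) * n \<le> real (card X) \<and> (\<forall>u\<in>X. \<forall>v\<in>X. ?R (Suc c) u v))"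
    proof (rule closed_partition[where \<eta> = \<eta> and R = ?R])
      show "V \<noteq> {}" "0 < n" using neV unfolding n_def by auto
      show "?R i v u" if "?R i u v" for i u v using that by (rule reachable_sym)
      show "?R (Suc i) u v" if "i \<le> c" "?R i u v" for i u v
        unfolding m b using that by (intro reachable_extend finV b0 \<eta> neV n_ge refl) auto
      show "?R (Suc i) u v" if "i \<le> c" "\<eta> * n \<le> real (card {w\<in>V. ?R i u w \<and> ?R i w v})" for i u v
        unfolding m b using that unfolding n_def by (intro reachable_trans_robust finV b0 \<eta> neV n_ge) auto
      show "(\<zeta> - \<mu> + (real c)\<^sup>2 * \<eta>) * n \<le> real (card {u\<in>V. ?R 0 u v})" if v: "v \<in> V" for v
      proof -
        have "b 0 \<le> \<mu> * z / 2" unfolding b by simp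
        then have "b 0 / z \<le> \<mu> / 2" using z by (simp add: field_simps)
        then have "\<zeta> - \<mu> + (real c)\<^sup>2 * \<eta> \<le> \<zeta> - b 0 / \<zeta> ^ (k - 1)" using \<eta>1 unfolding z_def by linarith
        then have "(\<zeta> - \<mu> + (real c)\<^sup>2 * \<eta>) * n \<le> (\<zeta> - b 0 / \<zeta> ^ (k - 1)) * n"
          unfolding n_def by (intro mult_right_mono) auto
        then show ?thesis using reachable_degree_ge[OF v less_imp_le[OF b0[of 0]]] unfolding m n_def by linarith
      qed
      show "\<exists>u\<in>S. \<exists>v\<in>S. u \<noteq> v \<and> ?R 0 u v" if "S \<subseteq> V" "card S = Suc c" for S
        unfolding m
      proof (rule reachable_pair[OF that less_imp_le[OF b0]])
        have "b 0 \<le> 1 / (real (Suc c))\<^sup>2" unfolding b by simp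
        then have "(real (Suc c))\<^sup>2 * b 0 \<le> 1" by (simp add: field_simps)
        then show "1 + (real (Suc c))\<^sup>2 * b 0 < real (Suc c) * \<zeta> ^ (k - 1)"
          using cz z unfolding z_def[symmetric] by (simp add: algebra_simps)
      qed
    qed (use refl[of 0] \<mu> \<eta> \<eta>2 finV in auto)
    then show "\<exists>P. partition_on V P \<and> card P \<le> c \<and> (\<forall>X\<in>P. (\<zeta> - \<mu>) * real (card V) \<le> real (card X) \<and>
      (\<forall>u\<in>X. \<forall>v\<in>X. reachable V (layer J k) (m (Suc c)) (b (Suc c)) u v))"
      unfolding n_def .
  qed
qed

section \<open>Exchanges from the edge lattice\<close>

text \<open>Coordinates are numbered instead of being indexed by parts, so that for given r and k
  there is one finite set of vectors, whatever V and its partition are.\<close>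

definition bounded_vectors :: "nat \<Rightarrow> nat \<Rightarrow> (nat \<Rightarrow> int) set" where
  "bounded_vectors r k = {f. \<forall>i. (i \<in> {..<r} \<longrightarrow> f i \<in> {0..int k}) \<and> (i \<notin> {..<r} \<longrightarrow> f i = 0)}"

lemma finite_bounded_vectors: "finite (bounded_vectors r k)"
  unfolding bounded_vectors_def by (rule finite_set_of_finite_funs) auto

text \<open>Only finitely many configurations exist for given \<open>r\<close> and \<open>k\<close>, so the coefficients are
  bounded in terms of \<open>r\<close> and \<open>k\<close> alone.\<close>
lemma bounded_integer_combination:
  "\<exists>C\<ge>0. \<forall>B\<subseteq>bounded_vectors r k. \<forall>t\<in>bounded_vectors r k.
     (\<exists>c. \<forall>i. t i = (\<Sum>w\<in>B. c w * w i)) \<longrightarrow>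
     (\<exists>c. (\<forall>w\<in>B. \<bar>c w\<bar> \<le> (C::int)) \<and> (\<forall>i. t i = (\<Sum>w\<in>B. c w * w i)))"
proof -
  let ?K = "bounded_vectors r k"
  let ?Z = "Pow ?K \<times> ?K"
  let ?ok = "\<lambda>(B, t) c. \<forall>i. t i = (\<Sum>w\<in>B. c w * w i)"
  define coef where "coef z = (SOME c. ?ok z c)" for z :: "(nat \<Rightarrow> int) set \<times> (nat \<Rightarrow> int)"
  define C where "C = (\<Sum>z\<in>?Z. \<Sum>w\<in>?K. \<bar>coef z w\<bar>)"
  have finK: "finite ?K" by (rule finite_bounded_vectors)
  have bound: "\<bar>coef z w\<bar> \<le> C" if "z \<in> ?Z" "w \<in> ?K" for z w
  proof -
    have "\<bar>coef z w\<bar> \<le> (\<Sum>w\<in>?K. \<bar>coef z w\<bar>)"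
      using finK that by (intro member_le_sum) auto
    also have "\<dots> \<le> C" unfolding C_def
      using finK that by (intro member_le_sum[where f = "\<lambda>z. \<Sum>w\<in>?K. \<bar>coef z w\<bar>"] sum_nonneg) auto
    finally show ?thesis .
  qed
  show ?thesis
  proof (intro exI[of _ C] conjI allI ballI impI)
    show "0 \<le> C" unfolding C_def by (intro sum_nonneg) auto
    fix B t assume B: "B \<subseteq> ?K" and t: "t \<in> ?K" and "\<exists>c. \<forall>i. t i = (\<Sum>w\<in>B. c w * w i)"
    then have "\<exists>c. ?ok (B, t) c" by auto
    then have "?ok (B, t) (coef (B, t))" unfolding coef_def by (rule someI_ex)
    then show "\<exists>c. (\<forall>w\<in>B. \<bar>c w\<bar> \<le> C) \<and> (\<forall>i. t i = (\<Sum>w\<in>B. c w * w i))"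
      using bound[of "(B, t)"] B t by (intro exI[of _ "coef (B, t)"]) auto
  qed
qed

definition reindex :: "(nat \<Rightarrow> 'a set) \<Rightarrow> nat \<Rightarrow> ('a set \<Rightarrow> int) \<Rightarrow> nat \<Rightarrow> int" where
  "reindex h r v i = (if i < r then v (h i) else 0)"

lemma k_vector_le: "k_vector P k v \<Longrightarrow> finite P \<Longrightarrow> X \<in> P \<Longrightarrow> v X \<le> int k"
  using member_le_sum[of X P v] by (auto simp: k_vector_def)

lemma reindex_k_vector:
  assumes "bij_betw h {..<r} P" "finite P"
  shows "k_vector P k v \<Longrightarrow> reindex h r v \<in> bounded_vectors r k"
    and "inj_on (reindex h r) {v. k_vector P k v}"
proof -
  have hP: "h i \<in> P" if "i < r" for i using assms(1) that by (auto simp: bij_betw_def)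
  show "reindex h r v \<in> bounded_vectors r k" if "k_vector P k v"
    using that hP k_vector_le[OF that assms(2)] by (auto simp: bounded_vectors_def reindex_def k_vector_def)
  show "inj_on (reindex h r) {v. k_vector P k v}"
  proof (rule inj_onI, rule ext)
    fix v v' X assume v: "v \<in> {v. k_vector P k v}" "v' \<in> {v. k_vector P k v}" and eq: "reindex h r v = reindex h r v'"
    show "v X = v' X"
    proof (cases "X \<in> P")
      case True
      then obtain i where "i < r" "X = h i" using assms(1) by (auto simp: bij_betw_def)
      then show ?thesis using fun_cong[OF eq, of i] by (simp add: reindex_def)
    qed (use v in \<open>auto simp: k_vector_def\<close>)
  qed
qed

text \<open>Numbering the parts carries the uniform bound over to the lattice of any partition.
  Summing the bounds over all numbers of parts up to r makes C and D depend on r and k only.\<close>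

lemma bounded_lattice_combination:
  "\<exists>C\<ge>0. \<exists>D. \<forall>(P::'a set set) B. finite P \<longrightarrow> card P \<le> r \<longrightarrow> (\<forall>w\<in>B. k_vector P k w) \<longrightarrow>
     finite B \<and> card B \<le> D \<and>
     (\<forall>v. k_vector P k v \<longrightarrow> v \<in> lattice_gen B \<longrightarrow>
       (\<exists>c. (\<forall>w\<in>B. \<bar>c w\<bar> \<le> (C::int)) \<and> (\<forall>X\<in>P. v X = (\<Sum>w\<in>B. c w * w X))))"
proof -
  define good where "good r C \<longleftrightarrow> (\<forall>B\<subseteq>bounded_vectors r k. \<forall>t\<in>bounded_vectors r k.
     (\<exists>c. \<forall>i. t i = (\<Sum>w\<in>B. c w * w i)) \<longrightarrow>
     (\<exists>c. (\<forall>w\<in>B. \<bar>c w\<bar> \<le> (C::int)) \<and> (\<forall>i. t i = (\<Sum>w\<in>B. c w * w i))))" for r C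
  have "\<forall>r. \<exists>C. 0 \<le> C \<and> good r C"
    unfolding good_def by (intro allI bounded_integer_combination)
  then obtain C where C0: "\<And>r. 0 \<le> C r" and good: "\<And>r. good r (C r)" by metis
  have C: "\<exists>c. (\<forall>w\<in>B. \<bar>c w\<bar> \<le> C r) \<and> (\<forall>i. t i = (\<Sum>w\<in>B. c w * w i))"
    if "B \<subseteq> bounded_vectors r k" "t \<in> bounded_vectors r k" "\<exists>c. \<forall>i. t i = (\<Sum>w\<in>B. c w * w i)" for r B t
    using good[of r, unfolded good_def, rule_format, OF that] .
  define C' where "C' = (\<Sum>i\<le>r. C i)"
  define D where "D = (\<Sum>i\<le>r. card (bounded_vectors i k))"
  have C'0: "0 \<le> C'" unfolding C'_def using C0 by (intro sum_nonneg) auto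
  show ?thesis
  proof (rule exI[of _ C'], intro conjI C'0, rule exI[of _ D], intro allI impI)
    fix P :: "'a set set" and B
    assume P: "finite P" "card P \<le> r" and B: "\<forall>w\<in>B. k_vector P k w"
    define s where "s = card P"
    have s: "s \<le> r" using P unfolding s_def by simp
    have Cs: "C s \<le> C'" unfolding C'_def using s C0 by (intro member_le_sum) auto
    have Ds: "card (bounded_vectors s k) \<le> D" unfolding D_def using s by (intro member_le_sum) auto
    obtain h where h: "bij_betw h {..<s} P"
      using ex_bij_betw_nat_finite[OF P(1)] unfolding s_def atLeast0LessThan by blast
    let ?\<phi> = "reindex h s"
    have inj: "inj_on ?\<phi> B" using reindex_k_vector(2)[OF h P(1), of k] B by (auto intro: inj_on_subset)
    have sub: "?\<phi> ` B \<subseteq> bounded_vectors s k" using reindex_k_vector(1)[OF h P(1)] B by auto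
    have finB: "finite B"
      using finite_imageD[OF finite_subset[OF sub finite_bounded_vectors] inj] .
    have "card B \<le> card (bounded_vectors s k)"
      using card_image[OF inj] card_mono[OF finite_bounded_vectors sub] by simp
    then have cB: "card B \<le> D" using Ds by simp
    have "\<exists>c. (\<forall>w\<in>B. \<bar>c w\<bar> \<le> C') \<and> (\<forall>X\<in>P. v X = (\<Sum>w\<in>B. c w * w X))"
      if v: "k_vector P k v" "v \<in> lattice_gen B" for v
    proof -
      obtain F c where F: "finite F" "F \<subseteq> B" "v = (\<lambda>X. \<Sum>w\<in>F. c w * w X)"
        using v(2) unfolding lattice_gen_def by blast
      define c0 where "c0 w = (if w \<in> F then c w else 0)" for w
      have vB: "v X = (\<Sum>w\<in>B. c0 w * w X)" for X
        unfolding F(3) c0_def using F(2) finB by (intro sum.mono_neutral_cong_left) auto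
      have re: "(\<Sum>w\<in>?\<phi> ` B. d w * w i) = (\<Sum>w\<in>B. d (?\<phi> w) * ?\<phi> w i)" for d i
        by (simp add: sum.reindex[OF inj])
      have "\<forall>i. ?\<phi> v i = (\<Sum>w\<in>?\<phi> ` B. c0 (inv_into B ?\<phi> w) * w i)"
        unfolding re using inj vB by (simp add: reindex_def)
      then have "\<exists>d. \<forall>i. ?\<phi> v i = (\<Sum>w\<in>?\<phi> ` B. d w * w i)"
        by (rule exI[of _ "\<lambda>w. c0 (inv_into B ?\<phi> w)"])
      from C[OF sub reindex_k_vector(1)[OF h P(1) v(1)] this]
      obtain d where d: "\<forall>w\<in>?\<phi> ` B. \<bar>d w\<bar> \<le> C s" "\<forall>i. ?\<phi> v i = (\<Sum>w\<in>?\<phi> ` B. d w * w i)" by blast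
      have "v X = (\<Sum>w\<in>B. d (?\<phi> w) * w X)" if "X \<in> P" for X
      proof -
        obtain i where i: "i < s" "X = h i" using h \<open>X \<in> P\<close> by (auto simp: bij_betw_def)
        then show ?thesis using d(2)[rule_format, of i] unfolding re by (simp add: reindex_def)
      qed
      then show ?thesis using d(1) Cs by (intro exI[of _ "\<lambda>w. d (?\<phi> w)"]) force
    qed
    then show "finite B \<and> card B \<le> D \<and>
     (\<forall>v. k_vector P k v \<longrightarrow> v \<in> lattice_gen B \<longrightarrow>
       (\<exists>c. (\<forall>w\<in>B. \<bar>c w\<bar> \<le> C') \<and> (\<forall>X\<in>P. v X = (\<Sum>w\<in>B. c w * w X))))"
      using finB cB by blast
  qed
qed

lemma sum_list_replicate_concat:
  fixes f :: "'w \<Rightarrow> nat" and g :: "'w \<Rightarrow> int"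
  shows "distinct bs \<Longrightarrow> sum_list (map g (concat (map (\<lambda>w. replicate (f w) w) bs))) = (\<Sum>w\<in>set bs. int (f w) * g w)"
  by (induction bs) (auto simp: sum_list_replicate)

text \<open>The difference of the unit vectors at X and Y is the difference of two k-vectors: k at
  X, and k - 1 at X plus 1 at Y. Both have bounded coefficients over B. The common length of the
  lists does not depend on X, Y or B, because reachability needs one list length for all
  pairs.\<close>

lemma exchange_lists:
  fixes P :: "'a set set" and C :: int
  assumes P: "finite P" "X \<in> P" "Y \<in> P" and k: "0 < k"
    and B: "finite B" "card B \<le> D" "\<forall>w\<in>B. k_vector P k w" and C: "0 \<le> C"
    and gen: "\<And>v. k_vector P k v \<Longrightarrow> \<exists>c. (\<forall>w\<in>B. \<bar>c w\<bar> \<le> C) \<and> (\<forall>X\<in>P. v X = (\<Sum>w\<in>B. c w * w X))"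
  shows "\<exists>ps ns. set ps \<subseteq> B \<and> set ns \<subseteq> B \<and> length ps = nat (2 * C) * D \<and> length ns = nat (2 * C) * D \<and>
    (\<forall>Z\<in>P. (\<Sum>w\<leftarrow>ps. w Z) - (\<Sum>w\<leftarrow>ns. w Z) = of_bool (Z = X) - of_bool (Z = Y))"
proof -
  let ?v1 = "\<lambda>Z. if Z = X then int k else 0"
  let ?v2 = "\<lambda>Z. (if Z = X then int k - 1 else 0) + (if Z = Y then 1 else 0)"
  have k1: "k_vector P k ?v1" using P unfolding k_vector_def by (auto simp: sum.delta)
  have k2: "k_vector P k ?v2" using P k unfolding k_vector_def by (auto simp: sum.distrib sum.delta)
  obtain c1 where c1: "\<forall>w\<in>B. \<bar>c1 w\<bar> \<le> C" "\<forall>Z\<in>P. ?v1 Z = (\<Sum>w\<in>B. c1 w * w Z)" using gen[OF k1] by blast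
  obtain c2 where c2: "\<forall>w\<in>B. \<bar>c2 w\<bar> \<le> C" "\<forall>Z\<in>P. ?v2 Z = (\<Sum>w\<in>B. c2 w * w Z)" using gen[OF k2] by blast
  have "B \<noteq> {}" using c1(2)[rule_format, OF P(2)] k by auto
  then obtain w0 where w0: "w0 \<in> B" by blast
  \<comment> \<open>\<open>ns\<close> repeats each generator 2 C times and \<open>ps\<close> repeats
    w another c1 w - c2 w times, a number of absolute value at most 2 C, so both multiplicities are
    nonnegative. Extra copies of w0 on both sides fill up to the length for D generators.\<close>
  define pad where "pad = nat (2 * C) * (D - card B)"
  define g where "g w = nat (2 * C) + (if w = w0 then pad else 0)" for w
  define f where "f w = nat (2 * C + c1 w - c2 w) + (if w = w0 then pad else 0)" for w
  have fg: "int (f w) - int (g w) = c1 w - c2 w" if "w \<in> B" for w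
  proof -
    have "0 \<le> 2 * C + c1 w - c2 w" using c1(1) c2(1) that by fastforce
    then show ?thesis unfolding f_def g_def using C by simp
  qed
  obtain bs where bs: "set bs = B" "distinct bs" using finite_distinct_list[OF B(1)] by blast
  define ps where "ps = concat (map (\<lambda>w. replicate (f w) w) bs)"
  define ns where "ns = concat (map (\<lambda>w. replicate (g w) w) bs)"
  have sub: "set ps \<subseteq> B" "set ns \<subseteq> B" unfolding ps_def ns_def using bs by auto
  have diff: "(\<Sum>w\<leftarrow>ps. w Z) - (\<Sum>w\<leftarrow>ns. w Z) = of_bool (Z = X) - of_bool (Z = Y)" if Z: "Z \<in> P" for Z
  proof -
    have "(\<Sum>w\<leftarrow>ps. w Z) - (\<Sum>w\<leftarrow>ns. w Z) = (\<Sum>w\<in>B. (int (f w) - int (g w)) * w Z)"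
      unfolding ps_def ns_def using sum_list_replicate_concat[OF bs(2), of "\<lambda>w. w Z"] bs(1)
      by (simp add: sum_subtractf left_diff_distrib)
    also have "\<dots> = (\<Sum>w\<in>B. (c1 w - c2 w) * w Z)" using fg by (intro sum.cong) auto
    also have "\<dots> = ?v1 Z - ?v2 Z" using c1(2) c2(2) Z by (simp only: sum_subtractf left_diff_distrib) 
    finally show ?thesis by (auto simp: of_bool_def)
  qed
  \<comment> \<open>Every generator has coordinate sum k and the two lists differ by a vector of sum
    0, which forces equal lengths.\<close>
  have total: "(\<Sum>Z\<in>P. \<Sum>w\<leftarrow>qs. w Z) = int k * int (length qs)" if "set qs \<subseteq> B" for qs
    using that
  proof (induction qs)
    case (Cons q qs)
    have "(\<Sum>Z\<in>P. q Z) = int k" using Cons.prems B(3) by (auto simp: k_vector_def)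
    then show ?case using Cons by (simp add: sum.distrib algebra_simps)
  qed simp
  have "(\<Sum>Z\<in>P. (\<Sum>w\<leftarrow>ps. w Z) - (\<Sum>w\<leftarrow>ns. w Z)) = (\<Sum>Z\<in>P. of_bool (Z = X) - of_bool (Z = Y))"
    using diff by (intro sum.cong) auto
  also have "\<dots> = 0" using P by (simp add: sum_subtractf)
  finally have "int k * int (length ps) = int k * int (length ns)"
    using total[OF sub(1)] total[OF sub(2)] by (simp add: sum_subtractf)
  then have len: "length ps = length ns" using k by simp
  have "length ns = (\<Sum>w\<in>B. g w)"
    unfolding ns_def using bs by (simp add: length_concat comp_def sum_list_distinct_conv_sum_set)
  also have "\<dots> = card B * nat (2 * C) + pad"
    unfolding g_def using B(1) w0 by (simp add: sum.distrib)
  also have "\<dots> = nat (2 * C) * D" unfolding pad_def using B(2)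
    by (metis add.commute le_add_diff_inverse mult.commute distrib_left)
  finally show ?thesis using sub diff len by (intro exI[of _ ps] exI[of _ ns]) auto
qed

text \<open>Greedy pairing: the head x takes any entry of ys from its own part, and the counts of
  the remaining entries still agree. Entries may repeat, hence multisets.\<close>

lemma rearrange_to_same_parts:
  assumes P: "partition_on V P" and sets: "set xs \<subseteq> V" "set ys \<subseteq> V"
    and counts: "\<And>Z. Z \<in> P \<Longrightarrow> length (filter (\<lambda>x. x \<in> Z) xs) = length (filter (\<lambda>x. x \<in> Z) ys)"
  shows "\<exists>ys'. mset ys' = mset ys \<and> list_all2 (\<lambda>x y. \<exists>Z\<in>P. x \<in> Z \<and> y \<in> Z) xs ys'"
  using sets counts
proof (induction xs arbitrary: ys)
  case Nil
  have "ys = []"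
  proof (cases ys)
    case (Cons y ys')
    then obtain Z where "Z \<in> P" "y \<in> Z" using Nil(2) P by (auto simp: partition_on_def)
    then show ?thesis using Nil(3)[of Z] Cons by simp
  qed
  then show ?case by simp
next
  case (Cons x xs)
  obtain Z where Z: "Z \<in> P" "x \<in> Z" using Cons.prems(1) P by (auto simp: partition_on_def)
  have "0 < length (filter (\<lambda>x. x \<in> Z) ys)"
    unfolding Cons.prems(3)[OF Z(1), symmetric] using Z(2) by simp
  then obtain y where y: "y \<in> set ys" "y \<in> Z" by (force simp: length_greater_0_conv filter_empty_conv)
  then obtain l1 l2 where ys: "ys = l1 @ y # l2" by (meson split_list)
  have same: "x \<in> Z' \<longleftrightarrow> y \<in> Z'" if "Z' \<in> P" for Z'
    using P Z y that unfolding partition_on_def pairwise_def disjnt_def by blast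
  have "length (filter (\<lambda>x. x \<in> Z') xs) = length (filter (\<lambda>x. x \<in> Z') (l1 @ l2))" if "Z' \<in> P" for Z'
    using Cons.prems(3)[OF that] same[OF that] unfolding ys by (auto split: if_splits)
  then obtain ys' where "mset ys' = mset (l1 @ l2)" "list_all2 (\<lambda>x y. \<exists>Z\<in>P. x \<in> Z \<and> y \<in> Z) xs ys'"
    using Cons.IH[of "l1 @ l2"] Cons.prems(1,2) unfolding ys by auto
  then show ?case using Z y unfolding ys by (intro exI[of _ "y # ys'"]) auto
qed

lemma dense_tuples_index:
  assumes fin: "finite V" and H: "\<And>e. e \<in> H \<Longrightarrow> e \<subseteq> V \<and> card e = k" and \<mu>: "0 \<le> \<mu>"
    and ws: "\<And>w. w \<in> set ws \<Longrightarrow> robust_edge_vector V P k \<mu> H w"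
  shows "dense_tuples V (length ws * k) (\<mu> ^ length ws) (\<lambda>as. (distinct as \<longrightarrow> matchable H (set as)) \<and>
    (\<forall>Z\<in>P. int (length (filter (\<lambda>x. x \<in> Z) as)) = (\<Sum>w\<leftarrow>ws. w Z)))"
  using ws
proof (induction ws)
  case Nil
  have "{xs. set xs \<subseteq> V \<and> length xs = 0 \<and> (distinct xs \<longrightarrow> matchable H (set xs)) \<and>
     (\<forall>Z\<in>P. int (length (filter (\<lambda>x. x \<in> Z) xs)) = 0)} = {[]}" by (auto simp: matchable_empty)
  then show ?case unfolding dense_tuples_def by simp
next
  case (Cons w ws)
  let ?R = "\<lambda>ws as. (distinct as \<longrightarrow> matchable H (set as)) \<and>
    (\<forall>Z\<in>P. int (length (filter (\<lambda>x. x \<in> Z) as)) = (\<Sum>w\<leftarrow>ws. w Z))"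
  let ?E = "{e\<in>H. index_vec P e = w}"
  let ?S = "\<lambda>xs. distinct xs \<and> set xs \<in> H \<and> index_vec P (set xs) = w"
  have sE: "dense_tuples V k \<mu> ?S"
  proof -
    have "\<exists>xs. set xs = e \<and> distinct xs" if "e \<in> H" for e
      using H[OF that] fin finite_subset finite_distinct_list by metis
    \<comment> \<open>One ordering per edge suffices: the robust bound counts edges, and \<mu> n^k
      lists are already density \<mu>.\<close>
    then obtain l where l: "\<And>e. e \<in> H \<Longrightarrow> set (l e) = e \<and> distinct (l e)" by metis
    have "inj_on l ?E" using l by (intro inj_on_inverseI[where g = set]) auto
    then have "card ?E = card (l ` ?E)" by (simp add: card_image)
    also have "\<dots> \<le> card {xs. set xs \<subseteq> V \<and> length xs = k \<and> ?S xs}"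
      using l H distinct_card by (intro card_mono finite_tuples fin) force
    finally show ?thesis using Cons.prems[of w] unfolding dense_tuples_def robust_edge_vector_def by auto
  qed
  have "dense_tuples V (k + length ws * k) (\<mu> * \<mu> ^ length ws) (?R (w # ws))"
  proof (rule dense_tuples_append[OF _ fin])
    show "dense_tuples V k \<mu> (\<lambda>xs. dense_tuples V (length ws * k) (\<mu> ^ length ws) (\<lambda>as. ?R (w # ws) (xs @ as)))"
    proof (rule dense_tuples_mono[OF sE fin order_refl])
      fix xs assume xs: "?S xs"
      have cnt: "int (length (filter (\<lambda>x. x \<in> Z) xs)) = w Z" if "Z \<in> P" for Z
      proof -
        have "length (filter (\<lambda>x. x \<in> Z) xs) = card (set xs \<inter> Z)"
          using xs by (metis distinct_card distinct_filter set_filter Int_def mem_Collect_eq)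
        then show ?thesis using xs that unfolding index_vec_def by auto
      qed
      have IH: "dense_tuples V (length ws * k) (\<mu> ^ length ws) (?R ws)" using Cons by auto
      show "dense_tuples V (length ws * k) (\<mu> ^ length ws) (\<lambda>as. ?R (w # ws) (xs @ as))"
      proof (rule dense_tuples_mono[OF IH fin order_refl], intro conjI impI ballI)
        fix as assume as: "?R ws as"
        { assume "distinct (xs @ as)"
          then have d: "distinct as" "set xs \<inter> set as = {}" by auto
          have "matchable H (set xs)" using xs by (auto intro: matchable_edge)
          from matchable_Un[OF this _ d(2)] show "matchable H (set (xs @ as))" using as d(1) by simp }
        fix Z assume "Z \<in> P"
        then show "int (length (filter (\<lambda>x. x \<in> Z) (xs @ as))) = (\<Sum>w\<leftarrow>w # ws. w Z)"
          using as cnt by simp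
      qed
    qed
  qed (use \<mu> in auto)
  then show ?case by simp
qed

text \<open>The list is \<open>as @ bs @ zs\<close>, where \<open>as\<close> consists of edges with
  vectors ps and \<open>bs\<close> of edges with vectors ns. Since v, as and u, bs have equally many
  entries in each part, they can be paired inside the parts, and zs connects the pairs. With u, as
  is matched by its edges and u, bs, zs by the connections; with v, the roles of as and bs are
  exchanged.\<close>

lemma reachable_by_exchange:
  assumes fin: "finite V" and ne: "0 < card V" and P: "partition_on V P" and XY: "X \<in> P" "Y \<in> P" "u \<in> X" "v \<in> Y"
    and H: "\<And>e. e \<in> H \<Longrightarrow> e \<subseteq> V \<and> card e = k" and \<mu>: "0 < \<mu>" and b: "0 < b"
    and ps: "\<And>w. w \<in> set ps \<Longrightarrow> robust_edge_vector V P k \<mu> H w" "length ps = A"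
    and ns: "\<And>w. w \<in> set ns \<Longrightarrow> robust_edge_vector V P k \<mu> H w" "length ns = A"
    and diff: "\<And>Z. Z \<in> P \<Longrightarrow> (\<Sum>w\<leftarrow>ps. w Z) - (\<Sum>w\<leftarrow>ns. w Z) = (of_bool (Z = X) - of_bool (Z = Y) :: int)"
    and reach: "\<And>Z u v. Z \<in> P \<Longrightarrow> u \<in> Z \<Longrightarrow> v \<in> Z \<Longrightarrow> reachable V H m b u v"
    and l: "l = A * k + (A * k + (A * k + 1) * m)" and b': "b' = \<mu> ^ A * (\<mu> ^ A * b ^ (A * k + 1))"
    and n: "2 * real (l * (2 + l)) \<le> b' * real (card V)"
  shows "reachable V H l (b' / 2) u v"
proof -
  let ?R = "\<lambda>ws as. (distinct as \<longrightarrow> matchable H (set as)) \<and>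
    (\<forall>Z\<in>P. int (length (filter (\<lambda>x. x \<in> Z) as)) = (\<Sum>w\<leftarrow>ws. w Z))"
  let ?S = "\<lambda>as bs zs. (distinct ((v # as) @ zs) \<longrightarrow> matchable H (set (v # as) \<union> set zs)) \<and>
    (distinct ((u # bs) @ zs) \<longrightarrow> matchable H (set (u # bs) \<union> set zs))"
  let ?Q = "\<lambda>ts. \<exists>as bs zs. ts = as @ bs @ zs \<and> ?R ps as \<and> ?R ns bs \<and> ?S as bs zs"
  have uV: "u \<in> V" "v \<in> V" using P XY by (auto simp: partition_on_def)
  have dp: "dense_tuples V (A * k) (\<mu> ^ A) (?R ps)"
    using dense_tuples_index[OF fin H less_imp_le[OF \<mu>] ps(1), of ps] ps(2) by simp
  have dn: "dense_tuples V (A * k) (\<mu> ^ A) (?R ns)"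
    using dense_tuples_index[OF fin H less_imp_le[OF \<mu>] ns(1), of ns] ns(2) by simp
  have dS: "dense_tuples V ((A * k + 1) * m) (b ^ (A * k + 1)) (?S as bs)"
    if as: "set as \<subseteq> V" "length as = A * k" "?R ps as" and bs: "set bs \<subseteq> V" "length bs = A * k" "?R ns bs" for as bs
  proof -
    \<comment> \<open>Relative to \<open>bs\<close>, \<open>as\<close> has one entry more in X and
      one fewer in Y. Adding v, which lies in Y, to \<open>as\<close> and u, which lies in X, to
      \<open>bs\<close> balances every part, also if X = Y.\<close>
    have "length (filter (\<lambda>x. x \<in> Z) (v # as)) = length (filter (\<lambda>x. x \<in> Z) (u # bs))" if Z: "Z \<in> P" for Z
    proof -
      have "u \<in> Z \<longleftrightarrow> Z = X" "v \<in> Z \<longleftrightarrow> Z = Y"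
        using P XY Z unfolding partition_on_def pairwise_def disjnt_def by blast+
      moreover have "int (length (filter (\<lambda>x. x \<in> Z) as)) - int (length (filter (\<lambda>x. x \<in> Z) bs)) = of_bool (Z = X) - of_bool (Z = Y)"
        using diff[OF Z] as(3) bs(3) Z by simp
      ultimately show ?thesis by (cases "Z = X"; cases "Z = Y") auto
    qed
    then obtain ys where ys: "mset ys = mset (u # bs)" and la: "list_all2 (\<lambda>x y. \<exists>Z\<in>P. x \<in> Z \<and> y \<in> Z) (v # as) ys"
      using rearrange_to_same_parts[OF P, of "v # as" "u # bs"] uV as(1) bs(1) by auto
    have la': "list_all2 (reachable V H m b) (v # as) ys"
      by (rule list_all2_mono[OF la]) (use reach in blast)
    have set_ys: "set ys = set (u # bs)" using ys by (metis set_mset_mset)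
    have dist_ys: "distinct ys = distinct (u # bs)" using ys by (metis mset_eq_imp_distinct_iff)
    have "length (v # as) = A * k + 1" using as(2) by simp
    with dense_tuples_connecting[OF la' fin less_imp_le[OF b]]
    have "dense_tuples V ((A * k + 1) * m) (b ^ (A * k + 1)) (\<lambda>zs.
      (distinct ((v # as) @ zs) \<longrightarrow> matchable H (set (v # as) \<union> set zs)) \<and>
      (distinct (ys @ zs) \<longrightarrow> matchable H (set ys \<union> set zs)))" by (simp only:)
    then show ?thesis by (simp only: distinct_append set_ys dist_ys)
  qed
  have "dense_tuples V l b' ?Q"
    unfolding l b'
  proof (rule dense_tuples_append[OF _ fin])
    show "dense_tuples V (A * k) (\<mu> ^ A) (\<lambda>as. dense_tuples V (A * k + (A * k + 1) * m) (\<mu> ^ A * b ^ (A * k + 1)) (\<lambda>ts. ?Q (as @ ts)))"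
    proof (rule dense_tuples_mono[OF dp fin order_refl])
      fix as assume as: "set as \<subseteq> V" "length as = A * k" "?R ps as"
      show "dense_tuples V (A * k + (A * k + 1) * m) (\<mu> ^ A * b ^ (A * k + 1)) (\<lambda>ts. ?Q (as @ ts))"
      proof (rule dense_tuples_append[OF _ fin])
        show "dense_tuples V (A * k) (\<mu> ^ A) (\<lambda>bs. dense_tuples V ((A * k + 1) * m) (b ^ (A * k + 1)) (\<lambda>zs. ?Q (as @ bs @ zs)))"
        proof (rule dense_tuples_mono[OF dn fin order_refl])
          fix bs assume bs: "set bs \<subseteq> V" "length bs = A * k" "?R ns bs"
          show "dense_tuples V ((A * k + 1) * m) (b ^ (A * k + 1)) (\<lambda>zs. ?Q (as @ bs @ zs))"
          proof (rule dense_tuples_mono[OF dS[OF as bs] fin order_refl])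
            fix zs assume "?S as bs zs"
            then show "?Q (as @ bs @ zs)"
              by (intro exI[of _ as] exI[of _ bs] exI[of _ zs] conjI refl as(3) bs(3)) blast+
          qed
        qed
      qed (use b in auto)
    qed
  qed (use b \<mu> in auto)
  moreover have "card {u, v} \<le> 2" by (cases "u = v") auto
  moreover have "0 < b'" unfolding b' using \<mu> b by simp
  ultimately have "dense_tuples V l (b' / 2) (\<lambda>ts. ?Q ts \<and> distinct ts \<and> set ts \<inter> {u, v} = {})"
    by (intro dense_tuples_distinct_avoiding[where c = 2] fin n ne) auto
  then show ?thesis unfolding reachable_def
  proof (rule dense_tuples_mono[OF _ fin order_refl])
    fix ts assume ts: "?Q ts \<and> distinct ts \<and> set ts \<inter> {u, v} = {}"
    then obtain as bs zs where eq: "ts = as @ bs @ zs" and Q: "?R ps as" "?R ns bs" "?S as bs zs" by blast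
    have d: "distinct (as @ bs @ zs)" "u \<notin> set ts" "v \<notin> set ts" using ts eq by auto
    have "matchable H (set as)" "matchable H (set bs)" using Q d by auto
    moreover have "matchable H (set (v # as) \<union> set zs)" "matchable H (set (u # bs) \<union> set zs)"
      using Q(3) d eq by auto
    ultimately have "matchable H (set as \<union> (set (u # bs) \<union> set zs))" "matchable H (set bs \<union> (set (v # as) \<union> set zs))"
      using d eq by (auto intro!: matchable_Un[of H "set as"] matchable_Un[of H "set bs"] simp del: Un_insert_left)
    moreover have "set as \<union> (set (u # bs) \<union> set zs) = insert u (set ts)"
      "set bs \<union> (set (v # as) \<union> set zs) = insert v (set ts)" using eq by auto
    ultimately show "distinct ts \<and> u \<notin> set ts \<and> v \<notin> set ts \<and>
     matchable H (insert u (set ts)) \<and> matchable H (insert v (set ts))" using ts d by auto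
  qed
qed

section \<open>The perfect matching\<close>

text \<open>Even pairs inside one part go through the exchange, with X = Y, so that all pairs share
  the same list length and density. The minimum with 1 keeps powers of b bounded later on.\<close>

lemma all_reachable:
  fixes \<zeta> \<mu> :: real
  assumes k: "2 \<le> k" and \<mu>: "0 < \<mu>" "\<mu> < \<zeta>" "\<zeta> \<le> 1"
  shows "\<exists>l b n0. 0 < b \<and> b \<le> 1 \<and> (\<forall>(V::'a set) J. dense_complex k \<zeta> V J \<longrightarrow> n0 \<le> card V \<longrightarrow>
    (\<forall>P. partition_on V P \<and> (\<forall>X\<in>P. (\<zeta> - \<mu>) * real (card V) \<le> real (card X)) \<longrightarrow>
      complete_lattice_of P k (robust_lattice V P k \<mu> (layer J k))) \<longrightarrow>
    (\<forall>u\<in>V. \<forall>v\<in>V. reachable V (layer J k) l b u v))"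
proof -
  obtain c m b n0 where b: "0 < b" and part: "\<And>(V::'a set) J. dense_complex k \<zeta> V J \<Longrightarrow> n0 \<le> card V \<Longrightarrow>
    \<exists>P. partition_on V P \<and> card P \<le> c \<and> (\<forall>X\<in>P. (\<zeta> - \<mu>) * real (card V) \<le> real (card X) \<and>
      (\<forall>u\<in>X. \<forall>v\<in>X. reachable V (layer J k) m b u v))"
    using reachable_partition[OF k \<mu>, where ?'a = 'a] by blast
  obtain C D where C: "0 \<le> C" and comb: "\<forall>(P::'a set set) B. finite P \<longrightarrow> card P \<le> c \<longrightarrow> (\<forall>w\<in>B. k_vector P k w) \<longrightarrow>
     finite B \<and> card B \<le> D \<and>
     (\<forall>v. k_vector P k v \<longrightarrow> v \<in> lattice_gen B \<longrightarrow>
       (\<exists>c. (\<forall>w\<in>B. \<bar>c w\<bar> \<le> (C::int)) \<and> (\<forall>X\<in>P. v X = (\<Sum>w\<in>B. c w * w X))))"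
    using bounded_lattice_combination[of c k, where ?'a = 'a] by (elim exE conjE) (rule that)
  define A where "A = nat (2 * C) * D"
  define l where "l = A * k + (A * k + (A * k + 1) * m)"
  define b' where "b' = \<mu> ^ A * (\<mu> ^ A * b ^ (A * k + 1))"
  define n1 where "n1 = max n0 (nat \<lceil>2 * real (l * (2 + l)) / b'\<rceil>)"
  have b': "0 < b'" unfolding b'_def using \<mu> b by simp
  show ?thesis
  proof (rule exI[of _ l], rule exI[of _ "min 1 (b' / 2)"], rule exI[of _ n1], intro conjI allI impI ballI)
    fix V :: "'a set" and J u v
    assume D: "dense_complex k \<zeta> V J" and n1: "n1 \<le> card V" and uv: "u \<in> V" "v \<in> V"
      and lat: "\<forall>P. partition_on V P \<and> (\<forall>X\<in>P. (\<zeta> - \<mu>) * real (card V) \<le> real (card X)) \<longrightarrow>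
      complete_lattice_of P k (robust_lattice V P k \<mu> (layer J k))"
    interpret dense_complex k \<zeta> V J by fact
    have n0: "n0 \<le> card V" and "2 * real (l * (2 + l)) / b' \<le> real (card V)" using n1 unfolding n1_def by linarith+
    then have nb: "2 * real (l * (2 + l)) \<le> b' * real (card V)" using b' by (simp add: field_simps)
    obtain P where P: "partition_on V P" "card P \<le> c" "\<forall>X\<in>P. (\<zeta> - \<mu>) * real (card V) \<le> real (card X)"
        "\<And>X u v. X \<in> P \<Longrightarrow> u \<in> X \<Longrightarrow> v \<in> X \<Longrightarrow> reachable V H m b u v"
      using part[OF D n0] by blast
    have finP: "finite P" using finite_elements[OF finV P(1)] .
    let ?B = "{w. robust_edge_vector V P k \<mu> H w}"
    have BK: "\<forall>w\<in>?B. k_vector P k w" by (auto simp: robust_edge_vector_def)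
    note cmb = comb[THEN spec, THEN spec, THEN mp, THEN mp, THEN mp, OF finP P(2) BK]
    have complete: "v \<in> lattice_gen ?B" if "k_vector P k v" for v
      using lat P(1,3) that unfolding complete_lattice_of_def robust_lattice_def by blast
    obtain X Y where XY: "X \<in> P" "Y \<in> P" "u \<in> X" "v \<in> Y" using uv P(1) by (auto simp: partition_on_def)
    have "\<exists>ps ns. set ps \<subseteq> ?B \<and> set ns \<subseteq> ?B \<and> length ps = nat (2 * C) * D \<and> length ns = nat (2 * C) * D \<and>
      (\<forall>Z\<in>P. (\<Sum>w\<leftarrow>ps. w Z) - (\<Sum>w\<leftarrow>ns. w Z) = of_bool (Z = X) - of_bool (Z = Y))"
      by (rule exchange_lists[OF finP XY(1,2) _ _ _ BK C]) (use cmb complete k in auto)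
    then obtain ps ns where ps: "set ps \<subseteq> ?B" "length ps = A" and ns: "set ns \<subseteq> ?B" "length ns = A"
      and diff: "\<And>Z. Z \<in> P \<Longrightarrow> (\<Sum>w\<leftarrow>ps. w Z) - (\<Sum>w\<leftarrow>ns. w Z) = of_bool (Z = X) - of_bool (Z = Y)"
      unfolding A_def by blast
    have "reachable V H l (b' / 2) u v"
      by (rule reachable_by_exchange[OF finV neV P(1) XY _ \<mu>(1) b _ ps(2) _ ns(2) diff P(4) l_def b'_def nb])
        (use edge_H ps(1) ns(1) in auto)
    then show "reachable V H l (min 1 (b' / 2)) u v"
      unfolding reachable_def by (rule dense_tuples_mono) (use finV in auto)
  qed (use b' in auto)
qed

section \<open>Absorbing families with uniform constants\<close>

lemma eventually_power_less_exp:
  fixes a c :: real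
  assumes "0 < a" "0 < c"
  shows "\<exists>n0. \<forall>n\<ge>n0. real n ^ k * c < exp (a * real n)"
proof -
  have "((\<lambda>y::real. y ^ k / exp y) \<longlongrightarrow> 0) at_top" by (rule tendsto_power_div_exp_0)
  moreover have "0 < a ^ k / c" using assms by simp
  ultimately have "\<forall>\<^sub>F y in at_top. y ^ k / exp y < a ^ k / c" by (rule order_tendstoD(2))
  then obtain y0 where y0: "\<And>y. y0 \<le> y \<Longrightarrow> y ^ k / exp y < a ^ k / c" by (auto simp: eventually_at_top_linorder)
  show ?thesis
  proof (intro exI[of _ "nat \<lceil>y0 / a\<rceil>"] allI impI)
    fix n assume "nat \<lceil>y0 / a\<rceil> \<le> n"
    then have "y0 / a \<le> real n" by linarith
    then have "y0 \<le> a * real n" using assms by (simp add: field_simps)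
    from y0[OF this] show "real n ^ k * c < exp (a * real n)"
      using assms by (simp add: power_mult_distrib field_simps)
  qed
qed

lemma (in dense_complex) min_degree_le_1: "\<zeta> \<le> 1"
proof -
  obtain v where v: "v \<in> V" using neV by (metis card_gt_0_iff ex_in_conv)
  have "\<zeta> * real (card V) \<le> real (card {x\<in>V. x \<notin> {v} \<and> insert x {v} \<in> J})"
    using extensions_ge[OF singleton_in[OF v]] k2 by simp
  also have "\<dots> \<le> 1 * real (card V)" using finV by (simp add: card_mono)
  finally show ?thesis using neV by (simp add: mult_le_cancel_right)
qed

text \<open>A k-set with fewer than \<alpha> n absorbers would alone keep the potential above exp (-
  \<alpha> n). But the potential starts at no more than n^k and shrinks by the factor 1 - \<beta> /
  4 in each of about \<tau> n steps, which is a smaller quantity for large n.\<close>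

lemma absorbing_family_exists:
  fixes \<zeta> \<mu> \<epsilon> :: real
  assumes k: "2 \<le> k" and \<mu>: "0 < \<mu>" "\<mu> < \<zeta>" and \<epsilon>: "0 < \<epsilon>"
  shows "\<exists>\<alpha> n0. 0 < \<alpha> \<and> (\<forall>(V::'a set) J. dense_complex k \<zeta> V J \<longrightarrow> n0 \<le> card V \<longrightarrow>
    (\<forall>P. partition_on V P \<and> (\<forall>X\<in>P. (\<zeta> - \<mu>) * real (card V) \<le> real (card X)) \<longrightarrow>
      complete_lattice_of P k (robust_lattice V P k \<mu> (layer J k))) \<longrightarrow>
    (\<exists>\<F>. finite \<F> \<and> (\<forall>S\<in>\<F>. \<forall>T\<in>\<F>. S \<noteq> T \<longrightarrow> S \<inter> T = {}) \<and>
      (\<forall>T\<in>\<F>. T \<subseteq> V \<and> matchable (layer J k) T) \<and> real (card (\<Union>\<F>)) \<le> \<epsilon> * real (card V) \<and>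
      (\<forall>Q\<subseteq>V. card Q = k \<longrightarrow> \<alpha> * real (card V) \<le> real (card {T\<in>\<F>. absorbs (layer J k) T Q}))))"
proof (cases "\<zeta> \<le> 1")
  case False
  \<comment> \<open>Degrees above n are impossible, so the claim is vacuous and any \<alpha>
    serves.\<close>
  then have "\<not> dense_complex k \<zeta> V J" for V :: "'a set" and J
    using dense_complex.min_degree_le_1 by blast
  then show ?thesis by (intro exI[of _ 1]) auto
next
  case \<zeta>1: True
  obtain l b n1 where b: "0 < b" "b \<le> 1" and reach: "\<And>(V::'a set) J u v. dense_complex k \<zeta> V J \<Longrightarrow> n1 \<le> card V \<Longrightarrow>
    \<forall>P. partition_on V P \<and> (\<forall>X\<in>P. (\<zeta> - \<mu>) * real (card V) \<le> real (card X)) \<longrightarrow>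
      complete_lattice_of P k (robust_lattice V P k \<mu> (layer J k)) \<Longrightarrow>
    u \<in> V \<Longrightarrow> v \<in> V \<Longrightarrow> reachable V (layer J k) l b u v"
    using all_reachable[OF k \<mu> \<zeta>1, where ?'a = 'a] by metis
  define M where "M = k + k * l"
  define z where "z = \<zeta> ^ (k - 1)"
  define \<beta> where "\<beta> = z * b ^ k / 2"
  \<comment> \<open>The first bound keeps the family on at most \<epsilon> n vertices; the second
    leaves density \<beta> / 2 of absorbers disjoint from the earlier members. In \<alpha>, half of
    the decay rate \<beta> \<tau> / 4 is kept, the other half has to beat n^k.\<close>
  define \<tau> where "\<tau> = min (\<epsilon> / real M) (\<beta> / (4 * (real M)\<^sup>2))"
  define \<alpha> where "\<alpha> = \<beta> * \<tau> / 8"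
  have M: "0 < M" unfolding M_def using k by simp
  have z: "0 < z" "z \<le> 1" unfolding z_def using \<mu> \<zeta>1 by (auto simp: power_le_one)
  have bk: "0 < b ^ k" "b ^ k \<le> 1" using b by (auto simp: power_le_one)
  have \<beta>: "0 < \<beta>" "\<beta> \<le> 1" unfolding \<beta>_def using z bk mult_le_one[of z "b ^ k"] by auto
  have \<tau>: "0 < \<tau>" unfolding \<tau>_def using \<epsilon> \<beta> M by simp
  have \<tau>1: "real M * \<tau> \<le> \<epsilon>"
  proof -
    have "\<tau> \<le> \<epsilon> / real M" unfolding \<tau>_def by simp
    then show ?thesis using M by (simp add: field_simps)
  qed
  have \<tau>2: "4 * (real M)\<^sup>2 * \<tau> \<le> \<beta>"
  proof -
    have "\<tau> \<le> \<beta> / (4 * (real M)\<^sup>2)" unfolding \<tau>_def by simp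
    then show ?thesis using M by (simp add: field_simps)
  qed
  have \<alpha>: "0 < \<alpha>" unfolding \<alpha>_def using \<beta> \<tau> by simp
  \<comment> \<open>The factor exp (\<beta> / 4) pays for rounding the number of steps down, t \<ge>
    \<tau> n - 1.\<close>
  obtain n2 where n2: "\<And>n. n2 \<le> n \<Longrightarrow> real n ^ k * exp (\<beta> / 4) < exp (\<beta> * \<tau> / 8 * real n)"
    using eventually_power_less_exp[of "\<beta> * \<tau> / 8" "exp (\<beta> / 4)" k] \<beta> \<tau> by auto
  define n3 where "n3 = nat \<lceil>2 * real (M * (k + M)) / (z * b ^ k)\<rceil>"
  define n4 where "n4 = nat \<lceil>4 * (real M)\<^sup>2 / \<beta>\<rceil>"
  show ?thesis
  proof (rule exI[of _ \<alpha>], rule exI[of _ "max (max n1 n2) (max n3 n4)"], intro conjI \<alpha> allI impI)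
    fix V :: "'a set" and J
    assume D: "dense_complex k \<zeta> V J" and n: "max (max n1 n2) (max n3 n4) \<le> card V"
      and lat: "\<forall>P. partition_on V P \<and> (\<forall>X\<in>P. (\<zeta> - \<mu>) * real (card V) \<le> real (card X)) \<longrightarrow>
      complete_lattice_of P k (robust_lattice V P k \<mu> (layer J k))"
    interpret dense_complex k \<zeta> V J by fact
    let ?n = "real (card V)"
    define t where "t = nat \<lfloor>\<tau> * ?n\<rfloor>"
    define \<Q> where "\<Q> = {Q. Q \<subseteq> V \<and> card Q = k}"
    have "2 * real (M * (k + M)) / (z * b ^ k) \<le> ?n" using n unfolding n3_def by linarith
    then have n3: "2 * real (M * (k + M)) \<le> z * b ^ k * ?n" using z bk by (simp add: field_simps)
    have "4 * (real M)\<^sup>2 / \<beta> \<le> ?n" using n unfolding n4_def by linarith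
    then have n4: "4 * (real M)\<^sup>2 \<le> \<beta> * ?n" using \<beta> by (simp add: field_simps)
    have t: "real t \<le> \<tau> * ?n" "\<tau> * ?n - 1 \<le> real t"
      unfolding t_def using \<tau> by (auto simp: of_nat_nat)
    have dense: "dense_tuples V M \<beta> (\<lambda>zs. distinct zs \<and> absorbs H (set zs) Q)" if "Q \<in> \<Q>" for Q
    proof -
      have de: "dense_tuples V k z (\<lambda>xs. distinct xs \<and> set xs \<in> H)" using dense_edges unfolding z_def .
      show ?thesis unfolding M_def \<beta>_def
        by (rule dense_tuples_absorbing[OF finV b(1) z(1) _ de])
          (use that reach[OF D _ lat] n n3 neV in \<open>auto simp: \<Q>_def M_def\<close>)
    qed
    have fin\<Q>: "finite \<Q>" unfolding \<Q>_def using finV by simp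
    have prem: "2 * real (M * (M * t + M)) \<le> \<beta> * ?n"
    proof -
      have "2 * real (M * (M * t + M)) = 2 * (real M)\<^sup>2 * real t + 2 * (real M)\<^sup>2"
        by (simp add: power2_eq_square algebra_simps)
      also have "\<dots> \<le> 2 * (real M)\<^sup>2 * (\<tau> * ?n) + 2 * (real M)\<^sup>2"
        using t by (intro add_mono mult_left_mono) auto
      also have "2 * (real M)\<^sup>2 * (\<tau> * ?n) = (4 * (real M)\<^sup>2 * \<tau>) * ?n / 2" by simp
      also have "\<dots> \<le> \<beta> * ?n / 2" using \<tau>2 by (intro divide_right_mono mult_right_mono) auto
      finally show ?thesis using n4 by simp
    qed
    obtain \<F> where F: "finite \<F>" "card \<F> \<le> t" "\<forall>S\<in>\<F>. \<forall>T\<in>\<F>. S \<noteq> T \<longrightarrow> S \<inter> T = {}"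
      "\<forall>T\<in>\<F>. T \<subseteq> V \<and> card T = M \<and> matchable H T"
      "(\<Sum>Q\<in>\<Q>. (1/2) ^ card {T\<in>\<F>. absorbs H T Q}) \<le> real (card \<Q>) * (1 - \<beta> / 4) ^ t"
      using absorbing_family_potential[OF finV fin\<Q> neV M \<beta> dense prem] by blast
    have size: "real (card (\<Union>\<F>)) \<le> \<epsilon> * ?n"
    proof -
      have "card (\<Union>\<F>) \<le> sum card \<F>" by (rule card_Union_le_sum_card)
      also have "\<dots> = card \<F> * M" using F(4) by simp
      also have "\<dots> \<le> t * M" using F(2) by simp
      finally have "real (card (\<Union>\<F>)) \<le> real t * real M" by (simp flip: of_nat_mult)
      also have "\<dots> \<le> \<tau> * ?n * real M" using t by (intro mult_right_mono) auto
      also have "\<dots> = (real M * \<tau>) * ?n" by simp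
      also have "\<dots> \<le> \<epsilon> * ?n" using \<tau>1 by (intro mult_right_mono) auto
      finally show ?thesis .
    qed
    have many: "\<alpha> * ?n \<le> real (card {T\<in>\<F>. absorbs H T Q})" if Q: "Q \<subseteq> V" "card Q = k" for Q
    proof (rule ccontr)
      let ?X = "card {T\<in>\<F>. absorbs H T Q}"
      assume "\<not> ?thesis"
      then have X: "real ?X < \<alpha> * ?n" by simp
      \<comment> \<open>Both sides are compared as powers of e: 1/2 \<ge> exp (-1) from below, 1 -
        \<beta> / 4 \<le> exp (- \<beta> / 4) from above.\<close>
      have "exp (- real ?X) = exp (-1) ^ ?X" by (simp flip: exp_of_nat_mult)
      also have "\<dots> \<le> (1/2) ^ ?X"
      proof (intro power_mono)
        have "2 \<le> exp (1::real)" using exp_ge_add_one_self[of 1] by simp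
        then show "exp (- 1) \<le> (1 / 2 :: real)" by (simp add: exp_minus field_simps)
      qed simp
      also have "\<dots> \<le> (\<Sum>Q\<in>\<Q>. (1/2) ^ card {T\<in>\<F>. absorbs H T Q})"
        using fin\<Q> Q unfolding \<Q>_def by (intro member_le_sum) auto
      also have "\<dots> \<le> real (card \<Q>) * (1 - \<beta> / 4) ^ t" by (rule F(5))
      also have "\<dots> \<le> ?n ^ k * exp (- (\<beta> / 4)) ^ t"
      proof (intro mult_mono power_mono)
        have "card \<Q> = card V choose k" unfolding \<Q>_def using n_subsets[OF finV] by simp
        also have "\<dots> \<le> card V ^ k" using Q finV by (intro binomial_le_pow) (metis card_mono)
        finally show "real (card \<Q>) \<le> ?n ^ k" by (simp flip: of_nat_power)
        show "1 - \<beta> / 4 \<le> exp (- (\<beta> / 4))" using exp_ge_add_one_self[of "- (\<beta> / 4)"] by simp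
      qed (use \<beta> in auto)
      also have "exp (- (\<beta> / 4)) ^ t = exp (- (\<beta> / 4) * real t)"
        by (simp flip: exp_of_nat_mult add: mult.commute)
      also have "?n ^ k * exp (- (\<beta> / 4) * real t) \<le> ?n ^ k * exp (\<beta> / 4 - \<beta> / 4 * (\<tau> * ?n))"
      proof -
        have "\<beta> / 4 * (\<tau> * ?n - 1) \<le> \<beta> / 4 * real t" using t \<beta> by (intro mult_left_mono) auto
        then show ?thesis by (intro mult_left_mono) (auto simp: algebra_simps)
      qed
      finally have "exp (- real ?X) \<le> ?n ^ k * exp (\<beta> / 4 - \<beta> / 4 * (\<tau> * ?n))" .
      moreover have "exp (- (\<alpha> * ?n)) < exp (- real ?X)" using X by simp
      ultimately have "exp (- (\<alpha> * ?n)) < ?n ^ k * exp (\<beta> / 4 - \<beta> / 4 * (\<tau> * ?n))"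
        by linarith
      then have "exp (- (\<alpha> * ?n)) * exp (\<beta> / 4 * (\<tau> * ?n)) < ?n ^ k * exp (\<beta> / 4 - \<beta> / 4 * (\<tau> * ?n)) * exp (\<beta> / 4 * (\<tau> * ?n))"
        by (rule mult_strict_right_mono) simp
      moreover have "exp (- (\<alpha> * ?n)) * exp (\<beta> / 4 * (\<tau> * ?n)) = exp (\<beta> * \<tau> / 8 * ?n)"
        unfolding exp_add[symmetric] \<alpha>_def by (rule arg_cong[where f = exp]) (simp add: field_simps)
      moreover have "?n ^ k * exp (\<beta> / 4 - \<beta> / 4 * (\<tau> * ?n)) * exp (\<beta> / 4 * (\<tau> * ?n)) = ?n ^ k * exp (\<beta> / 4)"
        unfolding mult.assoc exp_add[symmetric] by simp
      ultimately have "exp (\<beta> * \<tau> / 8 * ?n) < ?n ^ k * exp (\<beta> / 4)" by (simp only:)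
      then show False using n2[of "card V"] n by simp
    qed
    show "\<exists>\<F>. finite \<F> \<and> (\<forall>S\<in>\<F>. \<forall>T\<in>\<F>. S \<noteq> T \<longrightarrow> S \<inter> T = {}) \<and>
      (\<forall>T\<in>\<F>. T \<subseteq> V \<and> matchable H T) \<and> real (card (\<Union>\<F>)) \<le> \<epsilon> * ?n \<and>
      (\<forall>Q\<subseteq>V. card Q = k \<longrightarrow> \<alpha> * ?n \<le> real (card {T\<in>\<F>. absorbs H T Q}))"
      using F(1,3,4) size many by (intro exI[of _ \<F>]) blast
  qed
qed

text \<open>Settles k = 1, which lies outside the range of nibble and absorption: an edge through v
  can only be {v}.\<close>

lemma perfect_fractional_matching_singletons:
  assumes "perfect_fractional_matching U E g" "\<And>e. e \<in> E \<Longrightarrow> card e = 1" "\<And>e. e \<in> E \<Longrightarrow> e \<subseteq> U"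
  shows "\<exists>M. perfect_matching U E M"
proof -
  have "{v} \<in> E" if "v \<in> U" for v
  proof -
    have "{e\<in>E. v \<in> e} \<noteq> {}"
      using assms(1) that unfolding perfect_fractional_matching_def by (metis sum.empty zero_neq_one)
    then obtain e where e: "e \<in> E" "v \<in> e" by blast
    then show ?thesis using assms(2)[OF e(1)] by (metis card_1_singletonE singletonD)
  qed
  then show ?thesis unfolding perfect_matching_def by (intro exI[of _ "(\<lambda>v. {v}) ` U"]) auto
qed

text \<open>The average of the m fractional matchings has all degrees 1 and codegrees at most 2 / m,
  so the nibble applies with K = 2 / \<gamma>.\<close>

lemma almost_perfect_matching_of_fractional_matchings:
  fixes \<alpha> \<gamma> :: real
  assumes k: "2 \<le> k" and \<alpha>: "0 < \<alpha>" and \<gamma>: "0 < \<gamma>"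
  shows "\<exists>N0. \<forall>(U::'a set) E m g. finite U \<longrightarrow> N0 \<le> card U \<longrightarrow> (\<forall>e\<in>E. e \<subseteq> U \<and> card e = k) \<longrightarrow>
      \<gamma> * real (card U) \<le> real m \<longrightarrow> (\<forall>i<m. perfect_fractional_matching U E (g i)) \<longrightarrow>
      (\<forall>u\<in>U. \<forall>v\<in>U. u \<noteq> v \<longrightarrow> (\<Sum>e\<in>{e\<in>E. u \<in> e \<and> v \<in> e}. \<Sum>i<m. g i e) \<le> 2) \<longrightarrow>
      (\<exists>M\<subseteq>E. (\<forall>e\<in>M. \<forall>f\<in>M. e \<noteq> f \<longrightarrow> e \<inter> f = {}) \<and> real (card (U - \<Union>M)) \<le> \<alpha> * real (card U))"
proof -
  have K: "0 \<le> 2 / \<gamma>" using \<gamma> by simp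
  obtain N0 where N0: "\<forall>(U::'a set) E w. finite U \<longrightarrow> N0 \<le> card U \<longrightarrow> (\<forall>e\<in>E. e \<subseteq> U \<and> card e = k) \<longrightarrow>
      (\<forall>e. 0 \<le> w e) \<longrightarrow> (\<forall>v\<in>U. wdeg w E v = 1) \<longrightarrow>
      (\<forall>u\<in>U. \<forall>v\<in>U. u \<noteq> v \<longrightarrow> wcod w E u v \<le> 2 / \<gamma> / real (card U)) \<longrightarrow>
      (\<exists>M\<subseteq>E. (\<forall>e\<in>M. \<forall>f\<in>M. e \<noteq> f \<longrightarrow> e \<inter> f = {}) \<and> real (card (U - \<Union>M)) \<le> \<alpha> * real (card U))"
    using almost_perfect_matching[OF k \<alpha> K, where ?'a = 'a] by (elim exE) (rule that)
  show ?thesis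
  proof (rule exI[of _ "max 1 N0"], intro allI impI)
    fix U :: "'a set" and E m and g :: "nat \<Rightarrow> 'a set \<Rightarrow> real"
    assume U: "finite U" "max 1 N0 \<le> card U" and E: "\<forall>e\<in>E. e \<subseteq> U \<and> card e = k"
      and m: "\<gamma> * real (card U) \<le> real m" and g: "\<forall>i<m. perfect_fractional_matching U E (g i)"
      and cod: "\<forall>u\<in>U. \<forall>v\<in>U. u \<noteq> v \<longrightarrow> (\<Sum>e\<in>{e\<in>E. u \<in> e \<and> v \<in> e}. \<Sum>i<m. g i e) \<le> 2"
    have finE: "finite E" by (rule finite_subset[of _ "Pow U"]) (use E U in auto)
    have U0: "0 < real (card U)" using U by simp
    have m0: "0 < real m" using m \<gamma> U0 by (meson less_le_trans mult_pos_pos)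
    \<comment> \<open>Zero outside E, because \<open>almost_perfect_matching\<close> asks for
      weights that are nonnegative everywhere.\<close>
    define w where "w e = (if e \<in> E then (\<Sum>i<m. g i e) / real m else 0)" for e
    show "\<exists>M\<subseteq>E. (\<forall>e\<in>M. \<forall>f\<in>M. e \<noteq> f \<longrightarrow> e \<inter> f = {}) \<and> real (card (U - \<Union>M)) \<le> \<alpha> * real (card U)"
    proof (rule N0[THEN spec, THEN spec, THEN spec[of _ w], THEN mp, THEN mp, THEN mp, THEN mp, THEN mp, THEN mp])
      show "\<forall>e. 0 \<le> w e"
        using g unfolding w_def perfect_fractional_matching_def by (auto intro!: divide_nonneg_nonneg sum_nonneg)
      show "\<forall>v\<in>U. wdeg w E v = 1"
      proof
        fix v assume v: "v \<in> U"
        have "wdeg w E v = (\<Sum>e\<in>{e\<in>E. v \<in> e}. (\<Sum>i<m. g i e) / real m)"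
          unfolding wdeg_def w_def using finE by (intro sum.mono_neutral_cong_right) auto
        also have "\<dots> = (\<Sum>i<m. \<Sum>e\<in>{e\<in>E. v \<in> e}. g i e) / real m"
          unfolding sum_divide_distrib[symmetric] by (subst sum.swap) simp
        also have "\<dots> = (\<Sum>i<m. 1) / real m"
          using g v unfolding perfect_fractional_matching_def by (intro arg_cong2[where f = "(/)"] sum.cong) auto
        finally show "wdeg w E v = 1" using m0 by simp
      qed
      show "\<forall>u\<in>U. \<forall>v\<in>U. u \<noteq> v \<longrightarrow> wcod w E u v \<le> 2 / \<gamma> / real (card U)"
      proof (intro ballI impI)
        fix u v assume uv: "u \<in> U" "v \<in> U" "u \<noteq> v"
        have "wcod w E u v = (\<Sum>e\<in>{e\<in>E. u \<in> e \<and> v \<in> e}. (\<Sum>i<m. g i e) / real m)"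
          unfolding wcod_def w_def using finE by (intro sum.mono_neutral_cong_right) auto
        also have "\<dots> = (\<Sum>e\<in>{e\<in>E. u \<in> e \<and> v \<in> e}. \<Sum>i<m. g i e) / real m"
          by (simp add: sum_divide_distrib)
        also have "\<dots> \<le> 2 / real m" using cod uv by (intro divide_right_mono) auto
        also have "\<dots> \<le> 2 / (\<gamma> * real (card U))" using m \<gamma> U0 m0 by (intro divide_left_mono mult_pos_pos) auto
        finally show "wcod w E u v \<le> 2 / \<gamma> / real (card U)" by simp
      qed
    qed (use U E in auto)
  qed
qed

theorem theorem6p1:
  shows "\<forall>k::nat. k \<ge> 1 \<longrightarrow> (\<forall>\<zeta>::real. \<zeta> > 0 \<longrightarrow>
    (\<exists>a0::real. a0 > 0 \<and> (\<forall>\<gamma> \<epsilon> \<mu>::real.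
      0 < \<gamma> \<and> \<gamma> \<le> a0 \<and> 0 < \<epsilon> \<and> \<epsilon> \<le> a0 \<and> 0 < \<mu> \<and> \<mu> \<le> a0 \<longrightarrow>
      (\<exists>n0::nat. \<forall>n\<ge>n0. \<forall>(V::'a set) (J::'a set set).
         k dvd n \<and> card V = n \<and> k_complex k V J \<and> min_deg_cond k J n \<zeta>
         \<and> (\<forall>U. U \<subseteq> V \<and> real (card U) \<ge> real n - \<epsilon> * real n \<longrightarrow>
               (\<exists>m::nat. \<exists>g::nat \<Rightarrow> 'a set \<Rightarrow> real.
                  real m \<ge> \<gamma> * real (card U)
                  \<and> (\<forall>i<m. perfect_fractional_matching U (layer (induced J U) k) (g i))
                  \<and> (\<forall>u\<in>U. \<forall>v\<in>U. u \<noteq> v \<longrightarrow>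
                       (\<Sum>e\<in>{e \<in> layer (induced J U) k. u \<in> e \<and> v \<in> e}. \<Sum>i<m. g i e) \<le> 2)))
         \<and> (\<forall>P. partition_on V P \<and> (\<forall>X\<in>P. real (card X) \<ge> (\<zeta> - \<mu>) * real n) \<longrightarrow>
               complete_lattice_of P k (robust_lattice V P k \<mu> (layer J k)))
         \<longrightarrow> (\<exists>M. perfect_matching V (layer J k) M)))))"
proof (intro allI impI)
  fix k :: nat and \<zeta> :: real
  assume k1: "1 \<le> k" and \<zeta>: "0 < \<zeta>"
  let ?frac = "\<lambda>U (J::'a set set) \<gamma> m g. \<gamma> * real (card U) \<le> real m
      \<and> (\<forall>i<m. perfect_fractional_matching U (layer (induced J U) k) (g i))
      \<and> (\<forall>u\<in>U. \<forall>v\<in>U. u \<noteq> v \<longrightarrow>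
           (\<Sum>e\<in>{e \<in> layer (induced J U) k. u \<in> e \<and> v \<in> e}. \<Sum>i<m. g i e) \<le> (2::real))"
  let ?frac_all = "\<lambda>n V J \<gamma> \<epsilon>. \<forall>U. U \<subseteq> V \<and> real (card U) \<ge> real n - \<epsilon> * real n \<longrightarrow> (\<exists>m g. ?frac U J \<gamma> m g)"
  let ?lat = "\<lambda>n (V::'a set) J \<mu>. \<forall>P. partition_on V P \<and> (\<forall>X\<in>P. (\<zeta> - \<mu>) * real n \<le> real (card X)) \<longrightarrow>
               complete_lattice_of P k (robust_lattice V P k \<mu> (layer J k))"
  \<comment> \<open>\<epsilon> \<le> 1/2 leaves at least n / 2 vertices beside the absorbers, and
    \<mu> < \<zeta> makes the required part sizes positive. All further dependence on \<gamma>,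
    \<epsilon> and \<mu> goes into n0.\<close>
  have main: "\<exists>n0::nat. \<forall>n\<ge>n0. \<forall>(V::'a set) (J::'a set set).
         k dvd n \<and> card V = n \<and> k_complex k V J \<and> min_deg_cond k J n \<zeta>
         \<and> ?frac_all n V J \<gamma> \<epsilon> \<and> ?lat n V J \<mu>
         \<longrightarrow> (\<exists>M. perfect_matching V (layer J k) M)"
    if par: "0 < \<gamma>" "0 < \<epsilon>" "\<epsilon> \<le> 1/2" "0 < \<mu>" "\<mu> < \<zeta>" for \<gamma> \<epsilon> \<mu> :: real
  proof -
    \<comment> \<open>Applied to V itself, (i) yields a k-edge, which brings {} into J, and a
      fractional matching that settles k = 1.\<close>
    have nonempty: "\<exists>e. e \<in> layer J k" and perfect_1: "k = 1 \<Longrightarrow> \<exists>M. perfect_matching V (layer J k) M"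
      if "k_complex k V J" "0 < card V" "?frac_all (card V) V J \<gamma> \<epsilon>" for V J
    proof -
      have sub: "e \<subseteq> V" if "e \<in> J" for e using that \<open>k_complex k V J\<close> by (auto simp: k_complex_def)
      have "real (card V) - \<epsilon> * real (card V) \<le> real (card V)" using par by simp
      then obtain m g where mg: "?frac V J \<gamma> m g" using \<open>?frac_all (card V) V J \<gamma> \<epsilon>\<close> by blast
      have "0 < \<gamma> * real (card V)" using par \<open>0 < card V\<close> by simp
      then have "0 < m" using mg by (cases m) auto
      moreover have ind: "layer (induced J V) k = layer J k" using sub by (auto simp: layer_def induced_def)
      ultimately have pfm: "perfect_fractional_matching V (layer J k) (g 0)" using mg by auto
      obtain v where v: "v \<in> V" using \<open>0 < card V\<close> by (metis card_gt_0_iff ex_in_conv)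
      have "(\<Sum>e\<in>{e\<in>layer J k. v \<in> e}. g 0 e) = 1" using pfm v unfolding perfect_fractional_matching_def by blast
      then have "{e\<in>layer J k. v \<in> e} \<noteq> {}" by (metis sum.empty zero_neq_one)
      then show "\<exists>e. e \<in> layer J k" by blast
      show "\<exists>M. perfect_matching V (layer J k) M" if "k = 1"
        using pfm by (rule perfect_fractional_matching_singletons) (use that sub in \<open>auto simp: layer_def\<close>)
    qed
    show ?thesis
    proof (cases "k = 1")
      case True
      show ?thesis
      proof (rule exI[of _ 1], intro allI impI, elim conjE)
        fix n and V :: "'a set" and J
        assume "1 \<le> n" "card V = n" "k_complex k V J" "?frac_all n V J \<gamma> \<epsilon>"
        then show "\<exists>M. perfect_matching V (layer J k) M" using perfect_1[of V J] True by auto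
      qed
    next
      case False
      then have k2: "2 \<le> k" using k1 by simp
      obtain \<alpha> n1 where \<alpha>: "0 < \<alpha>" and fam: "\<forall>(V::'a set) J. dense_complex k \<zeta> V J \<longrightarrow> n1 \<le> card V \<longrightarrow> ?lat (card V) V J \<mu> \<longrightarrow>
        (\<exists>\<F>. finite \<F> \<and> (\<forall>S\<in>\<F>. \<forall>T\<in>\<F>. S \<noteq> T \<longrightarrow> S \<inter> T = {}) \<and>
          (\<forall>T\<in>\<F>. T \<subseteq> V \<and> matchable (layer J k) T) \<and> real (card (\<Union>\<F>)) \<le> \<epsilon> * real (card V) \<and>
          (\<forall>Q\<subseteq>V. card Q = k \<longrightarrow> \<alpha> * real (card V) \<le> real (card {T\<in>\<F>. absorbs (layer J k) T Q})))"
        using absorbing_family_exists[OF k2 par(4,5,2), where ?'a = 'a] by (elim exE conjE) (rule that)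
      \<comment> \<open>The nibble receives the \<alpha> that the absorbing family supplied.\<close>
      obtain N0 where nib: "\<forall>(U::'a set) E m g. finite U \<longrightarrow> N0 \<le> card U \<longrightarrow> (\<forall>e\<in>E. e \<subseteq> U \<and> card e = k) \<longrightarrow>
          \<gamma> * real (card U) \<le> real m \<longrightarrow> (\<forall>i<m. perfect_fractional_matching U E (g i)) \<longrightarrow>
          (\<forall>u\<in>U. \<forall>v\<in>U. u \<noteq> v \<longrightarrow> (\<Sum>e\<in>{e\<in>E. u \<in> e \<and> v \<in> e}. \<Sum>i<m. g i e) \<le> 2) \<longrightarrow>
          (\<exists>M\<subseteq>E. (\<forall>e\<in>M. \<forall>f\<in>M. e \<noteq> f \<longrightarrow> e \<inter> f = {}) \<and> real (card (U - \<Union>M)) \<le> \<alpha> * real (card U))"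
        using almost_perfect_matching_of_fractional_matchings[OF k2 \<alpha> par(1), where ?'a = 'a] by (elim exE) (rule that)
      show ?thesis
      proof (rule exI[of _ "max 1 (max n1 (2 * N0))"], intro allI impI, elim conjE)
        fix n and V :: "'a set" and J
        assume n: "max 1 (max n1 (2 * N0)) \<le> n" and dvd: "k dvd n" and cV: "card V = n" and J: "k_complex k V J"
          and deg: "min_deg_cond k J n \<zeta>" and frac: "?frac_all n V J \<gamma> \<epsilon>" and lat: "?lat n V J \<mu>"
        have V0: "0 < card V" using n cV by simp
        obtain e0 where "e0 \<in> layer J k" using nonempty[OF J V0] frac cV by blast
        then have "{} \<in> J" using J by (auto simp: k_complex_def layer_def)
        then interpret dense_complex k \<zeta> V J using k2 \<zeta> J deg V0 cV by unfold_locales auto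
        have D: "dense_complex k \<zeta> V J" by unfold_locales
        have n1V: "n1 \<le> card V" using n cV by simp
        have latV: "?lat (card V) V J \<mu>" using lat cV by simp
        obtain \<F> where F: "finite \<F>" "\<forall>S\<in>\<F>. \<forall>T\<in>\<F>. S \<noteq> T \<longrightarrow> S \<inter> T = {}"
            "\<forall>T\<in>\<F>. T \<subseteq> V \<and> matchable H T" "real (card (\<Union>\<F>)) \<le> \<epsilon> * real n"
            "\<forall>Q\<subseteq>V. card Q = k \<longrightarrow> \<alpha> * real n \<le> real (card {T\<in>\<F>. absorbs H T Q})"
          using fam[THEN spec, THEN spec, THEN mp, THEN mp, THEN mp, OF D n1V latV] unfolding cV
          by (elim exE conjE) (rule that)
        define U where "U = V - \<Union>\<F>"
        have FV: "\<Union>\<F> \<subseteq> V" using F(3) by blast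
        have finF: "finite (\<Union>\<F>)" using FV finV finite_subset by blast
        have "card U = card V - card (\<Union>\<F>)" unfolding U_def using FV finF by (simp add: card_Diff_subset)
        moreover have "card (\<Union>\<F>) \<le> card V" using FV finV by (intro card_mono)
        ultimately have "card U + card (\<Union>\<F>) = n" using cV by simp
        then have "real (card U) + real (card (\<Union>\<F>)) = real n" by linarith
        then have cU: "real n - \<epsilon> * real n \<le> real (card U)" using F(4) by linarith
        have "\<epsilon> * real n \<le> 1/2 * real n" using par by (intro mult_right_mono) auto
        then have N0U: "N0 \<le> card U" using cU n by linarith
        have UV: "U \<subseteq> V" unfolding U_def by auto
        let ?E = "layer (induced J U) k"
        \<comment> \<open>(i) is used for the vertices that the absorbers leave free, so the nibble
          cannot touch the family.\<close>
        obtain m g where mg: "?frac U J \<gamma> m g" using frac UV cU by blast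
        have EU: "\<forall>e\<in>?E. e \<subseteq> U \<and> card e = k" and EH: "?E \<subseteq> H" by (auto simp: layer_def induced_def)
        obtain M where M: "M \<subseteq> ?E" "\<forall>e\<in>M. \<forall>f\<in>M. e \<noteq> f \<longrightarrow> e \<inter> f = {}" "real (card (U - \<Union>M)) \<le> \<alpha> * real (card U)"
          using nib[THEN spec, THEN spec, THEN spec, THEN spec, THEN mp, THEN mp, THEN mp, THEN mp, THEN mp, THEN mp,
            OF finite_subset[OF UV finV] N0U EU mg[THEN conjunct1] mg[THEN conjunct2, THEN conjunct1] mg[THEN conjunct2, THEN conjunct2]]
          by (elim exE conjE) (rule that)
        define R where "R = U - \<Union>M"
        have MU: "\<Union>M \<subseteq> U" using M(1) EU by blast
        have finM: "finite (\<Union>M)" using MU UV finV by (meson finite_subset)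
        have mM: "matchable H (\<Union>M)" 
          unfolding matchable_def perfect_matching_def
          by (intro exI[of _ M] conjI M(2) refl subset_trans[OF M(1) EH])
        have mF: "matchable H (\<Union>\<F>)" using F(1,2,3) by (intro matchable_Union) auto
        have V_eq: "V = (\<Union>\<F> \<union> \<Union>M) \<union> R" and disj: "\<Union>\<F> \<inter> \<Union>M = {}" "R \<inter> \<Union>\<F> = {}" "R \<inter> \<Union>M = {}"
          using FV MU UV unfolding R_def U_def by blast+
        have finR: "finite R" unfolding R_def using UV finV by (meson Diff_subset finite_subset)
        \<comment> \<open>All vertices outside R are matched, so divisibility of n passes to
          R.\<close>
        have "k dvd card (\<Union>\<F> \<union> \<Union>M)"
          using matchable_Un[OF mF mM disj(1)] finF finM edge_H(2) by (intro dvd_card_matchable) auto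
        moreover have "card V = card (\<Union>\<F> \<union> \<Union>M) + card R"
          by (subst V_eq, rule card_Un_disjoint) (use finF finM finR disj in auto)
        ultimately have "k dvd card R" using dvd cV by (metis dvd_add_right_iff)
        then obtain q where q: "card R = k * q" by blast
        have "matchable H (\<Union>\<F> \<union> R)"
        proof (rule matchable_absorbing_family[OF _ F(1)])
          fix Q assume Q: "Q \<subseteq> R" "card Q = k"
          \<comment> \<open>R consists of q k-sets, and q \<le> \<open>card R\<close> \<le> \<alpha>
            n, which is the number of absorbers guaranteed for each of them.\<close>
          have "1 * q \<le> k * q" using k1 by (intro mult_le_mono1)
          then have "real q \<le> real (card R)" unfolding q by (simp only: mult_1 of_nat_le_iff)
          also have "\<dots> \<le> \<alpha> * real (card U)" using M(3) unfolding R_def .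
          also have "\<dots> \<le> \<alpha> * real n" using \<alpha> UV finV cV by (intro mult_left_mono) (auto simp: card_mono)
          also have "\<dots> \<le> real (card {T\<in>\<F>. absorbs H T Q})" using F(5) Q UV unfolding R_def by blast
          finally show "q \<le> card {T\<in>\<F>. absorbs H T Q}" by simp
        qed (use F k1 finR q disj in auto)
        then have "matchable H ((\<Union>\<F> \<union> R) \<union> \<Union>M)" by (rule matchable_Un[OF _ mM]) (use disj in auto)
        moreover have "(\<Union>\<F> \<union> R) \<union> \<Union>M = V" using V_eq by auto
        ultimately show "\<exists>M. perfect_matching V (layer J k) M" unfolding matchable_def by simp
      qed
    qed
  qed
  show "\<exists>a0::real. a0 > 0 \<and> (\<forall>\<gamma> \<epsilon> \<mu>::real.
      0 < \<gamma> \<and> \<gamma> \<le> a0 \<and> 0 < \<epsilon> \<and> \<epsilon> \<le> a0 \<and> 0 < \<mu> \<and> \<mu> \<le> a0 \<longrightarrow>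
      (\<exists>n0::nat. \<forall>n\<ge>n0. \<forall>(V::'a set) (J::'a set set).
         k dvd n \<and> card V = n \<and> k_complex k V J \<and> min_deg_cond k J n \<zeta>
         \<and> ?frac_all n V J \<gamma> \<epsilon> \<and> ?lat n V J \<mu>
         \<longrightarrow> (\<exists>M. perfect_matching V (layer J k) M)))"
  \<comment> \<open>\<zeta> / 2 ensures \<mu> < \<zeta>, and 1 / 2 is the bound on
    \<epsilon>.\<close>
  proof (rule exI[of _ "min (\<zeta> / 2) (1 / 2)"], intro conjI allI impI)
    show "0 < min (\<zeta> / 2) (1 / 2)" using \<zeta> by simp
    fix \<gamma> \<epsilon> \<mu> :: real
    assume "0 < \<gamma> \<and> \<gamma> \<le> min (\<zeta> / 2) (1 / 2) \<and> 0 < \<epsilon> \<and> \<epsilon> \<le> min (\<zeta> / 2) (1 / 2) \<and> 0 < \<mu> \<and> \<mu> \<le> min (\<zeta> / 2) (1 / 2)"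
    then have "0 < \<gamma>" "0 < \<epsilon>" "\<epsilon> \<le> 1/2" "0 < \<mu>" "\<mu> < \<zeta>" using \<zeta> by auto
    then show "\<exists>n0::nat. \<forall>n\<ge>n0. \<forall>(V::'a set) (J::'a set set).
         k dvd n \<and> card V = n \<and> k_complex k V J \<and> min_deg_cond k J n \<zeta>
         \<and> ?frac_all n V J \<gamma> \<epsilon> \<and> ?lat n V J \<mu>
         \<longrightarrow> (\<exists>M. perfect_matching V (layer J k) M)"
      by (rule main)
  qed
qed

end
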